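(* Let $(\mathcal V,\mathcal E)$ be a finite connected directed graph with at least one boundary vertex ($\mathcal V_\partial\neq\emptyset$), with edge lengths $0<l^e<\infty$ for $e\in\mathcal E$, and let $a,b,c\in L^2(\mathcal E)$ satisfy $C_0\le a,b,c\le C_1$ a.e. on $\mathcal E$ for some constants $C_0,C_1>0$. Let $V_h=P_1(T_h(\mathcal E))\cap H(\mathrm{div})$ and $Q_h=P_0(T_h(\mathcal E))$ be the finite element spaces over a mesh $T_h(\mathcal E)$ with global mesh size $h$. Let $\bar f,\bar g\in L^2(\mathcal E)$, let $(\bar u,\bar p)\in H(\mathrm{div})\times H^1_0$ be the unique solution of $$\partial_x'\bar p+a\bar u=\bar f,\qquad\partial_x'\bar u=\bar g\qquad\text{on }\mathcal E,$$ and let $(\bar u_h,\bar p_h)\in V_h\times Q_h$ be the unique solution of $$(a\bar u_h,\bar v_h)_{\mathcal E}-(\bar p_h,\partial_x'\bar v_h)_{\mathcal E}=(\bar f,\bar v_h)_{\mathcal E}\quad\forall\bar v_h\in V_h,\qquad(\partial_x'\bar u_h,\bar q_h)_{\mathcal E}=(\bar g,\bar q_h)_{\mathcal E}\quad\forall\bar q_h\in Q_h.$$ Then for $0\le m\le1$ $$\|\bar u-\bar u_h\|_{H(\mathrm{div})}+\|\bar p-\bar p_h\|_{L^2}\le Ch^m\big(\|\bar u\|_{H^{m+1}(\mathcal E)}+\|\bar p\|_{H^m(\mathcal E)}\big),$$ provided that $\bar u\in H^{m+1}(\mathcal E)$ and $\bar p\in H^m(\mathcal E)$. The constant $C$ depends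 only on the network geometry and topology and on the bounds $C_0,C_1$ for the coefficients.
   Context: Network notation: $\mathcal E\subset\mathcal V\times\mathcal V$, the two end vertices of each edge being distinct; connectedness ignores edge orientation. $\mathcal E(v)$ is the set of edges having $v$ as an end vertex; $\mathcal V_0=\{v:|\mathcal E(v)|\ge2\}$ are the interior vertices and $\mathcal V_\partial=\mathcal V\setminus\mathcal V_0$ the boundary vertices. For $e\in\mathcal E$: $n^e(v)=-1$ if $e=(v,\cdot)$, $n^e(v)=1$ if $e=(\cdot,v)$, and $n^e(v)=0$ otherwise. Each edge $e=(v_l,v_r)$ is identified with the interval $[0,l^e]$, $v_l$ with $0$ and $v_r$ with $l^e$; for a function $w$ on the network, $w^e=w|_e$ and $w^e(v)$ is the value (trace) of $w^e$ at the endpoint corresponding to $v$. Function spaces: $L^2=L^2(\mathcal E)=\{w: w^e\in L^2(e)\ \forall e\}$ with $(w,z)_{\mathcal E}=\sum_e(w^e,z^e)_{L^2(e)}$ and norm $\|\cdot\|_{L^2}$; $H^s(\mathcal E)=\{w: w^e\in H^s(e)\ \forall e\}$ with the corresponding broken norm; $\partial_x' w$ is the edgewise derivative, $(\partial_x' w)|_e=\partial_x w^e$. $H^1_0=\{p\in H^1(\mathcal E): p^e(v)=p^{e'}(v)\ \forall e,e'\in\mathcal E(v),v\in\mathcal V_0;\ p^e(v)=0\ \forall v\in\mathcal V_\partial, e\in\mathcal E(v)\}$. $H(\mathrm{div})=\{u\in H^1(\mathcal E):\sum_{e\in\mathcal E(v)}n^e(v)u^e(v)=0\ \forall v\in\mathcal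 V_0\}$ with norm $\|u\|_{H(\mathrm{div})}^2=\|u\|_{L^2}^2+\|\partial_x'u\|_{L^2}^2$. Mesh: each edge $e\cong[0,l^e]$ carries a uniform mesh $T_h(e)$ of subintervals of length $h^e$; $T_h(\mathcal E)=\{T_h(e):e\in\mathcal E\}$ and $h=\max_eh^e$. $P_k(T_h(\mathcal E))$ is the space of $w\in L^2(\mathcal E)$ whose restriction to every subinterval is a polynomial of degree $\le k$. *)

theory Defs
  imports "HOL-Analysis.Analysis" "HOL-Computational_Algebra.Polynomial"
begin

section \<open>Networks\<close>

text \<open>An edge is an ordered pair of vertices; \<open>l e\<close> is the length of the edge \<open>e\<close>.\<close>

definition network :: "'v set \<Rightarrow> ('v \<times> 'v) set \<Rightarrow> ('v \<times> 'v \<Rightarrow> real) \<Rightarrow> bool" where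
  "network V E l \<longleftrightarrow>
     finite V \<and> V \<noteq> {} \<and> E \<subseteq> V \<times> V \<and> (\<forall>e\<in>E. fst e \<noteq> snd e) \<and>
     (\<forall>v\<in>V. \<forall>w\<in>V. (v, w) \<in> (E \<union> E\<inverse>)\<^sup>*) \<and>
     (\<forall>e\<in>E. 0 < l e)"

definition incident_edges :: "('v \<times> 'v) set \<Rightarrow> 'v \<Rightarrow> ('v \<times> 'v) set" where
  "incident_edges E v = {e \<in> E. fst e = v \<or> snd e = v}"

definition interior_vertices :: "'v set \<Rightarrow> ('v \<times> 'v) set \<Rightarrow> 'v set" where
  "interior_vertices V E = {v \<in> V. 2 \<le> card (incident_edges E v)}"

definition boundary_vertices :: "'v set \<Rightarrow> ('v \<times> 'v) set \<Rightarrow> 'v set" where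
  "boundary_vertices V E = V - interior_vertices V E"

definition incidence :: "'v \<times> 'v \<Rightarrow> 'v \<Rightarrow> real" where
  "incidence e v = (if v = fst e then -1 else if v = snd e then 1 else 0)"

section \<open>Lebesgue and Sobolev spaces on an interval\<close>

text \<open>Elements of \<open>L\<^sup>2(0,L)\<close> are represented by functions on the reals of which only the values
  on \<open>[0,L]\<close>, up to null sets, matter.  All notions below are invariant under
  modification on null sets.\<close>

definition L2_ivl :: "real \<Rightarrow> (real \<Rightarrow> real) set" where
  "L2_ivl L = {w. w \<in> borel_measurable (lebesgue_on {0..L}) \<and>
                  integrable (lebesgue_on {0..L}) (\<lambda>x. (w x)\<^sup>2)}"

definition inner_L2_ivl :: "real \<Rightarrow> (real \<Rightarrow> real) \<Rightarrow> (real \<Rightarrow> real) \<Rightarrow> real" where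
  "inner_L2_ivl L w z = (\<integral>x. w x * z x \<partial>(lebesgue_on {0..L}))"

text \<open>Continuously differentiable functions with compact support in the open interval
  \<open>(0,L)\<close>, as in Brezis' treatment of one-dimensional Sobolev spaces.\<close>

definition test_functions :: "real \<Rightarrow> (real \<Rightarrow> real) set" where
  "test_functions L = {\<phi>. \<phi> C1_differentiable_on UNIV \<and>
     (\<exists>\<alpha> \<beta>. 0 < \<alpha> \<and> \<beta> < L \<and> (\<forall>x. x \<notin> {\<alpha>..\<beta>} \<longrightarrow> \<phi> x = 0))}"

definition has_weak_deriv :: "real \<Rightarrow> (real \<Rightarrow> real) \<Rightarrow> (real \<Rightarrow> real) \<Rightarrow> bool" where
  "has_weak_deriv L w g \<longleftrightarrow>
     (\<forall>\<phi>\<in>test_functions L. inner_L2_ivl L w (deriv \<phi>) = - inner_L2_ivl L g \<phi>)"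

definition weak_deriv :: "real \<Rightarrow> (real \<Rightarrow> real) \<Rightarrow> real \<Rightarrow> real" where
  "weak_deriv L w = (SOME g. g \<in> L2_ivl L \<and> has_weak_deriv L w g)"

primrec Hk_ivl :: "real \<Rightarrow> nat \<Rightarrow> (real \<Rightarrow> real) set" where
  "Hk_ivl L 0 = L2_ivl L"
| "Hk_ivl L (Suc k) = {w \<in> L2_ivl L. \<exists>g\<in>Hk_ivl L k. has_weak_deriv L w g}"

text \<open>Sobolev--Slobodeckij spaces of real order \<open>s \<ge> 0\<close>: for non-integer \<open>s\<close> the weak
  derivative of order \<open>\<lfloor>s\<rfloor>\<close> has a finite Gagliardo seminorm of order \<open>frac s\<close>.\<close>

definition gagliardo_kernel :: "real \<Rightarrow> (real \<Rightarrow> real) \<Rightarrow> real \<times> real \<Rightarrow> real" where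
  "gagliardo_kernel \<theta> w = (\<lambda>(x, y). (w x - w y)\<^sup>2 / \<bar>x - y\<bar> powr (1 + 2 * \<theta>))"

definition Hs_ivl :: "real \<Rightarrow> real \<Rightarrow> (real \<Rightarrow> real) set" where
  "Hs_ivl L s = {w \<in> Hk_ivl L (nat \<lfloor>s\<rfloor>). 0 < frac s \<longrightarrow>
     integrable (lebesgue_on {0..L} \<Otimes>\<^sub>M lebesgue_on {0..L})
       (gagliardo_kernel (frac s) ((weak_deriv L ^^ nat \<lfloor>s\<rfloor>) w))}"

definition Hs_norm_sq_ivl :: "real \<Rightarrow> real \<Rightarrow> (real \<Rightarrow> real) \<Rightarrow> real" where
  "Hs_norm_sq_ivl L s w =
     (\<Sum>j\<le>nat \<lfloor>s\<rfloor>. inner_L2_ivl L ((weak_deriv L ^^ j) w) ((weak_deriv L ^^ j) w)) +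
     (if 0 < frac s
      then \<integral>z. gagliardo_kernel (frac s) ((weak_deriv L ^^ nat \<lfloor>s\<rfloor>) w) z
             \<partial>(lebesgue_on {0..L} \<Otimes>\<^sub>M lebesgue_on {0..L})
      else 0)"

text \<open>Point value at \<open>x \<in> [0,L]\<close> of the continuous representative (which exists and is
  unique for \<open>w \<in> H\<^sup>1(0,L)\<close>).\<close>

definition trace_ivl :: "real \<Rightarrow> (real \<Rightarrow> real) \<Rightarrow> real \<Rightarrow> real" where
  "trace_ivl L w x = (THE c. \<exists>v. continuous_on {0..L} v \<and>
     (AE t in lebesgue_on {0..L}. v t = w t) \<and> v x = c)"

section \<open>Function spaces on a network\<close>

text \<open>A function on the network is a family of functions on the intervals \<open>[0, l e]\<close>.\<close>

type_synonym 'v netfun = "'v \<times> 'v \<Rightarrow> real \<Rightarrow> real"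

definition L2_net :: "('v \<times> 'v) set \<Rightarrow> ('v \<times> 'v \<Rightarrow> real) \<Rightarrow> 'v netfun set" where
  "L2_net E l = {w. \<forall>e\<in>E. w e \<in> L2_ivl (l e)}"

definition inner_net ::
  "('v \<times> 'v) set \<Rightarrow> ('v \<times> 'v \<Rightarrow> real) \<Rightarrow> 'v netfun \<Rightarrow> 'v netfun \<Rightarrow> real" where
  "inner_net E l w z = (\<Sum>e\<in>E. inner_L2_ivl (l e) (w e) (z e))"

definition norm_L2 :: "('v \<times> 'v) set \<Rightarrow> ('v \<times> 'v \<Rightarrow> real) \<Rightarrow> 'v netfun \<Rightarrow> real" where
  "norm_L2 E l w = sqrt (inner_net E l w w)"

definition Hs_net :: "('v \<times> 'v) set \<Rightarrow> ('v \<times> 'v \<Rightarrow> real) \<Rightarrow> real \<Rightarrow> 'v netfun set" where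
  "Hs_net E l s = {w. \<forall>e\<in>E. w e \<in> Hs_ivl (l e) s}"

definition norm_Hs ::
  "('v \<times> 'v) set \<Rightarrow> ('v \<times> 'v \<Rightarrow> real) \<Rightarrow> real \<Rightarrow> 'v netfun \<Rightarrow> real" where
  "norm_Hs E l s w = sqrt (\<Sum>e\<in>E. Hs_norm_sq_ivl (l e) s (w e))"

definition ddx :: "('v \<times> 'v \<Rightarrow> real) \<Rightarrow> 'v netfun \<Rightarrow> 'v netfun" where
  "ddx l w = (\<lambda>e. weak_deriv (l e) (w e))"

text \<open>For \<open>v\<close> not an end vertex of \<open>e\<close> the value of \<open>vertex_value\<close> is irrelevant.\<close>

definition vertex_value :: "('v \<times> 'v \<Rightarrow> real) \<Rightarrow> 'v netfun \<Rightarrow> 'v \<times> 'v \<Rightarrow> 'v \<Rightarrow> real" where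
  "vertex_value l w e v = trace_ivl (l e) (w e) (if v = fst e then 0 else l e)"

definition H10_net ::
  "'v set \<Rightarrow> ('v \<times> 'v) set \<Rightarrow> ('v \<times> 'v \<Rightarrow> real) \<Rightarrow> 'v netfun set" where
  "H10_net V E l = {p \<in> Hs_net E l 1.
     (\<forall>v\<in>interior_vertices V E. \<forall>e\<in>incident_edges E v. \<forall>e'\<in>incident_edges E v.
        vertex_value l p e v = vertex_value l p e' v) \<and>
     (\<forall>v\<in>boundary_vertices V E. \<forall>e\<in>incident_edges E v. vertex_value l p e v = 0)}"

definition Hdiv_net ::
  "'v set \<Rightarrow> ('v \<times> 'v) set \<Rightarrow> ('v \<times> 'v \<Rightarrow> real) \<Rightarrow> 'v netfun set" where
  "Hdiv_net V E l = {u \<in> Hs_net E l 1.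
     \<forall>v\<in>interior_vertices V E.
       (\<Sum>e\<in>incident_edges E v. incidence e v * vertex_value l u e v) = 0}"

definition norm_Hdiv :: "('v \<times> 'v) set \<Rightarrow> ('v \<times> 'v \<Rightarrow> real) \<Rightarrow> 'v netfun \<Rightarrow> real" where
  "norm_Hdiv E l u = sqrt ((norm_L2 E l u)\<^sup>2 + (norm_L2 E l (ddx l u))\<^sup>2)"

section \<open>Meshes and finite element spaces\<close>

text \<open>A uniform mesh is given by the number \<open>N e \<ge> 1\<close> of subintervals of each edge \<open>e\<close>,
  the local mesh width being \<open>l e / N e\<close>.\<close>

definition is_mesh :: "('v \<times> 'v) set \<Rightarrow> ('v \<times> 'v \<Rightarrow> nat) \<Rightarrow> bool" where
  "is_mesh E N \<longleftrightarrow> (\<forall>e\<in>E. 1 \<le> N e)"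

definition local_mesh_size :: "('v \<times> 'v \<Rightarrow> real) \<Rightarrow> ('v \<times> 'v \<Rightarrow> nat) \<Rightarrow> 'v \<times> 'v \<Rightarrow> real" where
  "local_mesh_size l N e = l e / real (N e)"

definition mesh_size ::
  "('v \<times> 'v) set \<Rightarrow> ('v \<times> 'v \<Rightarrow> real) \<Rightarrow> ('v \<times> 'v \<Rightarrow> nat) \<Rightarrow> real" where
  "mesh_size E l N = Max (local_mesh_size l N ` E)"

definition mesh :: "('v \<times> 'v \<Rightarrow> real) \<Rightarrow> ('v \<times> 'v \<Rightarrow> nat) \<Rightarrow> 'v \<times> 'v \<Rightarrow> real set set" where
  "mesh l N e =
     {{real i * local_mesh_size l N e .. real (Suc i) * local_mesh_size l N e} | i. i < N e}"

definition Pk_net ::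
  "('v \<times> 'v) set \<Rightarrow> ('v \<times> 'v \<Rightarrow> real) \<Rightarrow> ('v \<times> 'v \<Rightarrow> nat) \<Rightarrow> nat \<Rightarrow> 'v netfun set" where
  "Pk_net E l N k = {w \<in> L2_net E l. \<forall>e\<in>E. \<forall>K\<in>mesh l N e.
     \<exists>q :: real poly. degree q \<le> k \<and> (AE x in lebesgue_on K. w e x = poly q x)}"

definition Vh :: "'v set \<Rightarrow> ('v \<times> 'v) set \<Rightarrow> ('v \<times> 'v \<Rightarrow> real) \<Rightarrow> ('v \<times> 'v \<Rightarrow> nat) \<Rightarrow> 'v netfun set"
  where "Vh V E l N = Pk_net E l N 1 \<inter> Hdiv_net V E l"

definition Qh :: "('v \<times> 'v) set \<Rightarrow> ('v \<times> 'v \<Rightarrow> real) \<Rightarrow> ('v \<times> 'v \<Rightarrow> nat) \<Rightarrow> 'v netfun set" where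
  "Qh E l N = Pk_net E l N 0"

section \<open>The stationary problem and its discretization\<close>

definition bounded_coeff ::
  "('v \<times> 'v) set \<Rightarrow> ('v \<times> 'v \<Rightarrow> real) \<Rightarrow> real \<Rightarrow> real \<Rightarrow> 'v netfun \<Rightarrow> bool" where
  "bounded_coeff E l C0 C1 a \<longleftrightarrow> a \<in> L2_net E l \<and>
     (\<forall>e\<in>E. AE x in lebesgue_on {0..l e}. C0 \<le> a e x \<and> a e x \<le> C1)"

definition stationary_solution ::
  "'v set \<Rightarrow> ('v \<times> 'v) set \<Rightarrow> ('v \<times> 'v \<Rightarrow> real) \<Rightarrow> 'v netfun \<Rightarrow> 'v netfun \<Rightarrow> 'v netfun
     \<Rightarrow> 'v netfun \<Rightarrow> 'v netfun \<Rightarrow> bool" where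
  "stationary_solution V E l a f g u p \<longleftrightarrow>
     u \<in> Hdiv_net V E l \<and> p \<in> H10_net V E l \<and>
     (\<forall>e\<in>E. AE x in lebesgue_on {0..l e}. ddx l p e x + a e x * u e x = f e x) \<and>
     (\<forall>e\<in>E. AE x in lebesgue_on {0..l e}. ddx l u e x = g e x)"

definition discrete_solution ::
  "'v set \<Rightarrow> ('v \<times> 'v) set \<Rightarrow> ('v \<times> 'v \<Rightarrow> real) \<Rightarrow> ('v \<times> 'v \<Rightarrow> nat) \<Rightarrow> 'v netfun \<Rightarrow> 'v netfun
     \<Rightarrow> 'v netfun \<Rightarrow> 'v netfun \<Rightarrow> 'v netfun \<Rightarrow> bool" where
  "discrete_solution V E l N a f g uh ph \<longleftrightarrow>
     uh \<in> Vh V E l N \<and> ph \<in> Qh E l N \<and>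
     (\<forall>vh\<in>Vh V E l N.
        inner_net E l (\<lambda>e x. a e x * uh e x) vh - inner_net E l ph (ddx l vh)
          = inner_net E l f vh) \<and>
     (\<forall>qh\<in>Qh E l N. inner_net E l (ddx l uh) qh = inner_net E l g qh)"

end

theory Submission
  imports Defs
begin

text \<open>Every \<open>H\<^sup>1\<close> function on an edge is a constant plus the primitive of its weak derivative (du
  Bois-Reymond).  Hence the nodal interpolant \<open>I u\<close> of \<open>u\<close> is the primitive of the piecewise
  mean value projection \<open>P u'\<close>, it has the same vertex values as \<open>u\<close>, and
  \<open>\<parallel>u - I u\<parallel> \<le> l \<parallel>u' - P u'\<parallel>\<close>.  The second discrete equation forces \<open>u\<^sub>h' = P u' = (I u)'\<close>, so the
  test function \<open>u\<^sub>h - I u\<close> eliminates the pressure from the error equation and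
  \<open>\<parallel>u - u\<^sub>h\<parallel> \<le> (1 + C\<^sub>1 / C\<^sub>0) \<parallel>u - I u\<parallel>\<close>.  The pressure error follows from a discrete inf-sup
  condition: a piecewise constant function is integrated along each edge, and the Kirchhoff
  conditions are restored by edgewise constants that route the excess at every interior vertex along
  a path to a boundary vertex.  It remains to bound \<open>\<parallel>w - P w\<parallel>\<close> by \<open>h\<^sup>m\<close> times the \<open>H\<^sup>m\<close> norm of \<open>w\<close>:
  for \<open>m = 0\<close> \<open>P\<close> is an orthogonal projection, and for \<open>m > 0\<close> one uses Jensen's inequality on each
  cell, where points have distance at most \<open>h\<close>.\<close>

section \<open>Square integrable functions on an interval\<close>

text \<open>\<open>weak_deriv\<close> is a Hilbert choice: it is not linear and is fixed only up to
  null sets. The calculus therefore rests on primitives, where integration by parts is Fubini on a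
  square, and weak derivatives are compared almost everywhere through the primitives they generate.
  A boundary vertex is what makes the discrete divergence surjective: the net inflows of edgewise
  constants add up to zero over all vertices, so prescribing them at every interior vertex requires
  one vertex that carries no Kirchhoff condition. Fractional orders are estimated directly from the
  double integral over pairs of points in one cell instead of by interpolation of spaces; the cases
  \<open>m = 0\<close>, \<open>0 < m < 1\<close> and \<open>m = 1\<close> all have constant one on a
  single edge, so the final constant does not depend on \<open>m\<close>. It is
  \<open>1 + (1 + C1 / C0) * \<Lambda> * (1 + C1 * \<kappa>)\<close>, where the total length
  \<open>\<Lambda>\<close> bounds the operation of taking primitives and \<open>\<kappa>\<close> is
  the inf-sup constant.\<close>

abbreviation ivl :: "real \<Rightarrow> real measure" where
  "ivl L \<equiv> lebesgue_on {0..L}"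

lemma square_integrable_mult:
  fixes w z :: "'a \<Rightarrow> real"
  assumes [measurable]: "w \<in> borel_measurable M" "z \<in> borel_measurable M"
    and "integrable M (\<lambda>x. (w x)\<^sup>2)" "integrable M (\<lambda>x. (z x)\<^sup>2)"
  shows "integrable M (\<lambda>x. w x * z x)"
proof (rule Bochner_Integration.integrable_bound)
  show "integrable M (\<lambda>x. (w x)\<^sup>2 + (z x)\<^sup>2)"
    using assms by auto
  have "\<bar>a * b\<bar> \<le> a\<^sup>2 + b\<^sup>2" for a b :: real
    using sum_squares_bound[of "\<bar>a\<bar>" "\<bar>b\<bar>"] mult_nonneg_nonneg[of "\<bar>a\<bar>" "\<bar>b\<bar>"]
    by (simp add: abs_mult del: mult_nonneg_nonneg)
  then show "AE x in M. norm (w x * z x) \<le> norm ((w x)\<^sup>2 + (z x)\<^sup>2)"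
    by (intro AE_I2) (simp add: abs_of_nonneg)
qed measurable

text \<open>The numerical core of Cauchy-Schwarz, kept free of any inner product because it serves
  both the integral over a measure space and the sum over all edges.\<close>

lemma quadratic_discriminant_le:
  fixes A B C :: real
  assumes "\<And>t. 0 \<le> A + 2 * t * B + t\<^sup>2 * C" "0 \<le> C"
  shows "B\<^sup>2 \<le> A * C"
proof (cases "C = 0")
  case True
  have "B = 0"
  proof (rule ccontr)
    assume "B \<noteq> 0"
    \<comment> \<open>With \<open>C = 0\<close> the expression is affine in \<open>t\<close>; this
      \<open>t\<close> gives it the value -1.\<close>
    then show False
      using assms(1)[of "- (A + 1) / (2 * B)"] True by (simp add: field_simps)
  qed
  then show ?thesis using True by simp
next
  case False
  then have "C > 0" using assms(2) by simp
  \<comment> \<open>The quadratic attains its minimum at \<open>- B / C\<close>.\<close>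
  have "A + 2 * (- B / C) * B + (- B / C)\<^sup>2 * C = A - B\<^sup>2 / C"
    using False by (simp add: power2_eq_square field_simps)
  then have "0 \<le> A - B\<^sup>2 / C" using assms(1)[of "- B / C"] by simp
  then show ?thesis using \<open>C > 0\<close> by (simp add: field_simps)
qed

lemma Cauchy_Schwarz_integral:
  fixes w z :: "'a \<Rightarrow> real"
  assumes [measurable]: "w \<in> borel_measurable M" "z \<in> borel_measurable M"
    and w: "integrable M (\<lambda>x. (w x)\<^sup>2)" and z: "integrable M (\<lambda>x. (z x)\<^sup>2)"
  shows "(\<integral>x. w x * z x \<partial>M)\<^sup>2 \<le> (\<integral>x. (w x)\<^sup>2 \<partial>M) * (\<integral>x. (z x)\<^sup>2 \<partial>M)"
proof (rule quadratic_discriminant_le)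
  have wz: "integrable M (\<lambda>x. w x * z x)"
    by (rule square_integrable_mult) (use assms in auto)
  fix t :: real
  have "(\<integral>x. (w x + t * z x)\<^sup>2 \<partial>M)
      = (\<integral>x. (w x)\<^sup>2 + 2 * t * (w x * z x) + t\<^sup>2 * (z x)\<^sup>2 \<partial>M)"
    by (simp add: power2_eq_square algebra_simps)
  also have "\<dots> = (\<integral>x. (w x)\<^sup>2 \<partial>M) + 2 * t * (\<integral>x. w x * z x \<partial>M) + t\<^sup>2 * (\<integral>x. (z x)\<^sup>2 \<partial>M)"
    using w z wz by simp
  finally show "0 \<le> (\<integral>x. (w x)\<^sup>2 \<partial>M) + 2 * t * (\<integral>x. w x * z x \<partial>M) + t\<^sup>2 * (\<integral>x. (z x)\<^sup>2 \<partial>M)"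
    by (smt (verit) Bochner_Integration.integral_nonneg zero_le_power2)
qed simp

lemma finite_measure_ivl: "finite_measure (ivl L)"
  by (rule finite_measure_lebesgue_on) auto

lemma pair_sigma_finite_ivl: "pair_sigma_finite (ivl L) (ivl L)"
  using finite_measure_ivl[of L]
  by (simp add: pair_sigma_finite_def finite_measure_def)

lemma measurable_ident_ivl [measurable]: "(\<lambda>x. x) \<in> borel_measurable (ivl L)"
  by (rule measurable_restrict_space1) (simp add: measurable_completion)

lemma measure_ivl: "0 \<le> a \<Longrightarrow> a \<le> b \<Longrightarrow> b \<le> L \<Longrightarrow> measure (ivl L) {a..<b} = b - a"
  by (subst measure_restrict_space) auto

lemma integral_indicator_ivl:
  assumes "0 \<le> a" "a \<le> b" "b \<le> L"
  shows "(\<integral>x. indicat_real {a..<b} x \<partial>ivl L) = b - a"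
proof -
  have "{a..<b} \<inter> {0..L} = {a..<b}" using assms by auto
  then show ?thesis using measure_ivl[OF assms] by simp
qed

section \<open>Calculus of square integrable functions on one edge\<close>

lemma L2_measurable [measurable_dest]: "w \<in> L2_ivl L \<Longrightarrow> w \<in> borel_measurable (ivl L)"
  by (simp add: L2_ivl_def)

lemma L2_square_integrable: "w \<in> L2_ivl L \<Longrightarrow> integrable (ivl L) (\<lambda>x. (w x)\<^sup>2)"
  by (simp add: L2_ivl_def)

lemma L2_integrable: "w \<in> L2_ivl L \<Longrightarrow> integrable (ivl L) w"
  by (auto simp: L2_ivl_def intro: finite_measure.square_integrable_imp_integrable[OF finite_measure_ivl])

lemma L2_mult_integrable:
  "w \<in> L2_ivl L \<Longrightarrow> z \<in> L2_ivl L \<Longrightarrow> integrable (ivl L) (\<lambda>x. w x * z x)"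
  by (auto simp: L2_ivl_def intro: square_integrable_mult)

lemma L2_add: "w \<in> L2_ivl L \<Longrightarrow> z \<in> L2_ivl L \<Longrightarrow> (\<lambda>x. w x + z x) \<in> L2_ivl L"
  using L2_mult_integrable[of w L z]
  by (auto simp: L2_ivl_def power2_sum mult.assoc)

lemma L2_diff: "w \<in> L2_ivl L \<Longrightarrow> z \<in> L2_ivl L \<Longrightarrow> (\<lambda>x. w x - z x) \<in> L2_ivl L"
  using L2_mult_integrable[of w L z]
  by (auto simp: L2_ivl_def power2_diff mult.assoc)

lemma L2_cmult: "w \<in> L2_ivl L \<Longrightarrow> (\<lambda>x. c * w x) \<in> L2_ivl L"
  by (auto simp: L2_ivl_def power_mult_distrib)

text \<open>One domination argument for three uses: \<open>w\<close> an indicator, \<open>w\<close>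
  a coefficient, or (with \<open>z\<close> constant one) \<open>w\<close> any bounded
  function.\<close>

lemma L2_bounded_mult:
  assumes [measurable]: "w \<in> borel_measurable (ivl L)" and z: "z \<in> L2_ivl L"
    and b: "AE x in ivl L. \<bar>w x\<bar> \<le> B"
  shows "(\<lambda>x. w x * z x) \<in> L2_ivl L"
proof -
  have [measurable]: "z \<in> borel_measurable (ivl L)" using z by (rule L2_measurable)
  have "integrable (ivl L) (\<lambda>x. (w x * z x)\<^sup>2)"
  proof (rule Bochner_Integration.integrable_bound)
    show "integrable (ivl L) (\<lambda>x. B\<^sup>2 * (z x)\<^sup>2)"
      using z by (simp add: L2_ivl_def)
    show "AE x in ivl L. norm ((w x * z x)\<^sup>2) \<le> norm (B\<^sup>2 * (z x)\<^sup>2)"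
      using b
    proof eventually_elim
      case (elim x)
      have "\<bar>w x\<bar>\<^sup>2 \<le> B\<^sup>2" using elim by (intro power_mono) auto
      then have "(w x)\<^sup>2 * (z x)\<^sup>2 \<le> B\<^sup>2 * (z x)\<^sup>2" by (intro mult_right_mono) auto
      then show ?case by (simp add: power_mult_distrib)
    qed
  qed measurable
  then show ?thesis by (simp add: L2_ivl_def)
qed

lemma L2_const: "(\<lambda>x. c) \<in> L2_ivl L"
  using finite_measure_ivl[of L] by (auto simp: L2_ivl_def finite_measure.integrable_const)

lemma L2_bounded:
  assumes "w \<in> borel_measurable (ivl L)" "AE x in ivl L. \<bar>w x\<bar> \<le> B"
  shows "w \<in> L2_ivl L"
  using L2_bounded_mult[OF assms(1) L2_const[of 1 L] assms(2)] by simp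

lemma continuous_on_L2:
  assumes "continuous_on {0..L} w"
  shows "w \<in> L2_ivl L"
proof -
  obtain B where "\<And>x. x \<in> {0..L} \<Longrightarrow> \<bar>w x\<bar> \<le> B"
    using compact_imp_bounded[OF compact_continuous_image[OF assms]]
    by (force simp: bounded_iff)
  then show ?thesis
    by (intro L2_bounded[of _ _ B] continuous_imp_measurable_on_sets_lebesgue assms)
      (auto intro!: AE_I2)
qed

lemma inner_L2_commute: "inner_L2_ivl L w z = inner_L2_ivl L z w"
  by (simp add: inner_L2_ivl_def mult.commute)

lemma inner_L2_add_right:
  "w \<in> L2_ivl L \<Longrightarrow> z \<in> L2_ivl L \<Longrightarrow> z' \<in> L2_ivl L \<Longrightarrow>
    inner_L2_ivl L w (\<lambda>x. z x + z' x) = inner_L2_ivl L w z + inner_L2_ivl L w z'"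
  using L2_mult_integrable by (simp add: inner_L2_ivl_def algebra_simps)

lemma inner_L2_diff_right:
  "w \<in> L2_ivl L \<Longrightarrow> z \<in> L2_ivl L \<Longrightarrow> z' \<in> L2_ivl L \<Longrightarrow>
    inner_L2_ivl L w (\<lambda>x. z x - z' x) = inner_L2_ivl L w z - inner_L2_ivl L w z'"
  using L2_mult_integrable by (simp add: inner_L2_ivl_def algebra_simps)

lemma inner_L2_diff_left:
  "w \<in> L2_ivl L \<Longrightarrow> z \<in> L2_ivl L \<Longrightarrow> z' \<in> L2_ivl L \<Longrightarrow>
    inner_L2_ivl L (\<lambda>x. z x - z' x) w = inner_L2_ivl L z w - inner_L2_ivl L z' w"
  using inner_L2_diff_right by (metis inner_L2_commute)

lemma inner_L2_add_left:
  "w \<in> L2_ivl L \<Longrightarrow> z \<in> L2_ivl L \<Longrightarrow> z' \<in> L2_ivl L \<Longrightarrow>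
    inner_L2_ivl L (\<lambda>x. z x + z' x) w = inner_L2_ivl L z w + inner_L2_ivl L z' w"
  using inner_L2_add_right by (metis inner_L2_commute)

lemma inner_L2_cmult_right: "inner_L2_ivl L w (\<lambda>x. c * z x) = c * inner_L2_ivl L w z"
  by (simp add: inner_L2_ivl_def mult.left_commute)

lemma inner_L2_cong_AE:
  assumes "w \<in> L2_ivl L" "w' \<in> L2_ivl L" "z \<in> L2_ivl L" "z' \<in> L2_ivl L"
    and "AE x in ivl L. w x = w' x" "AE x in ivl L. z x = z' x"
  shows "inner_L2_ivl L w z = inner_L2_ivl L w' z'"
proof -
  note [measurable] = assms(1-4)[THEN L2_measurable]
  show ?thesis
    unfolding inner_L2_ivl_def using assms(5,6) by (intro integral_cong_AE) auto
qed

lemma inner_L2_nonneg: "0 \<le> inner_L2_ivl L w w"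
  by (simp add: inner_L2_ivl_def)

lemma inner_L2_self: "inner_L2_ivl L w w = (\<integral>x. (w x)\<^sup>2 \<partial>ivl L)"
  by (simp add: inner_L2_ivl_def power2_eq_square)

lemma Cauchy_Schwarz_L2:
  "w \<in> L2_ivl L \<Longrightarrow> z \<in> L2_ivl L \<Longrightarrow>
    (inner_L2_ivl L w z)\<^sup>2 \<le> inner_L2_ivl L w w * inner_L2_ivl L z z"
  unfolding inner_L2_self unfolding inner_L2_ivl_def
  by (rule Cauchy_Schwarz_integral) (auto simp: L2_ivl_def)

section \<open>Primitives\<close>

text \<open>The indicator keeps the measure space independent of \<open>x\<close>. This makes the
  primitive a section integral of a function of two variables, ready for Fubini, and additivity in
  integrable \<open>g\<close> holds at every real \<open>x\<close>.\<close>

definition primitive :: "real \<Rightarrow> (real \<Rightarrow> real) \<Rightarrow> real \<Rightarrow> real" where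
  "primitive L g x = (\<integral>t. indicat_real {..x} t * g t \<partial>ivl L)"

lemma integrable_indicator_mult:
  fixes g :: "real \<Rightarrow> real"
  assumes "integrable (ivl L) g" "A \<in> sets borel"
  shows "integrable (ivl L) (\<lambda>t. indicat_real A t * g t)"
proof -
  have [measurable]: "indicat_real A \<in> borel_measurable (ivl L)"
    using assms(2) measurable_compose[OF measurable_ident_ivl, of "indicat_real A" borel L] by simp
  show ?thesis
    using assms(1)
    by (rule Bochner_Integration.integrable_bound)
      (use assms(1) in measurable, auto simp: indicator_def)
qed

lemma primitive_eq_integral_lebesgue_on:
  assumes "0 \<le> x" "x \<le> L"
  shows "primitive L g x = integral\<^sup>L (ivl x) g"
proof -
  have "primitive L g x = (\<integral>t. (if t \<in> {0..x} then g t else 0) \<partial>ivl L)"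
    unfolding primitive_def
    by (rule Bochner_Integration.integral_cong) (auto simp: indicator_def)
  also have "\<dots> = integral\<^sup>L (ivl x) g"
    using assms by (subst Lebesgue_Measure.integral_restrict) auto
  finally show ?thesis .
qed

lemma primitive_0: "0 \<le> L \<Longrightarrow> primitive L g 0 = 0"
  by (subst primitive_eq_integral_lebesgue_on) (auto intro!: integral_eq_zero_null_sets)

lemma primitive_right: "primitive L g L = (\<integral>t. g t \<partial>ivl L)"
  unfolding primitive_def by (rule Bochner_Integration.integral_cong) auto

lemma continuous_on_primitive:
  assumes "integrable (ivl L) g"
  shows "continuous_on {0..L} (primitive L g)"
  using indefinite_integral_continuous_real[OF assms]
  by (rule continuous_on_eq) (simp add: primitive_eq_integral_lebesgue_on)

lemma primitive_L2: "integrable (ivl L) g \<Longrightarrow> primitive L g \<in> L2_ivl L"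
  by (intro continuous_on_L2 continuous_on_primitive)

lemma primitive_diff:
  assumes "integrable (ivl L) g" "integrable (ivl L) h"
  shows "primitive L (\<lambda>x. g x - h x) x = primitive L g x - primitive L h x"
  using integrable_indicator_mult[OF assms(1), of "{..x}"] integrable_indicator_mult[OF assms(2), of "{..x}"]
  by (simp add: primitive_def algebra_simps)

lemma primitive_increment:
  assumes "integrable (ivl L) g" "x \<le> y"
  shows "primitive L g y - primitive L g x = (\<integral>t. indicat_real {x<..y} t * g t \<partial>ivl L)"
proof -
  have "(\<lambda>t. indicat_real {x<..y} t * g t) = (\<lambda>t. indicat_real {..y} t * g t - indicat_real {..x} t * g t)"
    using assms(2) by (auto simp: indicator_def fun_eq_iff)
  then show ?thesis
    using integrable_indicator_mult[OF assms(1), of "{..x}"] integrable_indicator_mult[OF assms(1), of "{..y}"]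
    by (simp add: primitive_def)
qed

lemma indicator_L2: "A \<in> sets borel \<Longrightarrow> indicat_real A \<in> L2_ivl L"
  using measurable_compose[OF measurable_ident_ivl, of "indicat_real A" borel L]
  by (intro L2_bounded[of _ _ 1]) auto

lemma indicator_mult_L2:
  "A \<in> sets borel \<Longrightarrow> g \<in> L2_ivl L \<Longrightarrow> (\<lambda>x. indicat_real A x * g x) \<in> L2_ivl L"
  by (rule L2_bounded_mult[where B = 1]) (auto intro: L2_measurable indicator_L2)

text \<open>Cauchy-Schwarz for the indicator of \<open>{x<..y}\<close> against the restriction of
  \<open>g\<close>. The integral on the right stays on \<open>{x<..y}\<close>; this locality lets
  the cell estimates add up to one global norm.\<close>

lemma primitive_increment_square_le:
  assumes g: "g \<in> L2_ivl L" and xy: "0 \<le> x" "x \<le> y" "y \<le> L"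
  shows "(primitive L g y - primitive L g x)\<^sup>2
    \<le> (y - x) * (\<integral>t. indicat_real {x<..y} t * (g t)\<^sup>2 \<partial>ivl L)"
proof -
  let ?i = "indicat_real {x<..y}"
  have eq: "?i t * ?i t = ?i t" "(?i t * g t) * (?i t * g t) = ?i t * (g t)\<^sup>2"
    "?i t * (?i t * g t) = ?i t * g t" for t
    by (auto simp: indicator_def power2_eq_square)
  have "measure (ivl L) {x<..y} = y - x"
    using xy by (subst measure_restrict_space) auto
  then have "inner_L2_ivl L ?i ?i = y - x"
    using xy by (auto simp: inner_L2_ivl_def eq Int_absorb2 subset_iff)
  moreover have "inner_L2_ivl L (\<lambda>t. ?i t * g t) (\<lambda>t. ?i t * g t) = (\<integral>t. ?i t * (g t)\<^sup>2 \<partial>ivl L)"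
    by (simp add: inner_L2_ivl_def eq)
  moreover have "inner_L2_ivl L ?i (\<lambda>t. ?i t * g t) = primitive L g y - primitive L g x"
    using primitive_increment[OF L2_integrable[OF g] xy(2)] by (simp add: inner_L2_ivl_def eq)
  ultimately show ?thesis
    using Cauchy_Schwarz_L2[OF indicator_L2 indicator_mult_L2[OF _ g], of "{x<..y}" "{x<..y}"] by simp
qed

lemma AE_ivl_neq: "AE x in ivl L. x \<noteq> y"
proof -
  have "AE x in lebesgue. x \<notin> {y}"
    by (intro AE_not_in) (simp add: negligible_iff_null_sets[symmetric])
  then show ?thesis
    by (subst AE_restrict_space_iff) auto
qed

lemma integral_indicator_mult_le:
  fixes h :: "real \<Rightarrow> real"
  assumes "A \<in> sets borel" "integrable (ivl L) h" "\<And>t. 0 \<le> h t"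
  shows "(\<integral>t. indicat_real A t * h t \<partial>ivl L) \<le> (\<integral>t. h t \<partial>ivl L)"
  using assms by (intro integral_mono integrable_indicator_mult) (auto simp: indicator_def)

lemma primitive_square_le:
  assumes g: "g \<in> L2_ivl L" and x: "0 \<le> x" "x \<le> L"
  shows "(primitive L g x)\<^sup>2 \<le> L * inner_L2_ivl L g g"
proof -
  let ?J = "\<integral>t. indicat_real {0<..x} t * (g t)\<^sup>2 \<partial>ivl L"
  have "(primitive L g x)\<^sup>2 \<le> x * ?J"
    using primitive_increment_square_le[OF g order.refl x] x by (simp add: primitive_0)
  also have "\<dots> \<le> L * ?J"
    using x by (intro mult_right_mono Bochner_Integration.integral_nonneg) auto
  also have "\<dots> \<le> L * inner_L2_ivl L g g"
    unfolding inner_L2_self using x g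
    by (intro mult_left_mono integral_indicator_mult_le) (auto simp: L2_ivl_def)
  finally show ?thesis .
qed

lemma inner_primitive_le:
  assumes g: "g \<in> L2_ivl L" and L: "0 \<le> L"
  shows "inner_L2_ivl L (primitive L g) (primitive L g) \<le> L\<^sup>2 * inner_L2_ivl L g g"
proof -
  have "inner_L2_ivl L (primitive L g) (primitive L g) \<le> (\<integral>x. L * inner_L2_ivl L g g \<partial>ivl L)"
    unfolding inner_L2_self[of L "primitive L g"]
    using primitive_L2[OF L2_integrable[OF g]] L2_integrable[OF L2_const]
    by (intro integral_mono) (auto simp: L2_ivl_def intro: primitive_square_le[OF g])
  also have "\<dots> = L\<^sup>2 * inner_L2_ivl L g g"
    using L by (simp add: power2_eq_square measure_restrict_space)
  finally show ?thesis .
qed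

text \<open>Half lines are an intersection-stable generator of the Borel sets, so vanishing
  integrals over \<open>{..x}\<close> pass to all Borel sets by induction over complements and
  disjoint unions. A Lebesgue set differs from an F-sigma subset only by a null set, and a function
  whose integral over every measurable set is zero vanishes almost everywhere.\<close>

lemma AE_eq_0_of_primitive_eq_0:
  assumes g: "integrable (ivl L) g" and zero: "\<And>x. 0 \<le> x \<Longrightarrow> x \<le> L \<Longrightarrow> primitive L g x = 0"
    and L: "0 \<le> L"
  shows "AE x in ivl L. g x = 0"
proof (rule sigma_finite_measure.density_zero[OF _ g])
  show "sigma_finite_measure (ivl L)"
    using finite_measure_ivl[of L] by (simp add: finite_measure_def)
next
  have total: "(\<integral>x. g x \<partial>ivl L) = 0"
    using zero[of L] L by (simp add: primitive_right)
  have borel: "(\<integral>x. indicat_real A x * g x \<partial>ivl L) = 0" if "A \<in> sets borel" for A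
  proof -
    have "Int_stable (range (\<lambda>a::real. {..a}))"
    proof (rule Int_stableI_image)
      fix a b :: real show "\<exists>c\<in>UNIV. {..a} \<inter> {..b} = {..c}"
        by (intro bexI[of _ "min a b"]) auto
    qed
    moreover have "range (\<lambda>a::real. {..a}) \<subseteq> Pow UNIV" by simp
    moreover have "A \<in> sigma_sets UNIV (range (\<lambda>a::real. {..a}))"
      using that by (simp add: borel_eq_atMost)
    ultimately show ?thesis
    proof (induction rule: sigma_sets_induct_disjoint)
      case (basic A)
      then obtain x where x: "A = {..x}" by auto
      \<comment> \<open>The hypothesis covers only \<open>[0, L]\<close>: to the left of it the
        integrand is zero, to the right the integral is the total one.\<close>
      consider "x < 0" | "0 \<le> x" "x \<le> L" | "L < x" by linarith
      then show ?case
      proof cases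
        case 1
        then have "(\<integral>t. indicat_real A t * g t \<partial>ivl L) = (\<integral>t. 0 \<partial>ivl L)"
          unfolding x by (intro Bochner_Integration.integral_cong) auto
        then show ?thesis by simp
      next
        case 2
        then show ?thesis using zero[of x] by (simp add: primitive_def x)
      next
        case 3
        then have "(\<integral>t. indicat_real A t * g t \<partial>ivl L) = (\<integral>t. g t \<partial>ivl L)"
          unfolding x by (intro Bochner_Integration.integral_cong) auto
        then show ?thesis using total by simp
      qed
    next
      case (compl A)
      then have A: "A \<in> sets borel" by (simp add: borel_eq_atMost)
      have "(\<lambda>x. indicat_real (UNIV - A) x * g x) = (\<lambda>x. g x - indicat_real A x * g x)"
        by (auto simp: indicator_def)
      then show ?case
        using compl total g integrable_indicator_mult[OF g A] by simp
    next
      case (union A)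
      then have A: "A i \<in> sets borel" for i by (auto simp: borel_eq_atMost)
      \<comment> \<open>Members of the sigma-algebra of \<open>ivl L\<close> are subsets of
        \<open>{0..L}\<close>, so the sets are cut down before countable additivity is
        applied.\<close>
      let ?B = "\<lambda>i. A i \<inter> {0..L}"
      have AB: "(\<integral>t. indicat_real C t * g t \<partial>ivl L) = (\<integral>t\<in>C \<inter> {0..L}. g t \<partial>ivl L)" for C
        unfolding set_lebesgue_integral_def
        by (intro Bochner_Integration.integral_cong) (auto simp: indicator_def)
      have sets: "?B i \<in> sets (ivl L)" for i
        unfolding sets_restrict_space by (rule image_eqI[of _ _ "A i"]) (use A[of i] in auto)
      have "(\<integral>t\<in>(\<Union>i. ?B i). g t \<partial>ivl L) = (\<Sum>i. (\<integral>t\<in>?B i. g t \<partial>ivl L))"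
      proof (rule lebesgue_integral_countable_add)
        show "?B i \<inter> ?B j = {}" if "i \<noteq> j" for i j
          using union(1) that by (auto simp: disjoint_family_on_def)
        show "set_integrable (ivl L) (\<Union>i. ?B i) g"
          unfolding set_integrable_def by (intro integrable_mult_indicator sets.countable_UN g) (use sets in blast)
      qed (rule sets)
      also have "(\<lambda>i. \<integral>t\<in>?B i. g t \<partial>ivl L) = (\<lambda>i. 0)"
        using union(3) by (simp add: AB)
      finally show ?case by (simp add: AB)
    qed simp
  qed
  fix A assume A: "A \<in> sets (ivl L)"
  then have AL: "A \<in> sets lebesgue" "A \<subseteq> {0..L}"
    by (auto simp: sets_restrict_space)
  then obtain C where C: "C \<in> sets borel" "C \<subseteq> A" "A - C \<in> null_sets lebesgue"
  proof -
    obtain C T where CT: "fsigma C" "T \<in> null_sets lebesgue" "C \<union> T = A" "disjnt C T"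
      using lebesgue_set_almost_fsigma[OF AL(1)] .
    then have "A - C = T" by (auto simp: disjnt_iff)
    moreover have "C \<in> sets borel"
      using CT(1) by (auto elim!: fsigma.cases intro!: sets.countable_UN intro: borel_closed)
    ultimately show ?thesis using that CT by blast
  qed
  have "AE x in ivl L. x \<notin> A - C"
    using AL C(3) by (intro AE_not_in) (auto simp: null_sets_restrict_space)
  then have "(\<integral>x\<in>A. g x \<partial>ivl L) = (\<integral>x. indicat_real C x * g x \<partial>ivl L)"
    unfolding set_lebesgue_integral_def
    using integrable_mult_indicator[OF A g] integrable_indicator_mult[OF g C(1)] C(2)
    by (intro integral_cong_AE) (auto elim!: eventually_mono simp: indicator_def)
  then show "(\<integral>x\<in>A. g x \<partial>ivl L) = 0"
    using borel[OF C(1)] by simp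
qed

text \<open>Fubini for \<open>g x * k y\<close> on the triangle \<open>y \<le> x\<close>: the inner
  integral is a primitive of \<open>k\<close> in one order, and the total integral of
  \<open>g\<close> minus its primitive in the other.\<close>

lemma primitive_integration_by_parts:
  assumes g: "integrable (ivl L) g" and k: "integrable (ivl L) k"
  shows "(\<integral>x. g x * primitive L k x \<partial>ivl L) + (\<integral>x. primitive L g x * k x \<partial>ivl L)
    = (\<integral>x. g x \<partial>ivl L) * (\<integral>x. k x \<partial>ivl L)"
proof -
  interpret pair_sigma_finite "ivl L" "ivl L" by (rule pair_sigma_finite_ivl)
  have [measurable]: "g \<in> borel_measurable (ivl L)" "k \<in> borel_measurable (ivl L)"
    using g k by auto
  let ?F = "\<lambda>x y. of_bool (y \<le> x) * (g x * k y) :: real"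
  have F_meas: "(\<lambda>(x, y). ?F x y) \<in> borel_measurable (ivl L \<Otimes>\<^sub>M ivl L)"
    by measurable
  have P_meas: "(\<lambda>(x, y). g x * k y) \<in> borel_measurable (ivl L \<Otimes>\<^sub>M ivl L)"
    by measurable
  have P: "integrable (ivl L \<Otimes>\<^sub>M ivl L) (\<lambda>(x, y). g x * k y)"
    using P_meas
  proof (rule Fubini_integrable)
    show "integrable (ivl L) (\<lambda>x. \<integral>y. norm (case (x, y) of (x, y) \<Rightarrow> g x * k y) \<partial>ivl L)"
      using g by (simp add: abs_mult)
  qed (use k in auto)
  have F: "integrable (ivl L \<Otimes>\<^sub>M ivl L) (\<lambda>(x, y). ?F x y)"
    using P F_meas by (rule Bochner_Integration.integrable_bound) auto
  have "(\<integral>x. g x * primitive L k x \<partial>ivl L) = (\<integral>x. (\<integral>y. ?F x y \<partial>ivl L) \<partial>ivl L)"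
  proof (intro Bochner_Integration.integral_cong refl)
    fix x
    have "(\<lambda>y. ?F x y) = (\<lambda>y. g x * (indicat_real {..x} y * k y))"
      by (auto simp: indicator_def)
    then show "g x * primitive L k x = (\<integral>y. ?F x y \<partial>ivl L)"
      by (simp add: primitive_def)
  qed
  also have "\<dots> = (\<integral>y. (\<integral>x. ?F x y \<partial>ivl L) \<partial>ivl L)"
    using Fubini_integral[OF F] by simp
  also have "\<dots> = (\<integral>y. (\<integral>x. g x \<partial>ivl L) * k y - primitive L g y * k y \<partial>ivl L)"
  proof (intro Bochner_Integration.integral_cong refl)
    fix y
    \<comment> \<open>As functions of \<open>x\<close>, the indicator of \<open>y \<le> x\<close>
      and that of the complement of \<open>{..y}\<close> differ only at the diagonal point
      \<open>x = y\<close>.\<close>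
    have "AE x in ivl L. x \<noteq> y"
      by (rule AE_ivl_neq)
    then have "(\<integral>x. ?F x y \<partial>ivl L) = (\<integral>x. (g x - indicat_real {..y} x * g x) * k y \<partial>ivl L)"
    proof (intro integral_cong_AE)
      assume "AE x in ivl L. x \<noteq> y"
      then show "AE x in ivl L. ?F x y = (g x - indicat_real {..y} x * g x) * k y"
        by eventually_elim (auto simp: indicator_def)
    qed (use integrable_indicator_mult[OF g, of "{..y}"] in auto)
    also have "\<dots> = (\<integral>x. g x \<partial>ivl L) * k y - primitive L g y * k y"
      using integrable_indicator_mult[OF g, of "{..y}"] g by (simp add: primitive_def left_diff_distrib)
    finally show "(\<integral>x. ?F x y \<partial>ivl L) = (\<integral>x. g x \<partial>ivl L) * k y - primitive L g y * k y" .
  qed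
  also have "\<dots> = (\<integral>x. g x \<partial>ivl L) * (\<integral>x. k x \<partial>ivl L) - (\<integral>x. primitive L g x * k x \<partial>ivl L)"
  proof -
    \<comment> \<open>\<open>g\<close> and \<open>k\<close> are merely integrable, but a primitive
      is continuous and hence bounded on the compact interval, which makes the product
      integrable.\<close>
    obtain B where B: "\<And>x. x \<in> {0..L} \<Longrightarrow> \<bar>primitive L g x\<bar> \<le> B"
      using compact_imp_bounded[OF compact_continuous_image[OF continuous_on_primitive[OF g]]]
      by (force simp: bounded_iff)
    have "integrable (ivl L) (\<lambda>x. primitive L g x * k x)"
    proof (rule Bochner_Integration.integrable_bound)
      show "integrable (ivl L) (\<lambda>x. B * k x)" using k by simp
      show "(\<lambda>x. primitive L g x * k x) \<in> borel_measurable (ivl L)"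
        using L2_measurable[OF primitive_L2[OF g]] by measurable
      show "AE x in ivl L. norm (primitive L g x * k x) \<le> norm (B * k x)"
        using B by (intro AE_I2) (fastforce simp: abs_mult intro!: mult_right_mono)
    qed
    then show ?thesis using k by simp
  qed
  finally show ?thesis by simp
qed

section \<open>Weak derivatives and traces\<close>

text \<open>A test function is used only as the primitive of its derivative. That derivative has
  mean zero because both end values vanish, and the mean zero is what removes additive constants and
  boundary terms.\<close>

lemma test_function_primitive:
  assumes "\<phi> \<in> test_functions L" "0 < L"
  shows "continuous_on UNIV (deriv \<phi>)"
    and "\<And>x. x \<in> {0..L} \<Longrightarrow> \<phi> x = primitive L (deriv \<phi>) x"
    and "(\<integral>x. deriv \<phi> x \<partial>ivl L) = 0"
proof -
  obtain D where D: "\<And>x. (\<phi> has_vector_derivative D x) (at x)" "continuous_on UNIV D"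
    using assms(1) by (auto simp: test_functions_def C1_differentiable_on_def)
  have "deriv \<phi> = D"
    using D(1) by (auto simp: has_real_derivative_iff_has_vector_derivative[symmetric] intro: DERIV_imp_deriv)
  then show cont: "continuous_on UNIV (deriv \<phi>)" using D(2) by simp
  obtain \<alpha> \<beta> where "0 < \<alpha>" "\<beta> < L" "\<forall>x. x \<notin> {\<alpha>..\<beta>} \<longrightarrow> \<phi> x = 0"
    using assms(1) by (auto simp: test_functions_def)
  then have zero: "\<phi> 0 = 0" "\<phi> L = 0" by auto
  show prim: "\<phi> x = primitive L (deriv \<phi>) x" if "x \<in> {0..L}" for x
  proof -
    have "(deriv \<phi> has_integral \<phi> x - \<phi> 0) {0..x}"
      unfolding \<open>deriv \<phi> = D\<close>
      using that by (intro fundamental_theorem_of_calculus) (auto intro: has_vector_derivative_at_within D)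
    then have "integral {0..x} (deriv \<phi>) = \<phi> x"
      using zero by (simp add: integral_unique)
    moreover have "integrable (ivl x) (deriv \<phi>)"
      by (intro L2_integrable continuous_on_L2 continuous_on_subset[OF cont]) auto
    ultimately show ?thesis
      using that by (simp add: primitive_eq_integral_lebesgue_on lebesgue_integral_eq_integral)
  qed
  then show "(\<integral>x. deriv \<phi> x \<partial>ivl L) = 0"
    using prim[of L] zero assms(2) by (simp add: primitive_right)
qed

lemma has_weak_deriv_primitive:
  assumes g: "g \<in> L2_ivl L" and L: "0 < L"
  shows "has_weak_deriv L (\<lambda>x. c + primitive L g x) g"
  unfolding has_weak_deriv_def
proof
  fix \<phi> assume "\<phi> \<in> test_functions L"
  note \<phi> = test_function_primitive[OF this L]
  have D: "deriv \<phi> \<in> L2_ivl L"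
    by (intro continuous_on_L2 continuous_on_subset[OF \<phi>(1)]) auto
  have "inner_L2_ivl L g \<phi> = (\<integral>x. g x * primitive L (deriv \<phi>) x \<partial>ivl L)"
    unfolding inner_L2_ivl_def by (intro Bochner_Integration.integral_cong) (auto simp: \<phi>(2))
  moreover have "inner_L2_ivl L (\<lambda>x. c + primitive L g x) (deriv \<phi>)
      = (\<integral>x. primitive L g x * deriv \<phi> x \<partial>ivl L)"
    using L2_integrable[OF D] L2_mult_integrable[OF primitive_L2[OF L2_integrable[OF g]] D] \<phi>(3)
    by (simp add: inner_L2_ivl_def distrib_right)
  ultimately show "inner_L2_ivl L (\<lambda>x. c + primitive L g x) (deriv \<phi>) = - inner_L2_ivl L g \<phi>"
    using primitive_integration_by_parts[OF L2_integrable[OF g] L2_integrable[OF D]] \<phi>(3) by simp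
qed

text \<open>Mean zero is exactly what brings the antiderivative back to zero beyond
  \<open>\<beta>\<close>; since test functions are only required to be C1, continuity of
  \<open>\<zeta>\<close> is enough.\<close>

lemma ex_test_function_deriv_eq:
  fixes \<zeta> :: "real \<Rightarrow> real"
  assumes cont: "continuous_on UNIV \<zeta>" and \<alpha>\<beta>: "0 < \<alpha>" "\<alpha> \<le> \<beta>" "\<beta> < L"
    and zero: "\<And>x. x \<le> \<alpha> \<Longrightarrow> \<zeta> x = 0" "\<And>x. \<beta> \<le> x \<Longrightarrow> \<zeta> x = 0"
    and int: "(\<integral>x. \<zeta> x \<partial>ivl L) = 0"
  obtains \<phi> where "\<phi> \<in> test_functions L" "deriv \<phi> = \<zeta>"
proof -
  \<comment> \<open>The lower limit lies left of the support of \<open>\<zeta>\<close>; for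
    \<open>x < -1\<close> the interval is empty and the integral is zero too.\<close>
  define \<phi> where "\<phi> x = integral {-1..x} \<zeta>" for x
  have int0: "integral {a..b} \<zeta> = 0" if "\<And>x. x \<in> {a..b} \<Longrightarrow> \<zeta> x = 0" for a b
    using that has_integral_is_0[of "{a..b}" \<zeta>] by (simp add: integral_unique)
  have io: "\<zeta> integrable_on {a..b}" for a b
    by (intro integrable_continuous_real continuous_on_subset[OF cont]) auto
  have left: "\<phi> x = 0" if "x \<le> \<alpha>" for x
    unfolding \<phi>_def using that zero(1) by (intro int0) auto
  have D: "(\<phi> has_vector_derivative \<zeta> x) (at x)" for x
  proof (cases "x < \<alpha>")
    case True
    have "((\<lambda>x. 0) has_vector_derivative \<zeta> x) (at x)"
      using True zero(1) by simp
    then show ?thesis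
      by (rule has_vector_derivative_transform_within_open[of _ _ _ "{..<\<alpha>}"])
        (use True left in auto)
  next
    case False
    have "(\<phi> has_vector_derivative \<zeta> x) (at x within {-1..x+1})"
      unfolding \<phi>_def using False \<alpha>\<beta>
      by (intro integral_has_vector_derivative continuous_on_subset[OF cont]) auto
    moreover have "at x within {-1..x+1} = at x"
      using False \<alpha>\<beta> by (intro at_within_interior) (auto simp: interior_atLeastAtMost_real)
    ultimately show ?thesis by simp
  qed
  have split: "\<phi> y = \<phi> x + integral {x..y} \<zeta>" if "-1 \<le> x" "x \<le> y" for x y
    unfolding \<phi>_def using that by (intro Henstock_Kurzweil_Integration.integral_combine[symmetric] io) auto
  have "\<phi> L = integral {0..L} \<zeta>"
    using split[of 0 L] left[of 0] \<alpha>\<beta> by simp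
  also have "\<dots> = 0"
    using int lebesgue_integral_eq_integral[of "{0..L}" \<zeta>]
      L2_integrable[OF continuous_on_L2[OF continuous_on_subset[OF cont]], of L] by simp
  finally have "\<phi> L = 0" .
  moreover have "\<phi> x = \<phi> \<beta>" if "\<beta> \<le> x" for x
    using split[of \<beta> x] that \<alpha>\<beta> zero(2) by (subst split[of \<beta> x]) (auto intro!: int0)
  ultimately have right: "\<phi> x = 0" if "\<beta> \<le> x" for x
    using that \<alpha>\<beta> by (metis less_eq_real_def)
  have "\<phi> C1_differentiable_on UNIV"
    unfolding C1_differentiable_on_def using D cont by blast
  moreover have "\<forall>x. x \<notin> {\<alpha>..\<beta>} \<longrightarrow> \<phi> x = 0"
    using left right by (meson atLeastAtMost_iff linear)
  ultimately have "\<phi> \<in> test_functions L"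
    unfolding test_functions_def using \<alpha>\<beta> by blast
  moreover have "deriv \<phi> = \<zeta>"
    using D by (auto simp: has_real_derivative_iff_has_vector_derivative[symmetric] intro: DERIV_imp_deriv)
  ultimately show ?thesis by (rule that)
qed

text \<open>A continuous \<open>\<eta>\<close> becomes the derivative of a test function once a
  multiple of a fixed bump \<open>\<psi>\<close> is subtracted to make its mean zero; pairing that
  multiple with \<open>w\<close> produces the constant \<open>k\<close>. Letting
  \<open>\<eta>\<close> tend to the indicator of \<open>(0, b)\<close> shows that the primitive of
  \<open>w - k\<close> vanishes at every \<open>b\<close>.\<close>

lemma du_Bois_Reymond:
  assumes w: "w \<in> L2_ivl L" and L: "0 < L"
    and orth: "\<And>\<phi>. \<phi> \<in> test_functions L \<Longrightarrow> inner_L2_ivl L w (deriv \<phi>) = 0"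
  obtains k where "AE x in ivl L. w x = k"
proof -
  \<comment> \<open>A hat supported in \<open>[L/4, 3L/4]\<close>, continuous and of positive
    integral.\<close>
  define \<psi> where "\<psi> x = max 0 (L / 4 - \<bar>x - L / 2\<bar>)" for x
  have cont_\<psi>: "continuous_on S \<psi>" for S
    unfolding \<psi>_def by (intro continuous_intros)
  have \<psi>: "\<psi> \<in> L2_ivl L" by (intro continuous_on_L2 cont_\<psi>)
  define I where "I = (\<integral>x. \<psi> x \<partial>ivl L)"
  have "I > 0"
  proof -
    \<comment> \<open>On the middle quarter of the edge the hat is at least
      \<open>L/8\<close>.\<close>
    have "(\<integral>x. indicat_real {3/8*L..<5/8*L} x * (L/8) \<partial>ivl L) \<le> I"
      unfolding I_def using L
      by (intro integral_mono L2_integrable \<psi> integrable_indicator_mult L2_const)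
        (auto simp: indicator_def \<psi>_def abs_if)
    moreover have "(\<integral>x. indicat_real {3/8*L..<5/8*L} x * (L/8) \<partial>ivl L) = L/4 * (L/8)"
      using L by (subst Bochner_Integration.integral_mult_left_zero)
        (simp add: measure_ivl Int_absorb2 subset_iff)
    ultimately show ?thesis using L by (smt (verit) divide_pos_pos mult_pos_pos)
  qed
  define k where "k = inner_L2_ivl L w \<psi> / I"
  have ortho: "(\<integral>x. (w x - k) * \<eta> x \<partial>ivl L) = 0"
    if \<eta>: "continuous_on UNIV \<eta>" "0 < \<alpha>" "\<beta> < L"
      "\<And>x. x \<le> \<alpha> \<Longrightarrow> \<eta> x = 0" "\<And>x. \<beta> \<le> x \<Longrightarrow> \<eta> x = 0" for \<eta> \<alpha> \<beta>
  proof -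
    have \<eta>2: "\<eta> \<in> L2_ivl L"
      by (intro continuous_on_L2 continuous_on_subset[OF \<eta>(1)]) auto
    define J where "J = (\<integral>x. \<eta> x \<partial>ivl L)"
    let ?\<zeta> = "\<lambda>x. \<eta> x - J / I * \<psi> x"
    have "(\<integral>x. ?\<zeta> x \<partial>ivl L) = 0"
      using L2_integrable[OF \<eta>2] L2_integrable[OF \<psi>] \<open>I > 0\<close> by (simp add: I_def[symmetric] J_def)
    moreover have "continuous_on UNIV ?\<zeta>"
      by (intro continuous_intros \<eta> cont_\<psi>)
    moreover have "?\<zeta> x = 0" if "x \<le> min \<alpha> (L/4)" for x
      using that \<eta>(4) L by (simp add: \<psi>_def abs_if)
    moreover have "?\<zeta> x = 0" if "max \<beta> (3/4*L) \<le> x" for x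
      using that \<eta>(5) L by (simp add: \<psi>_def abs_if)
    \<comment> \<open>Enlarging the interval so that it contains the support of
      \<open>\<psi>\<close> also puts its ends in order; \<open>\<alpha>\<close> itself may exceed
      \<open>\<beta>\<close>.\<close>
    moreover have "0 < min \<alpha> (L/4)" "min \<alpha> (L/4) \<le> max \<beta> (3/4*L)" "max \<beta> (3/4*L) < L"
      using \<eta>(2,3) L by auto
    ultimately obtain \<phi> where "\<phi> \<in> test_functions L" "deriv \<phi> = ?\<zeta>"
      using ex_test_function_deriv_eq[of ?\<zeta>] by blast
    then have "inner_L2_ivl L w ?\<zeta> = 0" using orth by metis
    also have "inner_L2_ivl L w ?\<zeta> = inner_L2_ivl L w \<eta> - J / I * inner_L2_ivl L w \<psi>"
      by (simp only: inner_L2_diff_right[OF w \<eta>2 L2_cmult[OF \<psi>]] inner_L2_cmult_right)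
    finally have "inner_L2_ivl L w \<eta> = k * J" by (simp add: k_def)
    then show ?thesis
      using L2_mult_integrable[OF w \<eta>2] L2_integrable[OF \<eta>2]
      by (simp add: inner_L2_ivl_def left_diff_distrib J_def)
  qed
  have wk: "integrable (ivl L) (\<lambda>x. w x - k)"
    by (intro L2_integrable L2_diff w L2_const)
  have "AE x in ivl L. w x - k = 0"
  proof (rule AE_eq_0_of_primitive_eq_0[OF wk])
    fix b assume b: "0 \<le> b" "b \<le> L"
    \<comment> \<open>Trapezoids of slope \<open>n + 1\<close>, vanishing up to
      \<open>1 / (n + 1)\<close> and from \<open>b - 1 / (n + 1)\<close> on. They are bounded by
      one, tend to the indicator of \<open>(0, b)\<close>, and stay away from \<open>L\<close> even
      for \<open>b = L\<close>.\<close>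
    define \<eta> where "\<eta> n x = min 1 (max 0 (min (real (Suc n) * x - 1) (real (Suc n) * (b - x) - 1)))" for n x
    have \<eta>_lim: "(\<lambda>n. \<eta> n x) \<longlonglongrightarrow> indicat_real {0<..<b} x" for x
    proof (cases "x \<in> {0<..<b}")
      case True
      obtain n0 where n0: "real n0 > 2 / x" "real n0 > 2 / (b - x)"
        using reals_Archimedean2[of "max (2 / x) (2 / (b - x))"] by auto
      have "\<eta> n x = 1" if "n \<ge> n0" for n
      proof -
        have "real (Suc n) > 2 / x" "real (Suc n) > 2 / (b - x)" using n0 that by linarith+
        then have "real (Suc n) * x > 2" "real (Suc n) * (b - x) > 2"
          using True by (auto simp: pos_divide_less_eq simp del: of_nat_Suc)
        then show ?thesis by (simp add: \<eta>_def del: of_nat_Suc)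
      qed
      then show ?thesis
        using True by (intro tendsto_eventually eventually_sequentiallyI[of n0]) auto
    next
      case False
      then have "x \<le> 0 \<or> b \<le> x" by auto
      then have "real (Suc n) * x - 1 \<le> 0 \<or> real (Suc n) * (b - x) - 1 \<le> 0" for n
        by (smt (verit, best) mult_nonneg_nonpos of_nat_0_le_iff)
      then have "\<eta> n x = 0" for n
        unfolding \<eta>_def by (smt (verit, best))
      then show ?thesis using False by simp
    qed
    have \<eta>_cont: "continuous_on S (\<eta> n)" for n S
      unfolding \<eta>_def by (intro continuous_intros)
    have zero: "(\<integral>x. (w x - k) * \<eta> n x \<partial>ivl L) = 0" for n
    proof (rule ortho[OF \<eta>_cont])
      show "0 < 1 / real (Suc n)" by simp
      have "0 < 1 / real (Suc n)" by simp
      then show "b - 1 / real (Suc n) < L" using b by linarith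
      show "\<eta> n x = 0" if "x \<le> 1 / real (Suc n)" for x
      proof -
        have "real (Suc n) * x \<le> 1" using that by (simp add: field_simps)
        then show ?thesis by (simp add: \<eta>_def del: of_nat_Suc)
      qed
      show "\<eta> n x = 0" if "b - 1 / real (Suc n) \<le> x" for x
      proof -
        have "real (Suc n) * (b - x) \<le> 1" using that by (simp add: field_simps)
        then show ?thesis by (simp add: \<eta>_def del: of_nat_Suc)
      qed
    qed
    have "(\<lambda>n. \<integral>x. (w x - k) * \<eta> n x \<partial>ivl L) \<longlonglongrightarrow> (\<integral>x. (w x - k) * indicat_real {0<..<b} x \<partial>ivl L)"
    proof (rule integral_dominated_convergence)
      note [measurable] = L2_measurable[OF w] L2_measurable[OF continuous_on_L2[OF \<eta>_cont]]
        L2_measurable[OF indicator_L2]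
      show "(\<lambda>x. (w x - k) * indicat_real {0<..<b} x) \<in> borel_measurable (ivl L)"
        by measurable
      show "(\<lambda>x. (w x - k) * \<eta> n x) \<in> borel_measurable (ivl L)" for n
        by measurable
      show "integrable (ivl L) (\<lambda>x. \<bar>w x - k\<bar>)" using wk by simp
      show "AE x in ivl L. (\<lambda>n. (w x - k) * \<eta> n x) \<longlonglongrightarrow> (w x - k) * indicat_real {0<..<b} x"
        by (intro AE_I2 tendsto_intros \<eta>_lim)
      have "\<bar>\<eta> n x\<bar> \<le> 1" for n x by (simp add: \<eta>_def)
      then show "AE x in ivl L. norm ((w x - k) * \<eta> n x) \<le> \<bar>w x - k\<bar>" for n
        by (intro AE_I2) (simp add: abs_mult mult_left_le)
    qed
    then have "(\<integral>x. (w x - k) * indicat_real {0<..<b} x \<partial>ivl L) = 0"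
      unfolding zero using LIMSEQ_unique tendsto_const by blast
    moreover have "primitive L (\<lambda>x. w x - k) b = (\<integral>x. (w x - k) * indicat_real {0<..<b} x \<partial>ivl L)"
      unfolding primitive_def
    proof (rule integral_cong_AE)
      show "AE x in ivl L. indicat_real {..b} x * (w x - k) = (w x - k) * indicat_real {0<..<b} x"
        using AE_ivl_neq[of 0 L] AE_ivl_neq[of b L] AE_space
        by eventually_elim (auto simp: indicator_def)
    qed (use integrable_indicator_mult[OF wk, of "{..b}"] integrable_indicator_mult[OF wk, of "{0<..<b}"]
        in \<open>auto simp: mult.commute\<close>)
    ultimately show "primitive L (\<lambda>x. w x - k) b = 0" by simp
  qed (use L in simp)
  then show ?thesis by (intro that[of k]) simp
qed

lemma weak_deriv_representation:
  assumes w: "w \<in> L2_ivl L" and g: "g \<in> L2_ivl L" and wg: "has_weak_deriv L w g" and L: "0 < L"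
  obtains c where "AE x in ivl L. w x = c + primitive L g x"
proof -
  note G = primitive_L2[OF L2_integrable[OF g]]
  obtain k where "AE x in ivl L. w x - primitive L g x = k"
  proof (rule du_Bois_Reymond[OF L2_diff[OF w G] L])
    fix \<phi> assume \<phi>: "\<phi> \<in> test_functions L"
    have D: "deriv \<phi> \<in> L2_ivl L"
      by (intro continuous_on_L2 continuous_on_subset[OF test_function_primitive(1)[OF \<phi> L]]) auto
    show "inner_L2_ivl L (\<lambda>x. w x - primitive L g x) (deriv \<phi>) = 0"
      using wg has_weak_deriv_primitive[OF g L, of 0] \<phi>
      by (simp add: inner_L2_diff_left[OF D w G] has_weak_deriv_def)
  qed
  then show ?thesis by (intro that[of k]) (auto elim!: eventually_mono)
qed

text \<open>Stated for an arbitrary interval because it is applied to whole edges and to single mesh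
  cells: the continuous function \<open>\<bar>v x - w x\<bar>\<close> has integral zero.\<close>

lemma AE_eq_imp_eq_on_interval:
  fixes v w :: "real \<Rightarrow> real"
  assumes "continuous_on {a..b} v" "continuous_on {a..b} w" "AE x in lebesgue_on {a..b}. v x = w x"
    and "a < b" and x: "x \<in> {a..b}"
  shows "v x = w x"
proof -
  have *: "continuous_on {a..b} (\<lambda>x. \<bar>v x - w x\<bar>)"
    by (intro continuous_intros assms)
  have "(\<integral>x. \<bar>v x - w x\<bar> \<partial>lebesgue_on {a..b}) = 0"
    using assms(3) by (intro integral_eq_zero_AE) auto
  then show ?thesis
    using integralL_eq_0_iff[of a b "\<lambda>x. \<bar>v x - w x\<bar>"] * x \<open>a < b\<close> by simp
qed

lemma primitive_affine_unique:
  assumes g: "g \<in> L2_ivl L" and h: "h \<in> L2_ivl L" and L: "0 < L"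
    and AE: "AE x in ivl L. c + primitive L g x = d + primitive L h x"
  shows "c = d" and "AE x in ivl L. g x = h x"
proof -
  note gh = L2_integrable[OF g] L2_integrable[OF h]
  have eq: "c + primitive L g x = d + primitive L h x" if "x \<in> {0..L}" for x
    by (rule AE_eq_imp_eq_on_interval[OF _ _ AE L that])
      (intro continuous_intros continuous_on_primitive gh)+
  then show "c = d" using eq[of 0] L by (simp add: primitive_0)
  then have "AE x in ivl L. g x - h x = 0"
    using gh eq L by (intro AE_eq_0_of_primitive_eq_0) (auto simp: primitive_diff)
  then show "AE x in ivl L. g x = h x" by simp
qed

text \<open>The two representations as constant plus primitive agree almost everywhere, hence
  everywhere by continuity, which identifies the integrands. Identities for the chosen
  \<open>weak_deriv\<close> are obtained from this.\<close>

lemma weak_deriv_unique: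
  assumes "w \<in> L2_ivl L" "w' \<in> L2_ivl L" "g \<in> L2_ivl L" "h \<in> L2_ivl L" "AE x in ivl L. w x = w' x"
    "has_weak_deriv L w g" "has_weak_deriv L w' h" "0 < L"
  shows "AE x in ivl L. g x = h x"
proof -
  obtain c where c: "AE x in ivl L. w x = c + primitive L g x"
    using weak_deriv_representation[OF assms(1,3,6,8)] .
  obtain d where d: "AE x in ivl L. w' x = d + primitive L h x"
    using weak_deriv_representation[OF assms(2,4,7,8)] .
  show ?thesis
    by (rule primitive_affine_unique[OF assms(3,4,8), of c d])
      (use assms(5) c d in eventually_elim, auto)
qed

section \<open>Weak derivatives, traces and integration by parts in H1 of an edge\<close>

lemma Hs_ivl_1: "w \<in> Hs_ivl L 1 \<longleftrightarrow> w \<in> L2_ivl L \<and> (\<exists>g\<in>L2_ivl L. has_weak_deriv L w g)"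
  by (simp add: Hs_ivl_def)

lemma Hs_ivl_1_L2: "w \<in> Hs_ivl L 1 \<Longrightarrow> w \<in> L2_ivl L"
  by (simp add: Hs_ivl_1)

lemma
  assumes "w \<in> Hs_ivl L 1"
  shows weak_deriv_L2: "weak_deriv L w \<in> L2_ivl L"
    and has_weak_deriv_weak_deriv: "has_weak_deriv L w (weak_deriv L w)"
  using someI_ex[of "\<lambda>g. g \<in> L2_ivl L \<and> has_weak_deriv L w g"] assms
  by (auto simp: Hs_ivl_1 weak_deriv_def)

text \<open>A nondegenerate interval admits only one continuous representative, so the definite
  description is evaluated by exhibiting any of them.\<close>

lemma trace_ivl_eq:
  assumes "continuous_on {0..L} v" "AE x in ivl L. w x = v x" "0 < L" "x \<in> {0..L}"
  shows "trace_ivl L w x = v x"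
  unfolding trace_ivl_def
proof (rule the_equality)
  show "\<exists>v'. continuous_on {0..L} v' \<and> (AE t in ivl L. v' t = w t) \<and> v' x = v x"
    using assms by (intro exI[of _ v]) (auto elim!: eventually_mono)
  show "c = v x" if c: "\<exists>v'. continuous_on {0..L} v' \<and> (AE t in ivl L. v' t = w t) \<and> v' x = c" for c
  proof -
    from c obtain v' where v': "continuous_on {0..L} v'" "AE t in ivl L. v' t = w t" "v' x = c" by auto
    have "AE t in ivl L. v' t = v t" using v'(2) assms(2) by eventually_elim simp
    then show ?thesis
      using AE_eq_imp_eq_on_interval[OF v'(1) assms(1) _ assms(3,4)] v'(3) by simp
  qed
qed

text \<open>The constant of the representation is the trace at \<open>0\<close>, because primitives
  vanish there; all other traces then follow from it and the weak derivative.\<close>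

lemma
  assumes w: "w \<in> Hs_ivl L 1" and L: "0 < L"
  shows H1_representation: "AE x in ivl L. w x = trace_ivl L w 0 + primitive L (weak_deriv L w) x"
    and trace_eq_primitive: "\<And>x. x \<in> {0..L} \<Longrightarrow> trace_ivl L w x = trace_ivl L w 0 + primitive L (weak_deriv L w) x"
proof -
  note g = weak_deriv_L2[OF w]
  obtain c where c: "AE x in ivl L. w x = c + primitive L (weak_deriv L w) x"
    using weak_deriv_representation[OF Hs_ivl_1_L2[OF w] g has_weak_deriv_weak_deriv[OF w] L] .
  have cont: "continuous_on {0..L} (\<lambda>x. c + primitive L (weak_deriv L w) x)"
    by (intro continuous_intros continuous_on_primitive L2_integrable g)
  note tr = trace_ivl_eq[OF cont c L]
  have "trace_ivl L w 0 = c" using tr[of 0] L by (simp add: primitive_0)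
  then show "AE x in ivl L. w x = trace_ivl L w 0 + primitive L (weak_deriv L w) x"
    "\<And>x. x \<in> {0..L} \<Longrightarrow> trace_ivl L w x = trace_ivl L w 0 + primitive L (weak_deriv L w) x"
    using c tr by simp_all
qed

text \<open>The converse construction, by which the interpolant and the inf-sup function are built.
  The chosen weak derivative returns \<open>g\<close> only almost everywhere.\<close>

lemma
  assumes g: "g \<in> L2_ivl L" and L: "0 < L"
  shows primitive_Hs_1: "(\<lambda>x. c + primitive L g x) \<in> Hs_ivl L 1"
    and weak_deriv_primitive: "AE x in ivl L. weak_deriv L (\<lambda>x. c + primitive L g x) x = g x"
    and trace_primitive: "\<And>x. x \<in> {0..L} \<Longrightarrow> trace_ivl L (\<lambda>x. c + primitive L g x) x = c + primitive L g x"
proof -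
  have L2: "(\<lambda>x. c + primitive L g x) \<in> L2_ivl L"
    by (intro L2_add L2_const primitive_L2 L2_integrable g)
  show H1: "(\<lambda>x. c + primitive L g x) \<in> Hs_ivl L 1"
    using has_weak_deriv_primitive[OF g L] g L2 by (auto simp: Hs_ivl_1)
  show "AE x in ivl L. weak_deriv L (\<lambda>x. c + primitive L g x) x = g x"
    by (rule weak_deriv_unique[OF L2 L2 weak_deriv_L2[OF H1] g _
          has_weak_deriv_weak_deriv[OF H1] has_weak_deriv_primitive[OF g L] L]) simp
  show "trace_ivl L (\<lambda>x. c + primitive L g x) x = c + primitive L g x" if "x \<in> {0..L}" for x
    by (rule trace_ivl_eq[OF _ _ L that]) (intro continuous_intros continuous_on_primitive L2_integrable g, simp)
qed

lemma has_weak_deriv_diff: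
  assumes "w \<in> L2_ivl L" "z \<in> L2_ivl L" "g \<in> L2_ivl L" "h \<in> L2_ivl L"
    "has_weak_deriv L w g" "has_weak_deriv L z h" "0 < L"
  shows "has_weak_deriv L (\<lambda>x. w x - z x) (\<lambda>x. g x - h x)"
  unfolding has_weak_deriv_def
proof
  fix \<phi> assume \<phi>: "\<phi> \<in> test_functions L"
  have D: "deriv \<phi> \<in> L2_ivl L"
    by (intro continuous_on_L2 continuous_on_subset[OF test_function_primitive(1)[OF \<phi> assms(7)]]) auto
  have "\<phi> \<in> L2_ivl L"
    using \<phi> by (intro continuous_on_L2) (auto simp: test_functions_def intro: continuous_on_subset C1_differentiable_imp_continuous_on)
  then show "inner_L2_ivl L (\<lambda>x. w x - z x) (deriv \<phi>) = - inner_L2_ivl L (\<lambda>x. g x - h x) \<phi>"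
    using assms \<phi> by (simp add: inner_L2_diff_left D has_weak_deriv_def)
qed

text \<open>Linearity holds only almost everywhere, because the representatives chosen for the three
  weak derivatives are unrelated.\<close>

lemma
  assumes w: "w \<in> Hs_ivl L 1" and z: "z \<in> Hs_ivl L 1" and L: "0 < L"
  shows Hs_1_diff: "(\<lambda>x. w x - z x) \<in> Hs_ivl L 1"
    and weak_deriv_diff: "AE x in ivl L. weak_deriv L (\<lambda>x. w x - z x) x = weak_deriv L w x - weak_deriv L z x"
proof -
  note wd = weak_deriv_L2[OF w] weak_deriv_L2[OF z]
  have d: "has_weak_deriv L (\<lambda>x. w x - z x) (\<lambda>x. weak_deriv L w x - weak_deriv L z x)"
    by (intro has_weak_deriv_diff Hs_ivl_1_L2 w z wd has_weak_deriv_weak_deriv L)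
  show H: "(\<lambda>x. w x - z x) \<in> Hs_ivl L 1"
    using d wd w z by (auto simp: Hs_ivl_1 intro: L2_diff)
  show "AE x in ivl L. weak_deriv L (\<lambda>x. w x - z x) x = weak_deriv L w x - weak_deriv L z x"
    using Hs_ivl_1_L2[OF H]
    by (rule weak_deriv_unique[OF _ _ weak_deriv_L2[OF H] L2_diff[OF wd] _ has_weak_deriv_weak_deriv[OF H] d L])
      (use Hs_ivl_1_L2[OF H] in auto)
qed

lemma trace_diff:
  assumes w: "w \<in> Hs_ivl L 1" and z: "z \<in> Hs_ivl L 1" and L: "0 < L" and x: "x \<in> {0..L}"
  shows "trace_ivl L (\<lambda>x. w x - z x) x = trace_ivl L w x - trace_ivl L z x"
proof -
  have "AE x in ivl L. w x - z x = trace_ivl L w 0 + primitive L (weak_deriv L w) x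
      - (trace_ivl L z 0 + primitive L (weak_deriv L z) x)"
    using H1_representation[OF w L] H1_representation[OF z L] by eventually_elim simp
  then show ?thesis
    by (subst trace_ivl_eq[OF _ _ L x])
      (use trace_eq_primitive[OF w L x] trace_eq_primitive[OF z L x] in
        \<open>auto intro!: continuous_intros continuous_on_primitive L2_integrable weak_deriv_L2 w z\<close>)
qed

text \<open>After both representations are inserted, the constants account for end value terms and
  the two primitives are covered by the Fubini identity.\<close>

lemma H1_integration_by_parts:
  assumes p: "p \<in> Hs_ivl L 1" and v: "v \<in> Hs_ivl L 1" and L: "0 < L"
  shows "inner_L2_ivl L (weak_deriv L p) v + inner_L2_ivl L p (weak_deriv L v)
    = trace_ivl L p L * trace_ivl L v L - trace_ivl L p 0 * trace_ivl L v 0"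
proof -
  note p' = weak_deriv_L2[OF p] and v' = weak_deriv_L2[OF v]
  note pi = L2_integrable[OF p'] and vi = L2_integrable[OF v']
  let ?P = "primitive L (weak_deriv L p)" and ?V = "primitive L (weak_deriv L v)"
  let ?p0 = "trace_ivl L p 0" and ?v0 = "trace_ivl L v 0"
  have "inner_L2_ivl L (weak_deriv L p) v = inner_L2_ivl L (weak_deriv L p) (\<lambda>x. ?v0 + ?V x)"
    by (intro inner_L2_cong_AE p' Hs_ivl_1_L2 v H1_representation L L2_add L2_const primitive_L2 vi) simp
  also have "\<dots> = ?v0 * ?P L + (\<integral>x. weak_deriv L p x * ?V x \<partial>ivl L)"
    using pi L2_mult_integrable[OF p' primitive_L2[OF vi]]
    by (simp add: inner_L2_ivl_def distrib_left primitive_right)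
  finally have 1: "inner_L2_ivl L (weak_deriv L p) v = \<dots>" .
  have "inner_L2_ivl L p (weak_deriv L v) = inner_L2_ivl L (\<lambda>x. ?p0 + ?P x) (weak_deriv L v)"
    by (intro inner_L2_cong_AE v' Hs_ivl_1_L2 p H1_representation L L2_add L2_const primitive_L2 pi) simp
  also have "\<dots> = ?p0 * ?V L + (\<integral>x. ?P x * weak_deriv L v x \<partial>ivl L)"
    using vi L2_mult_integrable[OF primitive_L2[OF pi] v']
    by (simp add: inner_L2_ivl_def distrib_right primitive_right)
  finally have 2: "inner_L2_ivl L p (weak_deriv L v) = \<dots>" .
  show ?thesis
    using 1 2 primitive_integration_by_parts[OF pi vi] trace_eq_primitive[OF p L, of L]
      trace_eq_primitive[OF v L, of L] L
    by (simp add: primitive_right algebra_simps)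
qed

section \<open>Piecewise constant projection\<close>

text \<open>Half-open cells are pairwise disjoint, so sums over cells have at most one nonzero term,
  and only the right end \<open>L\<close> is missed. The cells of \<open>mesh\<close>, by contrast,
  are closed and share nodes.\<close>

definition cell_indicator :: "real \<Rightarrow> nat \<Rightarrow> nat \<Rightarrow> real \<Rightarrow> real" where
  "cell_indicator L n i = indicat_real {real i * (L / real n)..<real (Suc i) * (L / real n)}"

definition step_function :: "real \<Rightarrow> nat \<Rightarrow> (nat \<Rightarrow> real) \<Rightarrow> real \<Rightarrow> real" where
  "step_function L n c x = (\<Sum>i<n. c i * cell_indicator L n i x)"

definition cell_mean :: "real \<Rightarrow> nat \<Rightarrow> (real \<Rightarrow> real) \<Rightarrow> nat \<Rightarrow> real" where
  "cell_mean L n w i = (\<integral>x. cell_indicator L n i x * w x \<partial>ivl L) / (L / real n)"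

definition cell_proj :: "real \<Rightarrow> nat \<Rightarrow> (real \<Rightarrow> real) \<Rightarrow> real \<Rightarrow> real" where
  "cell_proj L n w = step_function L n (cell_mean L n w)"

section \<open>Cells of a uniform mesh and orthogonality of the cell means\<close>

locale uniform_mesh =
  fixes L :: real and n :: nat
  assumes L_pos: "0 < L" and n_pos: "1 \<le> n"
begin

definition h :: real where "h = L / real n"

lemma h_pos: "0 < h" and h_times_n: "real n * h = L"
  using L_pos n_pos by (simp_all add: h_def)

lemma cell_le: "i < n \<Longrightarrow> real (Suc i) * h \<le> L"
proof -
  assume "i < n"
  then have "real (Suc i) * h \<le> real n * h"
    using h_pos by (intro mult_right_mono) auto
  then show ?thesis by (simp add: h_times_n)
qed

lemma cell_indicator_eq: "cell_indicator L n i = indicat_real {real i * h..<real (Suc i) * h}"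
  by (simp only: cell_indicator_def h_def)

lemma cell_indicator_eq_1_iff: "cell_indicator L n i x = 1 \<longleftrightarrow> real i * h \<le> x \<and> x < real (Suc i) * h"
  by (simp add: cell_indicator_eq indicator_def)

lemma cell_indicator_cases: "cell_indicator L n i x = 0 \<or> cell_indicator L n i x = 1"
  by (simp add: cell_indicator_eq indicator_def)

lemma cell_indicator_nonneg: "0 \<le> cell_indicator L n i x"
  by (simp add: cell_indicator_eq)

lemma cell_indicator_idem: "cell_indicator L n i x * cell_indicator L n i x = cell_indicator L n i x"
  using cell_indicator_cases[of i x] by auto

lemma cell_indicator_disjoint:
  assumes "i \<noteq> j" shows "cell_indicator L n i x * cell_indicator L n j x = 0"
proof -
  have "cell_indicator L n i x = 0 \<or> cell_indicator L n j x = 0" if "i < j" for i j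
  proof -
    have "real (Suc i) * h \<le> real j * h" using that h_pos by (intro mult_right_mono) auto
    then show ?thesis by (auto simp: cell_indicator_eq indicator_def)
  qed
  then show ?thesis using assms by (metis linorder_neqE_nat mult_eq_0_iff)
qed

lemma ex_cell:
  assumes "0 \<le> x" "x < L"
  shows "\<exists>i<n. cell_indicator L n i x = 1"
proof -
  define i where "i = nat \<lfloor>x / h\<rfloor>"
  have "0 \<le> x / h" using assms(1) h_pos by simp
  then have "real i \<le> x / h" "x / h < real (Suc i)"
    unfolding i_def by linarith+
  then have "real i * h \<le> x" "x < real (Suc i) * h" using h_pos by (simp_all add: field_simps)
  moreover have "real i * h < real n * h" using calculation(1) assms(2) h_times_n by linarith
  then have "i < n" using h_pos by simp
  ultimately show ?thesis unfolding cell_indicator_eq_1_iff by blast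
qed

lemma step_function_eq:
  assumes "i < n" "cell_indicator L n i x = 1"
  shows "step_function L n c x = c i"
proof -
  have "c j * cell_indicator L n j x = 0" if "j \<noteq> i" for j
    using cell_indicator_disjoint[OF that, of x] assms(2) by simp
  then have "step_function L n c x = (\<Sum>j\<in>{i}. c j * cell_indicator L n j x)"
    unfolding step_function_def using assms(1) by (intro sum.mono_neutral_right) auto
  then show ?thesis using assms(2) by simp
qed

lemma AE_cell: "AE x in ivl L. \<exists>i<n. cell_indicator L n i x = 1"
  using AE_ivl_neq[of L L] AE_space
proof eventually_elim
  case (elim x)
  then have "0 \<le> x" "x < L" by auto
  then show ?case by (rule ex_cell)
qed

lemma cell_indicator_L2: "cell_indicator L n i \<in> L2_ivl L"
  by (simp add: cell_indicator_eq indicator_L2)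

lemma cell_indicator_mult_L2: "w \<in> L2_ivl L \<Longrightarrow> (\<lambda>x. cell_indicator L n i x * w x) \<in> L2_ivl L"
  by (simp add: cell_indicator_eq indicator_mult_L2)

lemma integral_cell_indicator: "i < n \<Longrightarrow> (\<integral>x. cell_indicator L n i x \<partial>ivl L) = h"
  using cell_le[of i] h_pos integral_indicator_ivl[of "real i * h" "real (Suc i) * h" L]
  by (simp add: cell_indicator_eq algebra_simps)

lemma L2_sum: "finite A \<Longrightarrow> (\<And>i. i \<in> A \<Longrightarrow> f i \<in> L2_ivl L) \<Longrightarrow> (\<lambda>x. \<Sum>i\<in>A. f i x) \<in> L2_ivl L"
  by (induction rule: finite_induct) (simp_all add: L2_add L2_const)

lemma step_function_L2: "step_function L n c \<in> L2_ivl L"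
  unfolding step_function_def[abs_def] by (intro L2_sum L2_cmult cell_indicator_L2) auto

lemma cell_proj_L2: "cell_proj L n w \<in> L2_ivl L"
  by (simp add: cell_proj_def step_function_L2)

lemma integral_mult_step_function:
  assumes "integrable (ivl L) w"
  shows "(\<integral>x. step_function L n c x * w x \<partial>ivl L) = (\<Sum>i<n. c i * (\<integral>x. cell_indicator L n i x * w x \<partial>ivl L))"
proof -
  have "integrable (ivl L) (\<lambda>x. cell_indicator L n i x * w x)" for i
    using assms by (simp add: cell_indicator_eq integrable_indicator_mult)
  then show ?thesis
    by (simp add: step_function_def sum_distrib_right mult.assoc)
qed

text \<open>A step function sees \<open>w\<close> only through its cell means; the orthogonality
  relations of the projection reduce to this.\<close>

lemma inner_step_function_right:
  assumes "w \<in> L2_ivl L"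
  shows "inner_L2_ivl L w (step_function L n c) = h * (\<Sum>i<n. c i * cell_mean L n w i)"
proof -
  have "inner_L2_ivl L w (step_function L n c) = (\<Sum>i<n. c i * (\<integral>x. cell_indicator L n i x * w x \<partial>ivl L))"
    using integral_mult_step_function[OF L2_integrable[OF assms], of c]
    by (simp add: inner_L2_ivl_def mult.commute)
  also have "\<dots> = h * (\<Sum>i<n. c i * cell_mean L n w i)"
    using h_pos by (simp add: cell_mean_def h_def[symmetric] sum_distrib_left)
  finally show ?thesis .
qed

lemma cell_mean_step_function: "i < n \<Longrightarrow> cell_mean L n (step_function L n c) i = c i"
proof -
  assume i: "i < n"
  have eq: "cell_indicator L n i x * step_function L n c x = c i * cell_indicator L n i x" for x
    using cell_indicator_cases[of i x] step_function_eq[OF i, of x c] by auto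
  show ?thesis
    using integral_cell_indicator[OF i] h_pos by (simp add: cell_mean_def eq h_def[symmetric])
qed

lemma inner_cell_proj_step_function:
  assumes w: "w \<in> L2_ivl L"
  shows "inner_L2_ivl L (cell_proj L n w) (step_function L n c) = inner_L2_ivl L w (step_function L n c)"
  by (simp add: inner_step_function_right w step_function_L2 cell_proj_L2)
    (simp add: cell_proj_def cell_mean_step_function)

lemma cell_proj_orthogonal:
  assumes w: "w \<in> L2_ivl L"
  shows "inner_L2_ivl L (\<lambda>x. w x - cell_proj L n w x) (step_function L n c) = 0"
  by (simp add: inner_L2_diff_left step_function_L2 cell_proj_L2 w inner_cell_proj_step_function)

text \<open>The constant one is a step function almost everywhere. Preserved edge integrals are what
  lets the interpolant keep the value of \<open>u\<close> at the far end of an edge.\<close>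

lemma integral_cell_proj:
  assumes w: "w \<in> L2_ivl L"
  shows "(\<integral>x. cell_proj L n w x \<partial>ivl L) = (\<integral>x. w x \<partial>ivl L)"
proof -
  have one: "AE x in ivl L. step_function L n (\<lambda>_. 1) x = 1"
    using AE_cell by eventually_elim (auto dest: step_function_eq[of _ _ "\<lambda>_. 1"])
  have "inner_L2_ivl L v (step_function L n (\<lambda>_. 1)) = (\<integral>x. v x \<partial>ivl L)" if "v \<in> L2_ivl L" for v
    using inner_L2_cong_AE[OF that that step_function_L2 L2_const _ one] by (simp add: inner_L2_ivl_def)
  then show ?thesis
    using inner_cell_proj_step_function[OF w] cell_proj_L2 w by metis
qed

text \<open>Pythagoras: the squared error is the squared norm of \<open>w\<close> minus that of its
  projection.\<close>

lemma cell_proj_error_le: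
  assumes w: "w \<in> L2_ivl L"
  shows "inner_L2_ivl L (\<lambda>x. w x - cell_proj L n w x) (\<lambda>x. w x - cell_proj L n w x) \<le> inner_L2_ivl L w w"
proof -
  let ?P = "cell_proj L n w"
  have "inner_L2_ivl L (\<lambda>x. w x - ?P x) (\<lambda>x. w x - ?P x)
      = inner_L2_ivl L (\<lambda>x. w x - ?P x) w - inner_L2_ivl L (\<lambda>x. w x - ?P x) ?P"
    by (intro inner_L2_diff_right L2_diff w cell_proj_L2)
  also have "inner_L2_ivl L (\<lambda>x. w x - ?P x) ?P = 0"
    using cell_proj_orthogonal[OF w] by (simp add: cell_proj_def)
  also have "inner_L2_ivl L (\<lambda>x. w x - ?P x) w = inner_L2_ivl L w w - inner_L2_ivl L ?P w"
    by (intro inner_L2_diff_left w cell_proj_L2)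
  also have "inner_L2_ivl L ?P w = inner_L2_ivl L ?P ?P"
    using inner_cell_proj_step_function[OF w] by (metis cell_proj_def inner_L2_commute)
  finally show ?thesis using inner_L2_nonneg[of L ?P] by simp
qed

text \<open>The deviation at \<open>x\<close> is the mean over the cell of \<open>w x - w y\<close>;
  Cauchy-Schwarz against the cell indicator, whose squared norm is \<open>h\<close>, bounds its
  square by the mean of the squares. Both estimates of positive order start here.\<close>

lemma cell_proj_deviation_le:
  assumes w: "w \<in> L2_ivl L" and i: "i < n" "cell_indicator L n i x = 1"
  shows "(w x - cell_proj L n w x)\<^sup>2 \<le> (1 / h) * (\<integral>y. cell_indicator L n i y * (w x - w y)\<^sup>2 \<partial>ivl L)"
proof -
  let ?\<chi> = "cell_indicator L n i"
  let ?v = "\<lambda>y. ?\<chi> y * (w x - w y)"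
  have v: "?v \<in> L2_ivl L" by (intro cell_indicator_mult_L2 L2_diff L2_const w)
  have "inner_L2_ivl L ?\<chi> ?v = (\<integral>y. ?\<chi> y * w x - ?\<chi> y * w y \<partial>ivl L)"
    unfolding inner_L2_ivl_def
    by (intro Bochner_Integration.integral_cong refl)
      (metis cell_indicator_idem mult.assoc right_diff_distrib)
  also have "\<dots> = h * w x - h * cell_mean L n w i"
    using L2_integrable[OF cell_indicator_L2[of i]] L2_integrable[OF cell_indicator_mult_L2[OF w, of i]]
      integral_cell_indicator[OF i(1)] h_pos
    by (simp add: cell_mean_def h_def[symmetric])
  also have "cell_mean L n w i = cell_proj L n w x"
    unfolding cell_proj_def using step_function_eq[OF i] by simp
  finally have 1: "inner_L2_ivl L ?\<chi> ?v = h * (w x - cell_proj L n w x)"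
    by (simp add: right_diff_distrib)
  have 2: "inner_L2_ivl L ?\<chi> ?\<chi> = h"
    using integral_cell_indicator[OF i(1)] by (simp add: inner_L2_ivl_def cell_indicator_idem)
  have 3: "inner_L2_ivl L ?v ?v = (\<integral>y. ?\<chi> y * (w x - w y)\<^sup>2 \<partial>ivl L)"
    unfolding inner_L2_ivl_def
  proof (intro Bochner_Integration.integral_cong refl)
    fix y show "?v y * ?v y = ?\<chi> y * (w x - w y)\<^sup>2"
      using cell_indicator_cases[of i y] by (auto simp: power2_eq_square)
  qed
  have "h * (h * (w x - cell_proj L n w x)\<^sup>2) \<le> h * inner_L2_ivl L ?v ?v"
    using Cauchy_Schwarz_L2[OF cell_indicator_L2 v, of i] unfolding 1 2
    by (simp add: power_mult_distrib power2_eq_square mult_ac)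
  then have "h * (w x - cell_proj L n w x)\<^sup>2 \<le> inner_L2_ivl L ?v ?v"
    using h_pos by simp
  then show ?thesis
    unfolding 3 using h_pos by (simp add: field_simps)
qed

section \<open>Approximation order of the cell projection\<close>

lemma same_cell_distance:
  assumes "cell_indicator L n i x = 1" "cell_indicator L n i y = 1"
  shows "\<bar>x - y\<bar> \<le> h"
  using assms unfolding cell_indicator_eq_1_iff by (auto simp: algebra_simps abs_if)

text \<open>Squared increments inside cell \<open>i\<close> are at most \<open>h * ?E i\<close>,
  hence so is the squared deviation; integration over cells of length \<open>h\<close> supplies the
  second factor \<open>h\<close>.\<close>

lemma cell_proj_error_H1:
  assumes w: "w \<in> Hs_ivl L 1"
  shows "inner_L2_ivl L (\<lambda>x. w x - cell_proj L n w x) (\<lambda>x. w x - cell_proj L n w x)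
    \<le> h\<^sup>2 * inner_L2_ivl L (weak_deriv L w) (weak_deriv L w)"
proof -
  let ?d = "weak_deriv L w"
  let ?W = "\<lambda>x. trace_ivl L w 0 + primitive L ?d x"
  let ?E = "\<lambda>i. \<integral>y. cell_indicator L n i y * (?d y)\<^sup>2 \<partial>ivl L"
  note w2 = Hs_ivl_1_L2[OF w] and d = weak_deriv_L2[OF w] and rep = H1_representation[OF w L_pos]
  have d2: "integrable (ivl L) (\<lambda>y. (?d y)\<^sup>2)" using d by (simp add: L2_ivl_def)
  have incr: "(primitive L ?d y - primitive L ?d x)\<^sup>2 \<le> h * ?E i"
    if xy: "cell_indicator L n i x = 1" "cell_indicator L n i y = 1" "i < n" "x \<le> y" for x y i
  proof -
    have b: "real i * h \<le> x" "y < real (Suc i) * h"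
      using xy by (simp_all add: cell_indicator_eq_1_iff)
    then have "0 \<le> x" using h_pos by (meson mult_nonneg_nonneg of_nat_0_le_iff order.trans less_imp_le)
    have "y \<le> L" using b cell_le[OF xy(3)] by linarith
    have "(primitive L ?d y - primitive L ?d x)\<^sup>2
        \<le> (y - x) * (\<integral>t. indicat_real {x<..y} t * (?d t)\<^sup>2 \<partial>ivl L)"
      by (rule primitive_increment_square_le[OF d \<open>0 \<le> x\<close> xy(4) \<open>y \<le> L\<close>])
    \<comment> \<open>Enlarging \<open>{x<..y}\<close> to the whole cell makes the integral
      independent of the two points.\<close>
    also have "\<dots> \<le> (y - x) * ?E i"
      unfolding cell_indicator_eq using b xy(4)
      by (intro mult_left_mono integral_mono integrable_indicator_mult d2 mult_right_mono)
        (auto simp: indicator_def)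
    also have "\<dots> \<le> h * ?E i"
      using same_cell_distance[OF xy(1,2)] xy(4)
      by (intro mult_right_mono Bochner_Integration.integral_nonneg mult_nonneg_nonneg cell_indicator_nonneg) auto
    finally show ?thesis .
  qed
  have "AE x in ivl L. (w x - cell_proj L n w x)\<^sup>2 \<le> step_function L n (\<lambda>i. h * ?E i) x"
    using rep AE_cell
  proof eventually_elim
    case (elim x)
    then obtain i where i: "i < n" "cell_indicator L n i x = 1" by auto
    have "(\<integral>y. cell_indicator L n i y * (w x - w y)\<^sup>2 \<partial>ivl L) \<le> (\<integral>y. cell_indicator L n i y * (h * ?E i) \<partial>ivl L)"
    proof (rule integral_mono_AE)
      show "integrable (ivl L) (\<lambda>y. cell_indicator L n i y * (w x - w y)\<^sup>2)"
        unfolding cell_indicator_eq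
        by (intro integrable_indicator_mult L2_square_integrable L2_diff L2_const w2) auto
      show "integrable (ivl L) (\<lambda>y. cell_indicator L n i y * (h * ?E i))"
        by (intro integrable_mult_left L2_integrable cell_indicator_L2)
      show "AE y in ivl L. cell_indicator L n i y * (w x - w y)\<^sup>2 \<le> cell_indicator L n i y * (h * ?E i)"
        using rep
      proof eventually_elim
        case (elim y)
        have "(w x - w y)\<^sup>2 = (primitive L ?d y - primitive L ?d x)\<^sup>2"
          using \<open>w x = _\<close> elim by (simp add: power2_commute)
        then show ?case
          using cell_indicator_cases[of i y] incr[of i x y] incr[of i y x] i
          by (cases "x \<le> y") (auto simp: power2_commute)
      qed
    qed
    also have "\<dots> = h * (h * ?E i)"
      using integral_cell_indicator[OF i(1)] by simp
    finally have "(1 / h) * (\<integral>y. cell_indicator L n i y * (w x - w y)\<^sup>2 \<partial>ivl L) \<le> h * ?E i"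
      using h_pos by (simp add: field_simps)
    then show ?case
      using cell_proj_deviation_le[OF w2 i] step_function_eq[OF i, of "\<lambda>i. h * ?E i"] by linarith
  qed
  then have "inner_L2_ivl L (\<lambda>x. w x - cell_proj L n w x) (\<lambda>x. w x - cell_proj L n w x)
      \<le> (\<integral>x. step_function L n (\<lambda>i. h * ?E i) x \<partial>ivl L)"
    unfolding inner_L2_self
    by (intro integral_mono_AE L2_square_integrable L2_integrable step_function_L2 L2_diff w2 cell_proj_L2)
  also have "\<dots> = (\<Sum>i<n. h * ?E i * h)"
    using integral_mult_step_function[of "\<lambda>_. 1" "\<lambda>i. h * ?E i"] L2_integrable[OF L2_const]
    by (simp add: integral_cell_indicator)
  also have "\<dots> = h\<^sup>2 * (\<Sum>i<n. 1 * ?E i)"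
    by (simp add: sum_distrib_left power2_eq_square mult_ac)
  \<comment> \<open>The local energies are reassembled: almost every point lies in a cell, so the
    step function with all coefficients one acts as the constant one.\<close>
  also have "(\<Sum>i<n. 1 * ?E i) = (\<integral>x. step_function L n (\<lambda>_. 1) x * (?d x)\<^sup>2 \<partial>ivl L)"
    using integral_mult_step_function[OF d2, of "\<lambda>_. 1"] by simp
  also have "\<dots> = inner_L2_ivl L ?d ?d"
    unfolding inner_L2_self
  proof (rule integral_cong_AE)
    show "AE x in ivl L. step_function L n (\<lambda>_. 1) x * (?d x)\<^sup>2 = (?d x)\<^sup>2"
      using AE_cell by eventually_elim (auto dest: step_function_eq[of _ _ "\<lambda>_. 1"])
  qed (use L2_measurable[OF d] L2_measurable[OF step_function_L2] in measurable)
  finally show ?thesis .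
qed

text \<open>Inside a cell \<open>\<bar>x - y\<bar> \<le> h\<close>, so
  \<open>h powr (1 + 2 * \<theta>)\<close> times the kernel dominates
  \<open>(w x - w y)\<^sup>2\<close>. The division by \<open>h\<close> in the mean leaves
  \<open>h powr (2 * \<theta>)\<close>, and pairs of points in one cell are then enlarged to all
  pairs.\<close>

lemma cell_proj_error_gagliardo:
  assumes w: "w \<in> L2_ivl L" and \<theta>: "0 < \<theta>"
    and gag: "integrable (ivl L \<Otimes>\<^sub>M ivl L) (gagliardo_kernel \<theta> w)"
  shows "inner_L2_ivl L (\<lambda>x. w x - cell_proj L n w x) (\<lambda>x. w x - cell_proj L n w x)
    \<le> h powr (2 * \<theta>) * (\<integral>z. gagliardo_kernel \<theta> w z \<partial>(ivl L \<Otimes>\<^sub>M ivl L))"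
proof -
  interpret pair_sigma_finite "ivl L" "ivl L" by (rule pair_sigma_finite_ivl)
  let ?G = "\<lambda>x. \<integral>y. gagliardo_kernel \<theta> w (x, y) \<partial>ivl L"
  have G_nonneg: "0 \<le> gagliardo_kernel \<theta> w z" for z
    by (cases z) (simp add: gagliardo_kernel_def)
  have "AE x in ivl L. (w x - cell_proj L n w x)\<^sup>2 \<le> h powr (2 * \<theta>) * ?G x"
    using AE_integrable_fst'[OF gag] AE_cell
  proof eventually_elim
    case (elim x)
    then obtain i where i: "i < n" "cell_indicator L n i x = 1" by auto
    have "(\<integral>y. cell_indicator L n i y * (w x - w y)\<^sup>2 \<partial>ivl L)
        \<le> (\<integral>y. h powr (1 + 2 * \<theta>) * gagliardo_kernel \<theta> w (x, y) \<partial>ivl L)"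
    proof (rule integral_mono)
      show "integrable (ivl L) (\<lambda>y. cell_indicator L n i y * (w x - w y)\<^sup>2)"
        unfolding cell_indicator_eq
        by (intro integrable_indicator_mult L2_square_integrable L2_diff L2_const w) auto
      show "integrable (ivl L) (\<lambda>y. h powr (1 + 2 * \<theta>) * gagliardo_kernel \<theta> w (x, y))"
        using elim by (intro integrable_mult_right) simp
      fix y
      show "cell_indicator L n i y * (w x - w y)\<^sup>2 \<le> h powr (1 + 2 * \<theta>) * gagliardo_kernel \<theta> w (x, y)"
      \<comment> \<open>On the diagonal the kernel is the quotient \<open>0 / 0 = 0\<close>, but
        there the difference vanishes as well.\<close>
      proof (cases "cell_indicator L n i y = 0 \<or> x = y")
        case True
        then show ?thesis using G_nonneg by auto
      next
        case False
        then have y: "cell_indicator L n i y = 1" using cell_indicator_cases by blast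
        have "\<bar>x - y\<bar> powr (1 + 2 * \<theta>) \<le> h powr (1 + 2 * \<theta>)"
          using same_cell_distance[OF i(2) y] \<theta> by (intro powr_mono2) auto
        then have "(w x - w y)\<^sup>2 * \<bar>x - y\<bar> powr (1 + 2 * \<theta>) \<le> (w x - w y)\<^sup>2 * h powr (1 + 2 * \<theta>)"
          by (intro mult_left_mono) auto
        then show ?thesis
          using False y by (simp add: gagliardo_kernel_def field_simps)
      qed
    qed
    also have "\<dots> = h * (h powr (2 * \<theta>) * ?G x)"
      using h_pos by (simp add: powr_add)
    finally have "(1 / h) * (\<integral>y. cell_indicator L n i y * (w x - w y)\<^sup>2 \<partial>ivl L) \<le> h powr (2 * \<theta>) * ?G x"
      using h_pos by (simp add: field_simps)
    then show ?case
      using cell_proj_deviation_le[OF w i] by linarith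
  qed
  then have "inner_L2_ivl L (\<lambda>x. w x - cell_proj L n w x) (\<lambda>x. w x - cell_proj L n w x)
      \<le> (\<integral>x. h powr (2 * \<theta>) * ?G x \<partial>ivl L)"
    unfolding inner_L2_self
    using integrable_fst'[OF gag]
    by (intro integral_mono_AE L2_square_integrable L2_diff w cell_proj_L2 integrable_mult_right)
  also have "\<dots> = h powr (2 * \<theta>) * (\<integral>z. gagliardo_kernel \<theta> w z \<partial>(ivl L \<Otimes>\<^sub>M ivl L))"
    using integral_fst'[OF gag] by simp
  finally show ?thesis .
qed

text \<open>\<open>Hs_norm_sq_ivl\<close> changes its form at integer orders, hence three cases; in
  each one the estimate uses a single summand of the norm.\<close>

lemma cell_proj_error:
  assumes w: "w \<in> Hs_ivl L m" and m: "0 \<le> m" "m \<le> 1"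
  shows "inner_L2_ivl L (\<lambda>x. w x - cell_proj L n w x) (\<lambda>x. w x - cell_proj L n w x)
    \<le> h powr (2 * m) * Hs_norm_sq_ivl L m w"
proof -
  consider "m = 0" | "0 < m" "m < 1" | "m = 1" using m by linarith
  then show ?thesis
  proof cases
    case 1
    then show ?thesis using cell_proj_error_le[of w] w h_pos by (simp add: Hs_ivl_def Hs_norm_sq_ivl_def)
  next
    case 2
    then have fl: "\<lfloor>m\<rfloor> = 0" "frac m = m" by (auto simp: floor_eq_iff frac_eq)
    have "h powr (2 * m) * (\<integral>z. gagliardo_kernel m w z \<partial>(ivl L \<Otimes>\<^sub>M ivl L)) \<le> h powr (2 * m) * Hs_norm_sq_ivl L m w"
      using 2 by (intro mult_left_mono) (simp_all add: Hs_norm_sq_ivl_def fl inner_L2_nonneg)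
    then show ?thesis
      using cell_proj_error_gagliardo[of w m] w 2 by (simp add: Hs_ivl_def fl)
  next
    case 3
    have "h\<^sup>2 * inner_L2_ivl L (weak_deriv L w) (weak_deriv L w) \<le> h\<^sup>2 * Hs_norm_sq_ivl L m w"
      using 3 by (intro mult_left_mono) (simp_all add: Hs_norm_sq_ivl_def inner_L2_nonneg)
    then show ?thesis
      using cell_proj_error_H1[of w] w 3 h_pos by (simp add: powr_realpow order.trans)
  qed
qed

end

text \<open>Raising the order by one shifts \<open>\<lfloor>m\<rfloor>\<close> and keeps the
  fractional part; in the norm only the term of order zero is gained.\<close>

lemma weak_deriv_Hs:
  assumes u: "u \<in> Hs_ivl L (m + 1)" and m: "0 \<le> m" "m \<le> 1" and L: "0 < L"
  shows "weak_deriv L u \<in> Hs_ivl L m"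
    and "Hs_norm_sq_ivl L m (weak_deriv L u) \<le> Hs_norm_sq_ivl L (m + 1) u"
proof -
  have fl: "\<lfloor>m + 1\<rfloor> = \<lfloor>m\<rfloor> + 1" "nat (\<lfloor>m\<rfloor> + 1) = Suc (nat \<lfloor>m\<rfloor>)" "frac (m + 1) = frac m"
    using m by (simp_all add: frac_def nat_add_distrib)
  have Hk: "u \<in> Hk_ivl L (Suc (nat \<lfloor>m\<rfloor>))"
    using u by (simp add: Hs_ivl_def fl)
  then obtain g where u2: "u \<in> L2_ivl L" and g: "g \<in> Hk_ivl L (nat \<lfloor>m\<rfloor>)" "has_weak_deriv L u g" by auto
  have gL2: "g \<in> L2_ivl L" using g(1) by (cases "nat \<lfloor>m\<rfloor>") auto
  have u1: "u \<in> Hs_ivl L 1" using u2 g(2) gL2 by (auto simp: Hs_ivl_1)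
  note d = weak_deriv_L2[OF u1]
  have "weak_deriv L u \<in> Hk_ivl L (nat \<lfloor>m\<rfloor>)"
  proof (cases "m = 1")
    case False
    then have "\<lfloor>m\<rfloor> = 0" using m by (simp add: floor_eq_iff)
    then show ?thesis using d by simp
  next
    case True
    then obtain k where k: "k \<in> L2_ivl L" "has_weak_deriv L g k" using g(1) by auto
    \<comment> \<open>For \<open>m = 1\<close> a second derivative is available for some weak
      derivative \<open>g\<close> of \<open>u\<close>; uniqueness transfers it to the chosen
      representative.\<close>
    have AE: "AE x in ivl L. weak_deriv L u x = g x"
      by (rule weak_deriv_unique[OF u2 u2 d gL2 _ has_weak_deriv_weak_deriv[OF u1] g(2) L]) simp
    have "has_weak_deriv L (weak_deriv L u) k"
      unfolding has_weak_deriv_def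
    proof
      fix \<phi> assume \<phi>: "\<phi> \<in> test_functions L"
      have D: "deriv \<phi> \<in> L2_ivl L"
        by (intro continuous_on_L2 continuous_on_subset[OF test_function_primitive(1)[OF \<phi> L]]) auto
      show "inner_L2_ivl L (weak_deriv L u) (deriv \<phi>) = - inner_L2_ivl L k \<phi>"
        using inner_L2_cong_AE[OF d gL2 D D AE] k(2) \<phi> by (simp add: has_weak_deriv_def)
    qed
    then show ?thesis using True d k(1) by auto
  qed
  then show "weak_deriv L u \<in> Hs_ivl L m"
    using u unfolding Hs_ivl_def fl by (simp add: funpow_Suc_right del: funpow.simps)
  have "(\<Sum>j\<le>Suc (nat \<lfloor>m\<rfloor>). inner_L2_ivl L ((weak_deriv L ^^ j) u) ((weak_deriv L ^^ j) u))
     = inner_L2_ivl L u u + (\<Sum>j\<le>nat \<lfloor>m\<rfloor>. inner_L2_ivl L ((weak_deriv L ^^ j) (weak_deriv L u)) ((weak_deriv L ^^ j) (weak_deriv L u)))"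
    by (subst sum.atMost_Suc_shift) (simp add: funpow_Suc_right del: funpow.simps)
  then show "Hs_norm_sq_ivl L m (weak_deriv L u) \<le> Hs_norm_sq_ivl L (m + 1) u"
    using inner_L2_nonneg[of L u]
    by (simp add: Hs_norm_sq_ivl_def fl funpow_Suc_right del: funpow.simps sum.atMost_Suc)
qed

subsection \<open>Piecewise affine functions on an edge\<close>

context uniform_mesh
begin

abbreviation cell :: "nat \<Rightarrow> real set" where
  "cell i \<equiv> {real i * h..real (Suc i) * h}"

lemma cell_subset: "i < n \<Longrightarrow> cell i \<subseteq> {0..L}"
  using cell_le[of i] h_pos by auto

lemma AE_cell_of_AE_ivl:
  assumes "i < n" "AE x in ivl L. Q x"
  shows "AE x in lebesgue_on (cell i). Q x"
  using assms(2) cell_subset[OF assms(1)]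
  by (auto simp: AE_restrict_space_iff elim!: eventually_mono)

lemma AE_cell_neq: "AE x in lebesgue_on (cell i). x \<noteq> y"
proof -
  have "AE x in lebesgue. x \<notin> {y}"
    by (intro AE_not_in) (simp add: negligible_iff_null_sets[symmetric])
  then show ?thesis
    by (subst AE_restrict_space_iff) auto
qed

text \<open>There are finitely many cells, so their exceptional null sets can be joined.\<close>

lemma AE_step_functionI:
  assumes "\<And>i. i < n \<Longrightarrow> AE x in lebesgue_on (cell i). w x = c i"
  shows "AE x in ivl L. w x = step_function L n c x"
proof -
  have "AE x in lebesgue. x \<in> cell i \<longrightarrow> w x = c i" if "i \<in> {..<n}" for i
    using assms[of i] that by (simp add: AE_restrict_space_iff)
  then have "AE x in lebesgue. \<forall>i\<in>{..<n}. x \<in> cell i \<longrightarrow> w x = c i"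
    by (subst AE_finite_all) auto
  then have "AE x in ivl L. \<forall>i\<in>{..<n}. x \<in> cell i \<longrightarrow> w x = c i"
    by (simp add: AE_restrict_space_iff) (auto elim!: eventually_mono)
  with AE_cell show ?thesis
  proof eventually_elim
    case (elim x)
    then obtain i where i: "i < n" "cell_indicator L n i x = 1" by auto
    then have "x \<in> cell i" by (simp add: cell_indicator_eq_1_iff)
    then show ?case using elim i step_function_eq[OF i, of c] by auto
  qed
qed

text \<open>Only the right node of the closed cell lies outside the half-open one.\<close>

lemma step_function_on_cell:
  assumes "i < n"
  shows "AE x in lebesgue_on (cell i). step_function L n c x = c i"
  using AE_cell_neq[where y = "real (Suc i) * h"] AE_space
proof eventually_elim
  case (elim x)
  then have "cell_indicator L n i x = 1" by (simp add: cell_indicator_eq_1_iff)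
  then show ?case by (rule step_function_eq[OF assms])
qed

lemma ex_cell_closed:
  assumes "x \<in> {0..L}"
  shows "\<exists>i<n. x \<in> cell i"
proof (cases "x = L")
  case True
  \<comment> \<open>The right end of the edge is missed by the half-open cells and belongs to the
    last closed one.\<close>
  have "x \<in> cell (n - 1)"
    using True n_pos h_times_n h_pos by (auto simp: of_nat_diff algebra_simps)
  then show ?thesis using n_pos by (intro exI[of _ "n - 1"]) auto
next
  case False
  then obtain i where "i < n" "cell_indicator L n i x = 1"
    using ex_cell[of x] assms by auto
  then show ?thesis by (auto simp: cell_indicator_eq_1_iff)
qed

lemma primitive_step_function:
  assumes i: "i < n" and x: "x \<in> cell i"
  shows "primitive L (step_function L n c) x = primitive L (step_function L n c) (real i * h) + c i * (x - real i * h)"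
proof -
  let ?a = "real i * h" and ?g = "step_function L n c"
  have g: "integrable (ivl L) ?g" by (rule L2_integrable[OF step_function_L2])
  have ax: "0 \<le> ?a" "?a \<le> x" "x \<le> L" using x h_pos cell_subset[OF i] by auto
  have "primitive L ?g x - primitive L ?g ?a = (\<integral>t. indicat_real {?a<..x} t * ?g t \<partial>ivl L)"
    by (rule primitive_increment[OF g ax(2)])
  also have "\<dots> = (\<integral>t. indicat_real {?a<..x} t * c i \<partial>ivl L)"
  proof (rule integral_cong_AE)
    show "AE t in ivl L. indicat_real {?a<..x} t * ?g t = indicat_real {?a<..x} t * c i"
      using AE_ivl_neq[of "real (Suc i) * h" L]
    proof eventually_elim
      case (elim t)
      show ?case
      proof (cases "t \<in> {?a<..x}")
        case True
        then have "cell_indicator L n i t = 1" using elim x by (simp add: cell_indicator_eq_1_iff)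
        then show ?thesis using step_function_eq[OF i, of t c] by simp
      qed simp
    qed
  qed (use integrable_indicator_mult[OF g, of "{?a<..x}"] L2_measurable[OF indicator_L2, of "{?a<..x}" L] in auto)
  also have "\<dots> = (x - ?a) * c i"
  proof -
    have "{?a<..x} \<inter> {0..L} = {?a<..x}" using ax by auto
    moreover have "measure (ivl L) {?a<..x} = x - ?a"
      using ax by (subst measure_restrict_space) auto
    ultimately have "(\<integral>t. indicat_real {?a<..x} t \<partial>ivl L) = x - ?a" by simp
    then show ?thesis by simp
  qed
  finally show ?thesis by (simp add: mult.commute)
qed

text \<open>On each cell the continuous representative equals the polynomial everywhere, so the
  primitive of the weak derivative has the same increments as that of the step function of slopes.
  The difference of the two primitives is constant on each closed cell and zero at \<open>0\<close>;
  shared nodes carry the zero from cell to cell.\<close>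

lemma piecewise_affine_weak_deriv:
  assumes w: "w \<in> Hs_ivl L 1"
    and poly: "\<And>i. i < n \<Longrightarrow> \<exists>q :: real poly. degree q \<le> 1 \<and> (AE x in lebesgue_on (cell i). w x = poly q x)"
  shows "\<exists>c. AE x in ivl L. weak_deriv L w x = step_function L n c x"
proof -
  obtain q :: "nat \<Rightarrow> real poly" where q: "\<And>i. i < n \<Longrightarrow> degree (q i) \<le> 1"
    "\<And>i. i < n \<Longrightarrow> AE x in lebesgue_on (cell i). w x = poly (q i) x"
    using poly by metis
  define c where "c i = coeff (q i) 1" for i
  let ?d = "weak_deriv L w" and ?s = "step_function L n c"
  note d = L2_integrable[OF weak_deriv_L2[OF w]] and s = L2_integrable[OF step_function_L2]
  have incr: "primitive L ?d x = primitive L ?d (real i * h) + c i * (x - real i * h)"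
    if i: "i < n" and x: "x \<in> cell i" for i x
  proof -
    have eq: "trace_ivl L w 0 + primitive L ?d y = poly (q i) y" if y: "y \<in> cell i" for y
    proof (rule AE_eq_imp_eq_on_interval[OF _ _ _ _ y])
      show "continuous_on (cell i) (\<lambda>x. trace_ivl L w 0 + primitive L ?d x)"
        by (intro continuous_intros continuous_on_subset[OF continuous_on_primitive[OF d] cell_subset[OF i]])
      show "continuous_on (cell i) (poly (q i))" by (intro continuous_intros)
      show "AE x in lebesgue_on (cell i). trace_ivl L w 0 + primitive L ?d x = poly (q i) x"
        using AE_cell_of_AE_ivl[OF i H1_representation[OF w L_pos]] q(2)[OF i] by eventually_elim simp
      show "real i * h < real (Suc i) * h" using h_pos by (intro mult_strict_right_mono) auto
    qed
    have "poly (q i) y = coeff (q i) 0 + c i * y" for y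
    proof -
      have "q i = [:coeff (q i) 0, coeff (q i) 1:]"
      proof (rule poly_eqI)
        fix k show "coeff (q i) k = coeff [:coeff (q i) 0, coeff (q i) 1:] k"
          using q(1)[OF i] by (cases "k \<le> 1") (auto simp: coeff_pCons le_Suc_eq coeff_eq_0 split: nat.split)
      qed
      then have "poly (q i) y = poly [:coeff (q i) 0, coeff (q i) 1:] y" by simp
      then show ?thesis by (simp add: c_def mult.commute)
    qed
    then show ?thesis
      using eq[OF x] eq[of "real i * h"] h_pos by (simp add: algebra_simps)
  qed
  have diff: "primitive L (\<lambda>x. ?d x - ?s x) x = primitive L ?d x - primitive L ?s x" for x
    by (rule primitive_diff[OF d s])
  have cell_const: "primitive L (\<lambda>x. ?d x - ?s x) x = primitive L (\<lambda>x. ?d x - ?s x) (real i * h)"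
    if "i < n" "x \<in> cell i" for i x
    unfolding diff using incr[OF that] primitive_step_function[OF that, of c] by simp
  have node: "primitive L (\<lambda>x. ?d x - ?s x) (real i * h) = 0" if "i \<le> n" for i
    using that
  proof (induction i)
    case 0
    then show ?case using L_pos by (simp add: primitive_0)
  next
    case (Suc i)
    then show ?case using cell_const[of i "real (Suc i) * h"] h_pos by (simp del: of_nat_Suc)
  qed
  have "AE x in ivl L. ?d x - ?s x = 0"
  proof (rule AE_eq_0_of_primitive_eq_0)
    show "integrable (ivl L) (\<lambda>x. ?d x - ?s x)" using d s by simp
    fix x assume "0 \<le> x" "x \<le> L"
    then obtain i where "i < n" "x \<in> cell i" using ex_cell_closed[of x] by auto
    then show "primitive L (\<lambda>x. ?d x - ?s x) x = 0" using cell_const[of i x] node[of i] by simp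
  qed (use L_pos in simp)
  then show ?thesis by (intro exI[of _ c]) simp
qed

lemma piecewise_constant_step_function:
  assumes "\<And>i. i < n \<Longrightarrow> \<exists>q :: real poly. degree q \<le> 0 \<and> (AE x in lebesgue_on (cell i). w x = poly q x)"
  shows "\<exists>c. AE x in ivl L. w x = step_function L n c x"
proof -
  obtain q :: "nat \<Rightarrow> real poly" where q: "\<And>i. i < n \<Longrightarrow> degree (q i) \<le> 0"
    "\<And>i. i < n \<Longrightarrow> AE x in lebesgue_on (cell i). w x = poly (q i) x"
    using assms by metis
  have "AE x in lebesgue_on (cell i). w x = coeff (q i) 0" if "i < n" for i
  proof -
    have "degree (q i) = 0" using q(1)[OF that] by simp
    then have "poly (q i) x = coeff (q i) 0" for x by (auto elim!: degree_eq_zeroE)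
    then show ?thesis using q(2)[OF that] by simp
  qed
  then show ?thesis by (intro exI AE_step_functionI)
qed

text \<open>\<open>u\<close> and \<open>I\<close> start from the same value at \<open>0\<close>, so
  their difference is the primitive of the residual \<open>r\<close>.\<close>

lemma cell_proj_primitive_error:
  assumes u: "u \<in> Hs_ivl L 1"
  defines "I \<equiv> (\<lambda>x. trace_ivl L u 0 + primitive L (cell_proj L n (weak_deriv L u)) x)"
    and "r \<equiv> (\<lambda>x. weak_deriv L u x - cell_proj L n (weak_deriv L u) x)"
  shows "inner_L2_ivl L (\<lambda>x. u x - I x) (\<lambda>x. u x - I x) \<le> L\<^sup>2 * inner_L2_ivl L r r"
proof -
  note d = weak_deriv_L2[OF u]
  have r: "r \<in> L2_ivl L" unfolding r_def by (intro L2_diff d cell_proj_L2)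
  have I: "I \<in> L2_ivl L"
    unfolding I_def by (intro L2_add L2_const primitive_L2 L2_integrable cell_proj_L2)
  have AE: "AE x in ivl L. u x - I x = primitive L r x"
    using H1_representation[OF u L_pos]
    by eventually_elim
      (simp add: I_def r_def primitive_diff[OF L2_integrable[OF d] L2_integrable[OF cell_proj_L2]])
  have "inner_L2_ivl L (\<lambda>x. u x - I x) (\<lambda>x. u x - I x) = inner_L2_ivl L (primitive L r) (primitive L r)"
    by (intro inner_L2_cong_AE AE L2_diff Hs_ivl_1_L2 u I primitive_L2 L2_integrable r)
  also have "\<dots> \<le> L\<^sup>2 * inner_L2_ivl L r r"
    using L_pos by (intro inner_primitive_le r) simp
  finally show ?thesis .
qed

end

section \<open>Inner products and flows on a network\<close>

lemma L2_net_add: "w \<in> L2_net E l \<Longrightarrow> z \<in> L2_net E l \<Longrightarrow> (\<lambda>e x. w e x + z e x) \<in> L2_net E l"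
  by (simp add: L2_net_def L2_add)

lemma L2_net_diff: "w \<in> L2_net E l \<Longrightarrow> z \<in> L2_net E l \<Longrightarrow> (\<lambda>e x. w e x - z e x) \<in> L2_net E l"
  by (simp add: L2_net_def L2_diff)

lemma L2_net_cmult: "w \<in> L2_net E l \<Longrightarrow> (\<lambda>e x. c * w e x) \<in> L2_net E l"
  by (simp add: L2_net_def L2_cmult)

lemma inner_net_commute: "inner_net E l w z = inner_net E l z w"
  unfolding inner_net_def by (intro sum.cong refl inner_L2_commute)

lemma inner_net_add_right:
  "w \<in> L2_net E l \<Longrightarrow> z \<in> L2_net E l \<Longrightarrow> z' \<in> L2_net E l \<Longrightarrow>
    inner_net E l w (\<lambda>e x. z e x + z' e x) = inner_net E l w z + inner_net E l w z'"
  by (simp add: inner_net_def L2_net_def inner_L2_add_right sum.distrib)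

lemma inner_net_add_left:
  "w \<in> L2_net E l \<Longrightarrow> z \<in> L2_net E l \<Longrightarrow> z' \<in> L2_net E l \<Longrightarrow>
    inner_net E l (\<lambda>e x. z e x + z' e x) w = inner_net E l z w + inner_net E l z' w"
  by (simp add: inner_net_def L2_net_def inner_L2_add_left sum.distrib)

lemma inner_net_diff_left:
  "w \<in> L2_net E l \<Longrightarrow> z \<in> L2_net E l \<Longrightarrow> z' \<in> L2_net E l \<Longrightarrow>
    inner_net E l (\<lambda>e x. z e x - z' e x) w = inner_net E l z w - inner_net E l z' w"
  by (simp add: inner_net_def L2_net_def inner_L2_diff_left sum_subtractf)

lemma inner_net_cmult_right: "inner_net E l w (\<lambda>e x. c * z e x) = c * inner_net E l w z"
  by (simp add: inner_net_def inner_L2_cmult_right sum_distrib_left)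

lemma inner_net_nonneg: "0 \<le> inner_net E l w w"
  unfolding inner_net_def by (intro sum_nonneg inner_L2_nonneg)

lemma inner_net_cong_AE:
  assumes "w \<in> L2_net E l" "w' \<in> L2_net E l" "z \<in> L2_net E l" "z' \<in> L2_net E l"
    and "\<And>e. e \<in> E \<Longrightarrow> AE x in ivl (l e). w e x = w' e x"
    and "\<And>e. e \<in> E \<Longrightarrow> AE x in ivl (l e). z e x = z' e x"
  shows "inner_net E l w z = inner_net E l w' z'"
  unfolding inner_net_def using assms
  by (intro sum.cong refl inner_L2_cong_AE) (auto simp: L2_net_def)

lemma norm_L2_nonneg: "0 \<le> norm_L2 E l w"
  by (simp add: norm_L2_def inner_net_nonneg)

lemma norm_L2_square: "(norm_L2 E l w)\<^sup>2 = inner_net E l w w"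
  by (simp add: norm_L2_def inner_net_nonneg)

lemma norm_L2_leI: "inner_net E l w w \<le> B\<^sup>2 \<Longrightarrow> 0 \<le> B \<Longrightarrow> norm_L2 E l w \<le> B"
  unfolding norm_L2_def by (rule real_le_lsqrt) (auto simp: inner_net_nonneg)

lemma norm_L2_minus: "norm_L2 E l (\<lambda>e x. (-1) * w e x) = norm_L2 E l w"
  by (simp add: norm_L2_def inner_net_def inner_L2_ivl_def)

lemma norm_L2_cong_AE:
  assumes "w \<in> L2_net E l" "w' \<in> L2_net E l" "\<And>e. e \<in> E \<Longrightarrow> AE x in ivl (l e). w e x = w' e x"
  shows "norm_L2 E l w = norm_L2 E l w'"
  unfolding norm_L2_def using inner_net_cong_AE[of w E l w' w w'] assms by simp

lemma Cauchy_Schwarz_net: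
  assumes w: "w \<in> L2_net E l" and z: "z \<in> L2_net E l"
  shows "\<bar>inner_net E l w z\<bar> \<le> norm_L2 E l w * norm_L2 E l z"
proof -
  have "(inner_net E l w z)\<^sup>2 \<le> inner_net E l w w * inner_net E l z z"
  proof (rule quadratic_discriminant_le)
    fix t
    let ?y = "\<lambda>e x. t * z e x"
    have y: "?y \<in> L2_net E l" by (rule L2_net_cmult[OF z])
    have wy: "(\<lambda>e x. w e x + ?y e x) \<in> L2_net E l" by (rule L2_net_add[OF w y])
    have "inner_net E l (\<lambda>e x. w e x + ?y e x) (\<lambda>e x. w e x + ?y e x)
      = inner_net E l w w + inner_net E l w ?y + (inner_net E l ?y w + inner_net E l ?y ?y)"
      by (simp only: inner_net_add_right[OF wy w y] inner_net_commute[of E l "\<lambda>e x. w e x + ?y e x"]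
          inner_net_add_right[OF w w y] inner_net_add_right[OF y w y])
    also have "\<dots> = inner_net E l w w + 2 * t * inner_net E l w z + t\<^sup>2 * inner_net E l z z"
      by (simp only: inner_net_cmult_right inner_net_commute[of E l ?y])
        (simp add: power2_eq_square inner_net_commute[of E l z w])
    finally show "0 \<le> inner_net E l w w + 2 * t * inner_net E l w z + t\<^sup>2 * inner_net E l z z"
      using inner_net_nonneg[of E l "\<lambda>e x. w e x + ?y e x"] by linarith
  qed (rule inner_net_nonneg)
  then have "\<bar>inner_net E l w z\<bar>\<^sup>2 \<le> (norm_L2 E l w * norm_L2 E l z)\<^sup>2"
    by (simp add: norm_L2_square power_mult_distrib)
  then show ?thesis
    by (rule power2_le_imp_le) (simp add: norm_L2_nonneg)
qed

lemma norm_L2_add_le: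
  assumes w: "w \<in> L2_net E l" and z: "z \<in> L2_net E l"
  shows "norm_L2 E l (\<lambda>e x. w e x + z e x) \<le> norm_L2 E l w + norm_L2 E l z"
proof (rule norm_L2_leI)
  have wz: "(\<lambda>e x. w e x + z e x) \<in> L2_net E l" by (rule L2_net_add[OF w z])
  have "inner_net E l (\<lambda>e x. w e x + z e x) (\<lambda>e x. w e x + z e x)
      = (norm_L2 E l w)\<^sup>2 + 2 * inner_net E l w z + (norm_L2 E l z)\<^sup>2"
    by (simp only: inner_net_add_right[OF wz w z] inner_net_commute[of E l "\<lambda>e x. w e x + z e x"]
          inner_net_add_right[OF w w z] inner_net_add_right[OF z w z] norm_L2_square
          inner_net_commute[of E l z w])
  also have "\<dots> \<le> (norm_L2 E l w + norm_L2 E l z)\<^sup>2"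
    using Cauchy_Schwarz_net[OF w z] by (simp add: power2_sum)
  finally show "inner_net E l (\<lambda>e x. w e x + z e x) (\<lambda>e x. w e x + z e x) \<le> \<dots>" .
qed (simp add: norm_L2_nonneg)

section \<open>Broken Sobolev functions and bounded coefficients\<close>

lemma Hs_net_1_L2: "w \<in> Hs_net E l 1 \<Longrightarrow> w \<in> L2_net E l"
  by (auto simp: Hs_net_def L2_net_def intro: Hs_ivl_1_L2)

lemma ddx_L2: "w \<in> Hs_net E l 1 \<Longrightarrow> ddx l w \<in> L2_net E l"
  by (auto simp: Hs_net_def L2_net_def ddx_def intro: weak_deriv_L2)

lemma Hdiv_net_Hs: "u \<in> Hdiv_net V E l \<Longrightarrow> u \<in> Hs_net E l 1"
  by (simp add: Hdiv_net_def)

lemma H10_net_Hs: "p \<in> H10_net V E l \<Longrightarrow> p \<in> Hs_net E l 1"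
  by (simp add: H10_net_def)

lemma bounded_coeff_mult_L2:
  assumes a: "bounded_coeff E l C0 C1 a" and w: "w \<in> L2_net E l" and "0 < C0"
  shows "(\<lambda>e x. a e x * w e x) \<in> L2_net E l"
  unfolding L2_net_def
proof safe
  fix e assume e: "e \<in> E"
  show "(\<lambda>x. a e x * w e x) \<in> L2_ivl (l e)"
  proof (rule L2_bounded_mult)
    show "a e \<in> borel_measurable (ivl (l e))" "w e \<in> L2_ivl (l e)"
      using a w e by (auto simp: bounded_coeff_def L2_net_def intro: L2_measurable)
    have "AE x in ivl (l e). C0 \<le> a e x \<and> a e x \<le> C1"
      using a e by (simp add: bounded_coeff_def)
    then show "AE x in ivl (l e). \<bar>a e x\<bar> \<le> C1"
      by eventually_elim (use \<open>0 < C0\<close> in auto)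
  qed
qed

lemma norm_bounded_coeff_mult_le:
  assumes a: "bounded_coeff E l C0 C1 a" and w: "w \<in> L2_net E l" and C: "0 < C0" "0 < C1"
  shows "norm_L2 E l (\<lambda>e x. a e x * w e x) \<le> C1 * norm_L2 E l w"
proof (rule norm_L2_leI)
  note aw = bounded_coeff_mult_L2[OF a w C(1)]
  have "inner_net E l (\<lambda>e x. a e x * w e x) (\<lambda>e x. a e x * w e x) \<le> (\<Sum>e\<in>E. C1\<^sup>2 * inner_L2_ivl (l e) (w e) (w e))"
    unfolding inner_net_def
  proof (rule sum_mono)
    fix e assume e: "e \<in> E"
    have AE: "AE x in ivl (l e). C0 \<le> a e x \<and> a e x \<le> C1"
      using a e by (simp add: bounded_coeff_def)
    have "inner_L2_ivl (l e) (\<lambda>x. a e x * w e x) (\<lambda>x. a e x * w e x) \<le> (\<integral>x. C1\<^sup>2 * (w e x)\<^sup>2 \<partial>ivl (l e))"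
      unfolding inner_L2_self
    proof (rule integral_mono_AE)
      show "integrable (ivl (l e)) (\<lambda>x. (a e x * w e x)\<^sup>2)"
        using aw e by (auto simp: L2_net_def intro: L2_square_integrable)
      show "integrable (ivl (l e)) (\<lambda>x. C1\<^sup>2 * (w e x)\<^sup>2)"
        using w e by (auto simp: L2_net_def intro: L2_square_integrable)
      show "AE x in ivl (l e). (a e x * w e x)\<^sup>2 \<le> C1\<^sup>2 * (w e x)\<^sup>2"
        using AE
      proof eventually_elim
        case (elim x)
        then have "(a e x)\<^sup>2 \<le> C1\<^sup>2" using C by (intro power_mono) auto
        then show ?case by (simp add: power_mult_distrib mult_right_mono)
      qed
    qed
    then show "inner_L2_ivl (l e) (\<lambda>x. a e x * w e x) (\<lambda>x. a e x * w e x) \<le> C1\<^sup>2 * inner_L2_ivl (l e) (w e) (w e)"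
      by (simp add: inner_L2_self)
  qed
  also have "\<dots> = (C1 * norm_L2 E l w)\<^sup>2"
    by (simp add: power_mult_distrib norm_L2_square inner_net_def sum_distrib_left)
  finally show "inner_net E l (\<lambda>e x. a e x * w e x) (\<lambda>e x. a e x * w e x) \<le> \<dots>" .
qed (use C in \<open>simp add: norm_L2_nonneg\<close>)

lemma bounded_coeff_coercive:
  assumes a: "bounded_coeff E l C0 C1 a" and w: "w \<in> L2_net E l" and C: "0 < C0"
  shows "C0 * (norm_L2 E l w)\<^sup>2 \<le> inner_net E l (\<lambda>e x. a e x * w e x) w"
proof -
  note aw = bounded_coeff_mult_L2[OF a w C(1)]
  have "C0 * inner_L2_ivl (l e) (w e) (w e) \<le> inner_L2_ivl (l e) (\<lambda>x. a e x * w e x) (w e)" if e: "e \<in> E" for e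
  proof -
    have AE: "AE x in ivl (l e). C0 \<le> a e x \<and> a e x \<le> C1"
      using a e by (simp add: bounded_coeff_def)
    have "(\<integral>x. C0 * (w e x)\<^sup>2 \<partial>ivl (l e)) \<le> inner_L2_ivl (l e) (\<lambda>x. a e x * w e x) (w e)"
      unfolding inner_L2_ivl_def
    proof (rule integral_mono_AE)
      show "integrable (ivl (l e)) (\<lambda>x. C0 * (w e x)\<^sup>2)"
        using w e by (auto simp: L2_net_def intro: L2_square_integrable)
      show "integrable (ivl (l e)) (\<lambda>x. a e x * w e x * w e x)"
        using aw w e by (auto simp: L2_net_def intro: L2_mult_integrable)
      show "AE x in ivl (l e). C0 * (w e x)\<^sup>2 \<le> a e x * w e x * w e x"
        using AE
      proof eventually_elim
        case (elim x)
        then have "C0 * (w e x)\<^sup>2 \<le> a e x * (w e x)\<^sup>2" by (intro mult_right_mono) auto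
        then show ?case by (simp add: power2_eq_square mult.assoc)
      qed
    qed
    then show ?thesis by (simp add: inner_L2_self)
  qed
  then show ?thesis
    by (simp add: norm_L2_square inner_net_def sum_distrib_left sum_mono)
qed

text \<open>Induction along an undirected path to \<open>b\<close>: each step puts a unit on the
  edge traversed, with the sign dictated by its orientation, and this moves the net inflow from
  \<open>v'\<close> to \<open>v\<close>. Nothing is required at \<open>b\<close>, so the trivial
  path carries the zero flow.\<close>

lemma ex_unit_flow:
  assumes fin: "finite E" and neq: "\<forall>e\<in>E. fst e \<noteq> snd e" and path: "(v, b) \<in> (E \<union> E\<inverse>)\<^sup>*"
  shows "\<exists>\<phi> :: 'v \<times> 'v \<Rightarrow> real. \<forall>w. w \<noteq> b \<longrightarrow> (\<Sum>e\<in>E. incidence e w * \<phi> e) = of_bool (w = v)"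
  using path
proof (induction rule: converse_rtrancl_induct)
  case base
  show ?case by (intro exI[of _ "\<lambda>_. 0"]) auto
next
  case (step v v')
  then obtain \<phi> where \<phi>: "\<And>w. w \<noteq> b \<Longrightarrow> (\<Sum>e\<in>E. incidence e w * \<phi> e) = of_bool (w = v')" by auto
  have *: "(\<Sum>e\<in>E. incidence e w * (\<phi> e + c * of_bool (e = e0))) = of_bool (w = v') + c * incidence e0 w"
    if "e0 \<in> E" "w \<noteq> b" for e0 c w
  proof -
    have "(\<Sum>e\<in>E. incidence e w * (\<phi> e + c * of_bool (e = e0)))
      = (\<Sum>e\<in>E. incidence e w * \<phi> e) + (\<Sum>e\<in>E. if e = e0 then c * incidence e0 w else 0)"
      unfolding sum.distrib[symmetric] by (intro sum.cong) (auto simp: algebra_simps)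
    then show ?thesis using \<phi>[OF that(2)] fin that(1) by simp
  qed
  have "(v, v') \<in> E \<or> (v', v) \<in> E" using step(1) by auto
  then show ?case
  proof
    assume e: "(v, v') \<in> E"
    then have "v \<noteq> v'" using neq by auto
    then show ?thesis
      using *[OF e, of _ "-1"]
      by (intro exI[of _ "\<lambda>e. \<phi> e + (-1) * of_bool (e = (v, v'))"]) (auto simp: incidence_def)
  next
    assume e: "(v', v) \<in> E"
    then have "v \<noteq> v'" using neq by auto
    then show ?thesis
      using *[OF e, of _ 1]
      by (intro exI[of _ "\<lambda>e. \<phi> e + 1 * of_bool (e = (v', v))"]) (auto simp: incidence_def)
  qed
qed

lemma sum_incident_edges:
  assumes "finite E"
  shows "(\<Sum>e\<in>incident_edges E v. incidence e v * F e) = (\<Sum>e\<in>E. incidence e v * F e)"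
  using assms by (intro sum.mono_neutral_left) (auto simp: incident_edges_def incidence_def)

text \<open>Superposition of the unit flows belonging to one boundary vertex \<open>b\<close>,
  weighted by \<open>d\<close>. \<open>K\<close> sums the absolute values of all these flows, so it
  depends on the graph alone and not on \<open>d\<close>.\<close>

lemma ex_flow:
  assumes net: "network V E l" and bdry: "boundary_vertices V E \<noteq> {}"
  shows "\<exists>K\<ge>0. \<forall>d :: 'v \<Rightarrow> real. \<exists>s. (\<forall>v\<in>interior_vertices V E. (\<Sum>e\<in>incident_edges E v. incidence e v * s e) = d v)
    \<and> (\<forall>e\<in>E. \<bar>s e\<bar> \<le> K * (\<Sum>v\<in>V. \<bar>d v\<bar>))"
proof -
  have finV: "finite V" and EV: "E \<subseteq> V \<times> V" and neq: "\<forall>e\<in>E. fst e \<noteq> snd e"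
    and con: "\<And>v w. v \<in> V \<Longrightarrow> w \<in> V \<Longrightarrow> (v, w) \<in> (E \<union> E\<inverse>)\<^sup>*"
    using net by (auto simp: network_def)
  then have fin: "finite E" by (meson finite_SigmaI finite_subset)
  obtain b where b: "b \<in> V" "b \<notin> interior_vertices V E"
    using bdry by (auto simp: boundary_vertices_def)
  obtain \<phi> :: "'v \<Rightarrow> 'v \<times> 'v \<Rightarrow> real"
    where \<phi>: "\<And>v w. v \<in> V \<Longrightarrow> w \<noteq> b \<Longrightarrow> (\<Sum>e\<in>E. incidence e w * \<phi> v e) = of_bool (w = v)"
    using ex_unit_flow[OF fin neq con[OF _ b(1)]] by metis
  let ?K = "\<Sum>v\<in>V. \<Sum>e\<in>E. \<bar>\<phi> v e\<bar>"
  have "\<exists>s. (\<forall>v\<in>interior_vertices V E. (\<Sum>e\<in>incident_edges E v. incidence e v * s e) = d v)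
    \<and> (\<forall>e\<in>E. \<bar>s e\<bar> \<le> ?K * (\<Sum>v\<in>V. \<bar>d v\<bar>))" for d :: "'v \<Rightarrow> real"
  proof (intro exI conjI ballI)
    let ?s = "\<lambda>e. \<Sum>v\<in>V. d v * \<phi> v e"
    show "(\<Sum>e\<in>incident_edges E w. incidence e w * ?s e) = d w" if w: "w \<in> interior_vertices V E" for w
    proof -
      have wb: "w \<noteq> b" "w \<in> V" using w b(2) by (auto simp: interior_vertices_def)
      have "(\<Sum>e\<in>incident_edges E w. incidence e w * ?s e) = (\<Sum>e\<in>E. \<Sum>v\<in>V. d v * (incidence e w * \<phi> v e))"
        unfolding sum_incident_edges[OF fin] by (simp add: sum_distrib_left mult_ac)
      also have "\<dots> = (\<Sum>v\<in>V. d v * (\<Sum>e\<in>E. incidence e w * \<phi> v e))"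
        by (subst sum.swap) (simp add: sum_distrib_left)
      also have "\<dots> = (\<Sum>v\<in>V. if v = w then d v else 0)"
        using \<phi>[OF _ wb(1)] by (intro sum.cong) auto
      finally show ?thesis using finV wb(2) by simp
    qed
    show "\<bar>?s e\<bar> \<le> ?K * (\<Sum>v\<in>V. \<bar>d v\<bar>)" if e: "e \<in> E" for e
    proof -
      have "\<bar>\<phi> v e\<bar> \<le> ?K" if v: "v \<in> V" for v
      proof -
        have "\<bar>\<phi> v e\<bar> \<le> (\<Sum>e\<in>E. \<bar>\<phi> v e\<bar>)" by (rule member_le_sum[OF e _ fin]) auto
        also have "\<dots> \<le> ?K" by (rule member_le_sum[OF v _ finV]) (auto intro: sum_nonneg)
        finally show ?thesis .
      qed
      then have "(\<Sum>v\<in>V. \<bar>d v * \<phi> v e\<bar>) \<le> (\<Sum>v\<in>V. ?K * \<bar>d v\<bar>)"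
        unfolding abs_mult mult.commute[of ?K] by (intro sum_mono mult_left_mono) auto
      then show ?thesis
        unfolding sum_distrib_left by (rule order.trans[OF sum_abs])
    qed
  qed
  then show ?thesis by (intro exI[of _ ?K]) (auto intro!: sum_nonneg)
qed

section \<open>Finite element spaces on a network\<close>

locale network_mesh =
  fixes V :: "'v set" and E :: "('v \<times> 'v) set" and l :: "'v \<times> 'v \<Rightarrow> real"
    and N :: "'v \<times> 'v \<Rightarrow> nat"
  assumes network: "network V E l" and mesh: "is_mesh E N"
begin

lemma finite_V: "finite V" and E_subset: "E \<subseteq> V \<times> V"
  and edge_neq: "e \<in> E \<Longrightarrow> fst e \<noteq> snd e" and l_pos: "e \<in> E \<Longrightarrow> 0 < l e"
  using network by (auto simp: network_def)

lemma finite_E: "finite E"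
  using finite_V E_subset by (meson finite_SigmaI finite_subset)

lemma uniform_mesh_edge: "e \<in> E \<Longrightarrow> uniform_mesh (l e) (N e)"
  using l_pos mesh by (auto simp: uniform_mesh_def is_mesh_def)

lemma Hs_edge: "w \<in> Hs_net E l s \<Longrightarrow> e \<in> E \<Longrightarrow> w e \<in> Hs_ivl (l e) s"
  by (simp add: Hs_net_def)

lemma L2_edge: "w \<in> L2_net E l \<Longrightarrow> e \<in> E \<Longrightarrow> w e \<in> L2_ivl (l e)"
  by (simp add: L2_net_def)

section \<open>Discrete functions given by one coefficient per cell\<close>

definition step_net :: "('v \<times> 'v \<Rightarrow> nat \<Rightarrow> real) \<Rightarrow> 'v netfun" where
  "step_net c = (\<lambda>e. step_function (l e) (N e) (c e))"

definition proj_net :: "'v netfun \<Rightarrow> 'v netfun" where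
  "proj_net w = (\<lambda>e. cell_proj (l e) (N e) (w e))"

definition mean_net :: "'v netfun \<Rightarrow> 'v \<times> 'v \<Rightarrow> nat \<Rightarrow> real" where
  "mean_net w = (\<lambda>e. cell_mean (l e) (N e) (w e))"

lemma proj_net_eq: "proj_net w = step_net (mean_net w)"
  by (simp add: proj_net_def step_net_def mean_net_def cell_proj_def fun_eq_iff)

lemma step_net_L2: "step_net c \<in> L2_net E l"
  by (simp add: L2_net_def step_net_def uniform_mesh.step_function_L2[OF uniform_mesh_edge])

lemma proj_net_L2: "proj_net w \<in> L2_net E l"
  by (simp add: proj_net_eq step_net_L2)

lemma step_net_diff: "(\<lambda>e x. step_net c e x - step_net c' e x) = step_net (\<lambda>e i. c e i - c' e i)"
  by (simp add: step_net_def step_function_def fun_eq_iff left_diff_distrib sum_subtractf)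

lemma inner_proj_net_step_net:
  assumes "w \<in> L2_net E l"
  shows "inner_net E l (proj_net w) (step_net c) = inner_net E l w (step_net c)"
  unfolding inner_net_def proj_net_def step_net_def using assms
  by (intro sum.cong refl uniform_mesh.inner_cell_proj_step_function uniform_mesh_edge) (auto simp: L2_net_def)

lemma mesh_eq:
  assumes "e \<in> E"
  shows "mesh l N e = {{real i * uniform_mesh.h (l e) (N e)..real (Suc i) * uniform_mesh.h (l e) (N e)} | i. i < N e}"
  unfolding mesh_def local_mesh_size_def uniform_mesh.h_def[OF uniform_mesh_edge[OF assms]] ..

lemma step_net_Qh: "step_net c \<in> Qh E l N"
  unfolding Qh_def Pk_net_def
proof (intro CollectI conjI ballI step_net_L2)
  fix e K assume e: "e \<in> E" and K: "K \<in> mesh l N e"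
  interpret uniform_mesh "l e" "N e" by (rule uniform_mesh_edge[OF e])
  obtain i where i: "i < N e" "K = cell i" using K unfolding mesh_eq[OF e] by auto
  show "\<exists>q :: real poly. degree q \<le> 0 \<and> (AE x in lebesgue_on K. step_net c e x = poly q x)"
    using step_function_on_cell[OF i(1), of "c e"] unfolding i(2)
    by (intro exI[of _ "[:c e i:]"]) (simp add: step_net_def)
qed

lemma Pk_net_cell:
  assumes "w \<in> Pk_net E l N k" "e \<in> E" "i < N e"
  shows "\<exists>q :: real poly. degree q \<le> k \<and>
    (AE x in lebesgue_on {real i * uniform_mesh.h (l e) (N e)..real (Suc i) * uniform_mesh.h (l e) (N e)}. w e x = poly q x)"
proof -
  have "{real i * uniform_mesh.h (l e) (N e)..real (Suc i) * uniform_mesh.h (l e) (N e)} \<in> mesh l N e"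
    unfolding mesh_eq[OF assms(2)] using assms(3) by blast
  then show ?thesis using assms(1,2) unfolding Pk_net_def by blast
qed

lemma Qh_AE_step_net:
  assumes "q \<in> Qh E l N"
  obtains c where "\<And>e. e \<in> E \<Longrightarrow> AE x in ivl (l e). q e x = step_net c e x"
proof -
  have "\<exists>c. AE x in ivl (l e). q e x = step_function (l e) (N e) c x" if e: "e \<in> E" for e
    using uniform_mesh.piecewise_constant_step_function[OF uniform_mesh_edge[OF e]]
      Pk_net_cell[OF assms[unfolded Qh_def] e] by blast
  then obtain c where "\<And>e. e \<in> E \<Longrightarrow> AE x in ivl (l e). q e x = step_function (l e) (N e) (c e) x" by metis
  then show ?thesis by (intro that[of c]) (simp add: step_net_def)
qed

lemma Vh_Hdiv: "v \<in> Vh V E l N \<Longrightarrow> v \<in> Hdiv_net V E l"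
  by (simp add: Vh_def)

lemma Vh_ddx_AE_step_net:
  assumes "v \<in> Vh V E l N"
  obtains c where "\<And>e. e \<in> E \<Longrightarrow> AE x in ivl (l e). ddx l v e x = step_net c e x"
proof -
  have "\<exists>c. AE x in ivl (l e). ddx l v e x = step_function (l e) (N e) c x" if e: "e \<in> E" for e
  proof -
    have "v \<in> Pk_net E l N 1" using assms by (simp add: Vh_def)
    then show ?thesis
      unfolding ddx_def
      using uniform_mesh.piecewise_affine_weak_deriv[OF uniform_mesh_edge[OF e]
          Hs_edge[OF Hdiv_net_Hs[OF Vh_Hdiv[OF assms]] e]] Pk_net_cell[OF _ e] by blast
  qed
  then obtain c where "\<And>e. e \<in> E \<Longrightarrow> AE x in ivl (l e). ddx l v e x = step_function (l e) (N e) (c e) x" by metis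
  then show ?thesis by (intro that[of c]) (simp add: step_net_def)
qed

text \<open>Up to null sets the general form of a broken H1 function: \<open>s e\<close> is the
  value at the tail of \<open>e\<close>, \<open>g\<close> the edgewise derivative, and the value at
  the head is \<open>s e\<close> plus the integral of \<open>g e\<close>.\<close>

definition primitive_net :: "('v \<times> 'v \<Rightarrow> real) \<Rightarrow> 'v netfun \<Rightarrow> 'v netfun" where
  "primitive_net s g = (\<lambda>e x. s e + primitive (l e) (g e) x)"

lemma primitive_net_Hs: "g \<in> L2_net E l \<Longrightarrow> primitive_net s g \<in> Hs_net E l 1"
  by (auto simp: Hs_net_def primitive_net_def intro: primitive_Hs_1 L2_edge l_pos)

lemma ddx_primitive_net:
  assumes "g \<in> L2_net E l" "e \<in> E"
  shows "AE x in ivl (l e). ddx l (primitive_net s g) e x = g e x"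
  unfolding ddx_def primitive_net_def
  by (rule weak_deriv_primitive[OF L2_edge[OF assms] l_pos[OF assms(2)]])

lemma vertex_value_primitive_net:
  assumes g: "g \<in> L2_net E l" and e: "e \<in> E"
  shows "vertex_value l (primitive_net s g) e v
    = s e + (if v = fst e then 0 else \<integral>x. g e x \<partial>ivl (l e))"
  using trace_primitive[OF L2_edge[OF g e] l_pos[OF e], of 0 "s e"]
    trace_primitive[OF L2_edge[OF g e] l_pos[OF e], of "l e" "s e"] l_pos[OF e]
  by (simp add: vertex_value_def primitive_net_def primitive_0 primitive_right)

text \<open>The hypothesis is the Kirchhoff condition written with tail values and edge integrals,
  the data from which both the interpolant and the inf-sup function are built.\<close>

lemma primitive_step_net_Vh:
  assumes "\<And>v. v \<in> interior_vertices V E \<Longrightarrow>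
    (\<Sum>e\<in>incident_edges E v. incidence e v * (s e + (if v = fst e then 0 else \<integral>x. step_net c e x \<partial>ivl (l e)))) = 0"
  shows "primitive_net s (step_net c) \<in> Vh V E l N"
proof -
  have Hs: "primitive_net s (step_net c) \<in> Hs_net E l 1"
    by (rule primitive_net_Hs[OF step_net_L2])
  have "primitive_net s (step_net c) \<in> Hdiv_net V E l"
    unfolding Hdiv_net_def
  proof (safe intro!: Hs)
    fix v assume v: "v \<in> interior_vertices V E"
    have "(\<Sum>e\<in>incident_edges E v. incidence e v * vertex_value l (primitive_net s (step_net c)) e v)
      = (\<Sum>e\<in>incident_edges E v. incidence e v * (s e + (if v = fst e then 0 else \<integral>x. step_net c e x \<partial>ivl (l e))))"
      by (intro sum.cong refl) (simp add: vertex_value_primitive_net[OF step_net_L2] incident_edges_def)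
    then show "(\<Sum>e\<in>incident_edges E v. incidence e v * vertex_value l (primitive_net s (step_net c)) e v) = 0"
      using assms[OF v] by simp
  qed
  moreover have "primitive_net s (step_net c) \<in> Pk_net E l N 1"
    unfolding Pk_net_def
  proof (intro CollectI conjI ballI Hs_net_1_L2 Hs)
    fix e K assume e: "e \<in> E" and K: "K \<in> mesh l N e"
    interpret uniform_mesh "l e" "N e" by (rule uniform_mesh_edge[OF e])
    obtain i where i: "i < N e" "K = cell i" using K unfolding mesh_eq[OF e] by auto
    let ?b = "s e + primitive (l e) (step_net c e) (real i * h) - c e i * (real i * h)"
    have "primitive_net s (step_net c) e x = poly [:?b, c e i:] x" if "x \<in> cell i" for x
      using primitive_step_function[OF i(1) that, of "c e"]
      by (simp add: primitive_net_def step_net_def algebra_simps)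
    then have "AE x in lebesgue_on K. primitive_net s (step_net c) e x = poly [:?b, c e i:] x"
      unfolding i(2) by (intro AE_I2) simp
    then show "\<exists>q :: real poly. degree q \<le> 1 \<and> (AE x in lebesgue_on K. primitive_net s (step_net c) e x = poly q x)"
      by (intro exI[of _ "[:?b, c e i:]"]) simp
  qed
  ultimately show ?thesis by (simp add: Vh_def)
qed

lemma ddx_diff:
  assumes "w \<in> Hs_net E l 1" "z \<in> Hs_net E l 1" "e \<in> E"
  shows "AE x in ivl (l e). ddx l (\<lambda>e x. w e x - z e x) e x = ddx l w e x - ddx l z e x"
  unfolding ddx_def by (rule weak_deriv_diff) (use assms in \<open>auto intro: Hs_edge l_pos\<close>)

lemma Hs_net_1_diff: "w \<in> Hs_net E l 1 \<Longrightarrow> z \<in> Hs_net E l 1 \<Longrightarrow> (\<lambda>e x. w e x - z e x) \<in> Hs_net E l 1"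
  by (auto simp: Hs_net_def intro!: Hs_1_diff l_pos)

lemma vertex_value_diff:
  assumes "w \<in> Hs_net E l 1" "z \<in> Hs_net E l 1" "e \<in> E"
  shows "vertex_value l (\<lambda>e x. w e x - z e x) e v = vertex_value l w e v - vertex_value l z e v"
  unfolding vertex_value_def
  by (rule trace_diff) (use assms l_pos[of e] in \<open>auto intro: Hs_edge simp: less_imp_le\<close>)

text \<open>Makes the difference of discrete solution and interpolant an admissible test
  function.\<close>

lemma Vh_diff:
  assumes w: "w \<in> Vh V E l N" and z: "z \<in> Vh V E l N"
  shows "(\<lambda>e x. w e x - z e x) \<in> Vh V E l N"
proof -
  have Hs: "w \<in> Hs_net E l 1" "z \<in> Hs_net E l 1" using w z by (auto intro: Hdiv_net_Hs Vh_Hdiv)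
  have "(\<lambda>e x. w e x - z e x) \<in> Hdiv_net V E l"
    unfolding Hdiv_net_def
  proof (intro CollectI conjI ballI Hs_net_1_diff Hs)
    fix v assume v: "v \<in> interior_vertices V E"
    have "(\<Sum>e\<in>incident_edges E v. incidence e v * vertex_value l (\<lambda>e x. w e x - z e x) e v)
      = (\<Sum>e\<in>incident_edges E v. incidence e v * vertex_value l w e v)
        - (\<Sum>e\<in>incident_edges E v. incidence e v * vertex_value l z e v)"
      unfolding sum_subtractf[symmetric]
      by (intro sum.cong refl) (simp add: vertex_value_diff[OF Hs] incident_edges_def right_diff_distrib)
    then show "(\<Sum>e\<in>incident_edges E v. incidence e v * vertex_value l (\<lambda>e x. w e x - z e x) e v) = 0"
      using w z v by (simp add: Vh_def Hdiv_net_def)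
  qed
  moreover have "(\<lambda>e x. w e x - z e x) \<in> Pk_net E l N 1"
    unfolding Pk_net_def
  proof (intro CollectI conjI ballI L2_net_diff)
    fix e K assume eK: "e \<in> E" "K \<in> mesh l N e"
    obtain q r :: "real poly" where q: "degree q \<le> 1" "AE x in lebesgue_on K. w e x = poly q x"
      and r: "degree r \<le> 1" "AE x in lebesgue_on K. z e x = poly r x"
      using w z eK unfolding Vh_def Pk_net_def by blast
    have "AE x in lebesgue_on K. w e x - z e x = poly (q - r) x"
      using q(2) r(2) by eventually_elim simp
    then show "\<exists>q :: real poly. degree q \<le> 1 \<and> (AE x in lebesgue_on K. w e x - z e x = poly q x)"
      using degree_diff_le[OF q(1) r(1)] by blast
  qed (use w z in \<open>auto simp: Vh_def Pk_net_def\<close>)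
  ultimately show ?thesis by (simp add: Vh_def)
qed

text \<open>The end terms of the edges are regrouped by vertices: at an interior vertex the common
  value of \<open>p\<close> factors out of the Kirchhoff sum of \<open>v\<close>, at a boundary
  vertex \<open>p\<close> vanishes.\<close>

lemma network_integration_by_parts:
  assumes p: "p \<in> H10_net V E l" and v: "v \<in> Hdiv_net V E l"
  shows "inner_net E l (ddx l p) v + inner_net E l p (ddx l v) = 0"
proof -
  let ?p = "vertex_value l p" and ?v = "vertex_value l v"
  note pH = Hs_edge[OF H10_net_Hs[OF p]] and vH = Hs_edge[OF Hdiv_net_Hs[OF v]]
  have "inner_L2_ivl (l e) (ddx l p e) (v e) + inner_L2_ivl (l e) (p e) (ddx l v e)
    = (\<Sum>w\<in>V. incidence e w * (?p e w * ?v e w))" if e: "e \<in> E" for e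
  proof -
    \<comment> \<open>Incidence numbers extend the two end terms of an edge to a sum over all
      vertices, which then permits exchanging the summations.\<close>
    have "(\<Sum>w\<in>V. incidence e w * (?p e w * ?v e w)) = (\<Sum>w\<in>{fst e, snd e}. incidence e w * (?p e w * ?v e w))"
      using E_subset e finite_V by (intro sum.mono_neutral_right) (auto simp: incidence_def)
    also have "\<dots> = ?p e (snd e) * ?v e (snd e) - ?p e (fst e) * ?v e (fst e)"
      using edge_neq[OF e] by (simp add: incidence_def)
    also have "\<dots> = inner_L2_ivl (l e) (ddx l p e) (v e) + inner_L2_ivl (l e) (p e) (ddx l v e)"
      using H1_integration_by_parts[OF pH[OF e] vH[OF e] l_pos[OF e]] edge_neq[OF e]
      by (simp add: vertex_value_def ddx_def)
    finally show ?thesis by simp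
  qed
  then have "inner_net E l (ddx l p) v + inner_net E l p (ddx l v)
      = (\<Sum>e\<in>E. \<Sum>w\<in>V. incidence e w * (?p e w * ?v e w))"
    by (simp add: inner_net_def sum.distrib[symmetric])
  also have "\<dots> = (\<Sum>w\<in>V. \<Sum>e\<in>incident_edges E w. incidence e w * (?p e w * ?v e w))"
    by (subst sum.swap) (simp add: sum_incident_edges[OF finite_E])
  also have "\<dots> = 0"
  proof (rule sum.neutral, rule ballI)
    fix w assume "w \<in> V"
    then consider "w \<in> boundary_vertices V E" | "w \<in> interior_vertices V E"
      by (auto simp: boundary_vertices_def)
    then show "(\<Sum>e\<in>incident_edges E w. incidence e w * (?p e w * ?v e w)) = 0"
    proof cases
      case 1
      then show ?thesis using p by (simp add: H10_net_def)
    next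
      case 2
      then have "incident_edges E w \<noteq> {}" by (auto simp: interior_vertices_def)
      then obtain e0 where e0: "e0 \<in> incident_edges E w" by blast
      have "(\<Sum>e\<in>incident_edges E w. incidence e w * (?p e w * ?v e w))
        = (\<Sum>e\<in>incident_edges E w. ?p e0 w * (incidence e w * ?v e w))"
      proof (rule sum.cong)
        fix e assume "e \<in> incident_edges E w"
        then have "?p e w = ?p e0 w" using p 2 e0 unfolding H10_net_def by blast
        then show "incidence e w * (?p e w * ?v e w) = ?p e0 w * (incidence e w * ?v e w)" by simp
      qed simp
      also have "\<dots> = 0"
        using v 2 by (simp add: sum_distrib_left[symmetric] Hdiv_net_def)
      finally show ?thesis .
    qed
  qed
  finally show ?thesis .
qed

section \<open>Projection error and inf-sup condition on the whole network\<close>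

lemma local_mesh_size_le: "e \<in> E \<Longrightarrow> uniform_mesh.h (l e) (N e) \<le> mesh_size E l N"
  unfolding mesh_size_def uniform_mesh.h_def[OF uniform_mesh_edge]
  using finite_E by (intro Max_ge) (auto simp: local_mesh_size_def)

text \<open>The bound \<open>B e\<close> is left free so that one estimate serves both
  \<open>p\<close>, with its own norm of order \<open>m\<close>, and the derivative of
  \<open>u\<close>, with the norm of \<open>u\<close> of order \<open>m + 1\<close>.\<close>

lemma proj_net_error:
  assumes w: "w \<in> L2_net E l" and m: "0 \<le> m" "m \<le> 1"
    and err: "\<And>e. e \<in> E \<Longrightarrow> w e \<in> Hs_ivl (l e) m \<and> Hs_norm_sq_ivl (l e) m (w e) \<le> B e"
  shows "norm_L2 E l (\<lambda>e x. w e x - proj_net w e x) \<le> mesh_size E l N powr m * sqrt (\<Sum>e\<in>E. B e)"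
proof (rule norm_L2_leI)
  let ?H = "mesh_size E l N"
  have B: "0 \<le> B e" if e: "e \<in> E" for e
  proof -
    have "0 \<le> Hs_norm_sq_ivl (l e) m (w e)"
      unfolding Hs_norm_sq_ivl_def
      by (auto intro!: add_nonneg_nonneg sum_nonneg inner_L2_nonneg Bochner_Integration.integral_nonneg
          simp: gagliardo_kernel_def split: prod.split)
    then show ?thesis using err[OF e] by linarith
  qed
  have "inner_net E l (\<lambda>e x. w e x - proj_net w e x) (\<lambda>e x. w e x - proj_net w e x) \<le> (\<Sum>e\<in>E. (?H powr m)\<^sup>2 * B e)"
    unfolding inner_net_def
  proof (rule sum_mono)
    fix e assume e: "e \<in> E"
    interpret uniform_mesh "l e" "N e" by (rule uniform_mesh_edge[OF e])
    have "inner_L2_ivl (l e) (\<lambda>x. w e x - proj_net w e x) (\<lambda>x. w e x - proj_net w e x)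
      \<le> h powr (2 * m) * Hs_norm_sq_ivl (l e) m (w e)"
      unfolding proj_net_def using err[OF e] m by (intro cell_proj_error) auto
    also have "\<dots> \<le> h powr (2 * m) * B e"
      using err[OF e] by (intro mult_left_mono) auto
    also have "\<dots> \<le> ?H powr (2 * m) * B e"
      using local_mesh_size_le[OF e] h_pos m B[OF e] by (intro mult_right_mono powr_mono2) auto
    also have "?H powr (2 * m) = (?H powr m)\<^sup>2"
      by (simp add: power2_eq_square powr_add[symmetric])
    finally show "inner_L2_ivl (l e) (\<lambda>x. w e x - proj_net w e x) (\<lambda>x. w e x - proj_net w e x) \<le> (?H powr m)\<^sup>2 * B e" .
  qed
  also have "\<dots> = (?H powr m * sqrt (\<Sum>e\<in>E. B e))\<^sup>2"
    using B by (simp add: power_mult_distrib sum_nonneg sum_distrib_left)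
  finally show "inner_net E l (\<lambda>e x. w e x - proj_net w e x) (\<lambda>e x. w e x - proj_net w e x) \<le> \<dots>" .
  show "0 \<le> ?H powr m * sqrt (\<Sum>e\<in>E. B e)"
    using B by (simp add: sum_nonneg)
qed

text \<open>Integration along the edges gives the right derivative but spoils the Kirchhoff
  conditions; edgewise constants repair them and leave the derivative alone. These constants cause
  the first summand of the bound, with \<open>sqrt\<close> of the total length as the norm of the
  constant one; the primitive causes the second. \<open>K\<close> enters as a hypothesis and is
  thereby fixed independently of the mesh.\<close>

lemma inf_sup:
  assumes K: "0 \<le> K" "\<And>d :: 'v \<Rightarrow> real. \<exists>s. (\<forall>v\<in>interior_vertices V E. (\<Sum>e\<in>incident_edges E v. incidence e v * s e) = d v)
    \<and> (\<forall>e\<in>E. \<bar>s e\<bar> \<le> K * (\<Sum>v\<in>V. \<bar>d v\<bar>))"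
  obtains z where "z \<in> Vh V E l N" "\<And>e. e \<in> E \<Longrightarrow> AE x in ivl (l e). ddx l z e x = step_net c e x"
    "norm_L2 E l z \<le> (K * real (card V) * (\<Sum>e\<in>E. sqrt (l e)) * sqrt (\<Sum>e\<in>E. l e) + (\<Sum>e\<in>E. l e)) * norm_L2 E l (step_net c)"
proof -
  define \<rho> where "\<rho> = step_net c"
  note \<rho> = step_net_L2[of c, folded \<rho>_def]
  let ?\<Lambda> = "\<Sum>e\<in>E. l e" and ?S = "\<Sum>e\<in>E. sqrt (l e)" and ?n = "norm_L2 E l \<rho>"
  define Q where "Q e = (\<integral>x. \<rho> e x \<partial>ivl (l e))" for e
  \<comment> \<open>Only edges ending at \<open>v\<close> contribute, since the primitive vanishes
    at the tail. Their incidence number is one, so \<open>d\<close> is minus the excess to be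
    compensated.\<close>
  define d where "d v = - (\<Sum>e\<in>incident_edges E v. if v = fst e then 0 else Q e)" for v
  obtain s where s: "\<And>v. v \<in> interior_vertices V E \<Longrightarrow> (\<Sum>e\<in>incident_edges E v. incidence e v * s e) = d v"
    "\<And>e. e \<in> E \<Longrightarrow> \<bar>s e\<bar> \<le> K * (\<Sum>v\<in>V. \<bar>d v\<bar>)"
    using K(2)[of d] by auto
  have l_le: "l e \<le> ?\<Lambda>" if "e \<in> E" for e
    using l_pos finite_E that by (intro member_le_sum) (auto simp: less_imp_le)
  have \<Lambda>0: "0 \<le> ?\<Lambda>" using l_pos by (intro sum_nonneg) (simp add: less_imp_le)
  have S0: "0 \<le> ?S" using l_pos by (intro sum_nonneg) (simp add: less_imp_le)
  have n_e: "inner_L2_ivl (l e) (\<rho> e) (\<rho> e) \<le> ?n\<^sup>2" if "e \<in> E" for e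
    unfolding norm_L2_square inner_net_def
    using that finite_E by (intro member_le_sum inner_L2_nonneg) auto
  have Q_le: "\<bar>Q e\<bar> \<le> sqrt (l e) * ?n" if e: "e \<in> E" for e
  proof -
    have "(Q e)\<^sup>2 \<le> l e * inner_L2_ivl (l e) (\<rho> e) (\<rho> e)"
      using primitive_square_le[OF L2_edge[OF \<rho> e], of "l e"] l_pos[OF e]
      by (simp add: Q_def primitive_right)
    also have "\<dots> \<le> l e * ?n\<^sup>2"
      using n_e[OF e] l_pos[OF e] by (intro mult_left_mono) auto
    also have "\<dots> = (sqrt (l e) * ?n)\<^sup>2"
      using l_pos[OF e] by (simp add: power_mult_distrib)
    finally have "\<bar>Q e\<bar>\<^sup>2 \<le> (sqrt (l e) * ?n)\<^sup>2" by simp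
    then show ?thesis
      by (rule power2_le_imp_le) (simp add: norm_L2_nonneg less_imp_le[OF l_pos[OF e]])
  qed
  have d_le: "\<bar>d v\<bar> \<le> ?S * ?n" for v
  proof -
    have "\<bar>d v\<bar> \<le> (\<Sum>e\<in>incident_edges E v. \<bar>if v = fst e then 0 else Q e\<bar>)"
      unfolding d_def abs_minus_cancel by (rule sum_abs)
    also have "\<dots> \<le> (\<Sum>e\<in>incident_edges E v. \<bar>Q e\<bar>)"
      by (intro sum_mono) auto
    also have "\<dots> \<le> (\<Sum>e\<in>E. \<bar>Q e\<bar>)"
      using finite_E by (intro sum_mono2) (auto simp: incident_edges_def)
    also have "\<dots> \<le> (\<Sum>e\<in>E. sqrt (l e) * ?n)"
      by (intro sum_mono Q_le)
    finally show ?thesis by (simp add: sum_distrib_right)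
  qed
  have s_le: "\<bar>s e\<bar> \<le> K * real (card V) * ?S * ?n" if e: "e \<in> E" for e
  proof -
    have "K * (\<Sum>v\<in>V. \<bar>d v\<bar>) \<le> K * (\<Sum>v\<in>V. ?S * ?n)"
      by (intro mult_left_mono sum_mono d_le K)
    then show ?thesis using s(2)[OF e] by (simp add: mult_ac)
  qed
  let ?z = "primitive_net s \<rho>"
  have "?z \<in> Vh V E l N"
    unfolding \<rho>_def
  proof (rule primitive_step_net_Vh)
    fix v assume v: "v \<in> interior_vertices V E"
    have "(\<Sum>e\<in>incident_edges E v. incidence e v * (s e + (if v = fst e then 0 else \<integral>x. step_net c e x \<partial>ivl (l e))))
      = (\<Sum>e\<in>incident_edges E v. incidence e v * s e) + (\<Sum>e\<in>incident_edges E v. if v = fst e then 0 else Q e)"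
      unfolding sum.distrib[symmetric]
      by (intro sum.cong refl) (auto simp: incident_edges_def incidence_def Q_def \<rho>_def algebra_simps)
    then show "(\<Sum>e\<in>incident_edges E v. incidence e v * (s e + (if v = fst e then 0 else \<integral>x. step_net c e x \<partial>ivl (l e)))) = 0"
      using s(1)[OF v] by (simp add: d_def)
  qed
  moreover have "AE x in ivl (l e). ddx l ?z e x = step_net c e x" if "e \<in> E" for e
    using ddx_primitive_net[OF \<rho> that] by (simp add: \<rho>_def)
  moreover have "norm_L2 E l ?z \<le> (K * real (card V) * ?S * sqrt ?\<Lambda> + ?\<Lambda>) * ?n"
  proof -
    let ?c = "\<lambda>e x. s e" and ?P = "\<lambda>e. primitive (l e) (\<rho> e)"
    have c: "?c \<in> L2_net E l" by (simp add: L2_net_def L2_const)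
    have P: "?P \<in> L2_net E l"
      by (simp add: L2_net_def primitive_L2 L2_integrable L2_edge[OF \<rho>])
    let ?B = "K * real (card V) * ?S * ?n"
    have B0: "0 \<le> ?B" using K(1) S0 by (simp add: norm_L2_nonneg)
    have nc: "norm_L2 E l ?c \<le> ?B * sqrt ?\<Lambda>"
    proof (rule norm_L2_leI)
      have "inner_L2_ivl (l e) (\<lambda>x. s e) (\<lambda>x. s e) \<le> ?B\<^sup>2 * l e" if e: "e \<in> E" for e
      proof -
        have "\<bar>s e\<bar>\<^sup>2 \<le> ?B\<^sup>2" using s_le[OF e] by (intro power_mono) auto
        then show ?thesis
          using l_pos[OF e] by (simp add: inner_L2_ivl_def measure_restrict_space power2_eq_square mult.commute mult_left_mono)
      qed
      then have "inner_net E l ?c ?c \<le> (\<Sum>e\<in>E. ?B\<^sup>2 * l e)"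
        unfolding inner_net_def by (intro sum_mono)
      also have "\<dots> = (?B * sqrt ?\<Lambda>)\<^sup>2"
        using \<Lambda>0 by (simp add: power_mult_distrib sum_distrib_left)
      finally show "inner_net E l ?c ?c \<le> (?B * sqrt ?\<Lambda>)\<^sup>2" .
      show "0 \<le> ?B * sqrt ?\<Lambda>" using B0 \<Lambda>0 by simp
    qed
    have nP: "norm_L2 E l ?P \<le> ?\<Lambda> * ?n"
    proof (rule norm_L2_leI)
      have "inner_L2_ivl (l e) (?P e) (?P e) \<le> ?\<Lambda>\<^sup>2 * inner_L2_ivl (l e) (\<rho> e) (\<rho> e)" if e: "e \<in> E" for e
      proof -
        have "inner_L2_ivl (l e) (?P e) (?P e) \<le> (l e)\<^sup>2 * inner_L2_ivl (l e) (\<rho> e) (\<rho> e)"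
          using l_pos[OF e] by (intro inner_primitive_le L2_edge[OF \<rho> e]) simp
        also have "\<dots> \<le> ?\<Lambda>\<^sup>2 * inner_L2_ivl (l e) (\<rho> e) (\<rho> e)"
          using l_le[OF e] l_pos[OF e] by (intro mult_right_mono power_mono inner_L2_nonneg) auto
        finally show ?thesis .
      qed
      then have "inner_net E l ?P ?P \<le> (\<Sum>e\<in>E. ?\<Lambda>\<^sup>2 * inner_L2_ivl (l e) (\<rho> e) (\<rho> e))"
        unfolding inner_net_def by (intro sum_mono)
      also have "\<dots> = (?\<Lambda> * ?n)\<^sup>2"
        by (simp add: power_mult_distrib norm_L2_square inner_net_def sum_distrib_left)
      finally show "inner_net E l ?P ?P \<le> (?\<Lambda> * ?n)\<^sup>2" .
      show "0 \<le> ?\<Lambda> * ?n" using \<Lambda>0 by (simp add: norm_L2_nonneg)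
    qed
    have "norm_L2 E l ?z \<le> norm_L2 E l ?c + norm_L2 E l ?P"
      unfolding primitive_net_def by (rule norm_L2_add_le[OF c P])
    also have "\<dots> \<le> ?B * sqrt ?\<Lambda> + ?\<Lambda> * ?n" using nc nP by simp
    finally show ?thesis by (simp add: algebra_simps)
  qed
  ultimately show ?thesis using that unfolding \<rho>_def by blast
qed

end

section \<open>Error analysis\<close>

context network_mesh
begin

text \<open>The projection preserves the integral of the derivative over each edge, so the Kirchhoff
  sums of the interpolant are literally those of \<open>u\<close>.\<close>

lemma interpolant_Vh:
  assumes u: "u \<in> Hdiv_net V E l"
  shows "primitive_net (\<lambda>e. trace_ivl (l e) (u e) 0) (proj_net (ddx l u)) \<in> Vh V E l N"
  unfolding proj_net_eq
proof (rule primitive_step_net_Vh)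
  fix v assume v: "v \<in> interior_vertices V E"
  have "trace_ivl (l e) (u e) 0 + (if v = fst e then 0 else \<integral>x. step_net (mean_net (ddx l u)) e x \<partial>ivl (l e))
      = vertex_value l u e v" if e: "e \<in> E" for e
  proof -
    interpret uniform_mesh "l e" "N e" by (rule uniform_mesh_edge[OF e])
    note ue = Hs_edge[OF Hdiv_net_Hs[OF u] e]
    have "(\<integral>x. step_net (mean_net (ddx l u)) e x \<partial>ivl (l e)) = primitive (l e) (weak_deriv (l e) (u e)) (l e)"
      using integral_cell_proj[OF weak_deriv_L2[OF ue]]
      unfolding proj_net_eq[symmetric] by (simp add: proj_net_def ddx_def primitive_right)
    then show ?thesis
      using trace_eq_primitive[OF ue L_pos, of "l e"] L_pos by (simp add: vertex_value_def)
  qed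
  then have "(\<Sum>e\<in>incident_edges E v. incidence e v * (trace_ivl (l e) (u e) 0 +
        (if v = fst e then 0 else \<integral>x. step_net (mean_net (ddx l u)) e x \<partial>ivl (l e))))
      = (\<Sum>e\<in>incident_edges E v. incidence e v * vertex_value l u e v)"
    by (intro sum.cong refl) (simp add: incident_edges_def)
  then show "(\<Sum>e\<in>incident_edges E v. incidence e v * (trace_ivl (l e) (u e) 0 +
        (if v = fst e then 0 else \<integral>x. step_net (mean_net (ddx l u)) e x \<partial>ivl (l e)))) = 0"
    using u v by (simp add: Hdiv_net_def)
qed

lemma interpolation_error:
  assumes u: "u \<in> Hs_net E l 1"
  defines "I \<equiv> primitive_net (\<lambda>e. trace_ivl (l e) (u e) 0) (proj_net (ddx l u))"
    and "r \<equiv> (\<lambda>e x. ddx l u e x - proj_net (ddx l u) e x)"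
  shows "norm_L2 E l (\<lambda>e x. u e x - I e x) \<le> (\<Sum>e\<in>E. l e) * norm_L2 E l r"
proof (rule norm_L2_leI)
  let ?\<Lambda> = "\<Sum>e\<in>E. l e"
  have "inner_L2_ivl (l e) (\<lambda>x. u e x - I e x) (\<lambda>x. u e x - I e x) \<le> ?\<Lambda>\<^sup>2 * inner_L2_ivl (l e) (r e) (r e)"
    if e: "e \<in> E" for e
  proof -
    interpret uniform_mesh "l e" "N e" by (rule uniform_mesh_edge[OF e])
    have "inner_L2_ivl (l e) (\<lambda>x. u e x - I e x) (\<lambda>x. u e x - I e x) \<le> (l e)\<^sup>2 * inner_L2_ivl (l e) (r e) (r e)"
      using cell_proj_primitive_error[OF Hs_edge[OF u e]]
      by (simp add: I_def r_def primitive_net_def proj_net_def ddx_def)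
    also have "\<dots> \<le> ?\<Lambda>\<^sup>2 * inner_L2_ivl (l e) (r e) (r e)"
      using l_pos finite_E e
      by (intro mult_right_mono power_mono inner_L2_nonneg member_le_sum) (auto simp: less_imp_le)
    finally show ?thesis .
  qed
  then have "inner_net E l (\<lambda>e x. u e x - I e x) (\<lambda>e x. u e x - I e x)
      \<le> (\<Sum>e\<in>E. ?\<Lambda>\<^sup>2 * inner_L2_ivl (l e) (r e) (r e))"
    unfolding inner_net_def by (intro sum_mono)
  also have "\<dots> = (?\<Lambda> * norm_L2 E l r)\<^sup>2"
    by (simp add: power_mult_distrib norm_L2_square inner_net_def sum_distrib_left)
  finally show "inner_net E l (\<lambda>e x. u e x - I e x) (\<lambda>e x. u e x - I e x) \<le> \<dots>" .
  show "0 \<le> ?\<Lambda> * norm_L2 E l r"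
    using l_pos by (simp add: sum_nonneg norm_L2_nonneg less_imp_le)
qed

text \<open>Quasi-optimality on one mesh: both errors are measured by projection errors alone, and
  the regularity of order \<open>m\<close> enters only afterwards. The inf-sup condition is a
  hypothesis with constant \<open>\<kappa>\<close>, so uniformity over meshes reduces to that of
  \<open>\<kappa>\<close>.\<close>

lemma galerkin_error:
  fixes a f g u p uh ph :: "'v netfun"
  assumes C: "0 < C0" "0 < C1" and a: "bounded_coeff E l C0 C1 a"
    and f: "f \<in> L2_net E l" and g: "g \<in> L2_net E l"
    and sol: "stationary_solution V E l a f g u p"
    and disc: "discrete_solution V E l N a f g uh ph"
    and \<kappa>: "0 \<le> \<kappa>"
      "\<And>c. \<exists>z\<in>Vh V E l N. (\<forall>e\<in>E. AE x in ivl (l e). ddx l z e x = step_net c e x) \<and>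
        norm_L2 E l z \<le> \<kappa> * norm_L2 E l (step_net c)"
  defines "\<Lambda> \<equiv> \<Sum>e\<in>E. l e"
  shows "norm_Hdiv E l (\<lambda>e x. u e x - uh e x) + norm_L2 E l (\<lambda>e x. p e x - ph e x)
    \<le> (1 + (1 + C1 / C0) * \<Lambda> * (1 + C1 * \<kappa>)) *
      (norm_L2 E l (\<lambda>e x. ddx l u e x - proj_net (ddx l u) e x) + norm_L2 E l (\<lambda>e x. p e x - proj_net p e x))"
proof -
  have u: "u \<in> Hdiv_net V E l" and p: "p \<in> H10_net V E l"
    and eq1: "\<And>e. e \<in> E \<Longrightarrow> AE x in ivl (l e). ddx l p e x + a e x * u e x = f e x"
    and eq2: "\<And>e. e \<in> E \<Longrightarrow> AE x in ivl (l e). ddx l u e x = g e x"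
    using sol by (auto simp: stationary_solution_def)
  have uh: "uh \<in> Vh V E l N" and ph: "ph \<in> Qh E l N"
    and deq1: "\<And>vh. vh \<in> Vh V E l N \<Longrightarrow>
        inner_net E l (\<lambda>e x. a e x * uh e x) vh - inner_net E l ph (ddx l vh) = inner_net E l f vh"
    and deq2: "\<And>qh. qh \<in> Qh E l N \<Longrightarrow> inner_net E l (ddx l uh) qh = inner_net E l g qh"
    using disc by (auto simp: discrete_solution_def)
  define d where "d = ddx l u"
  define I where "I = primitive_net (\<lambda>e. trace_ivl (l e) (u e) 0) (proj_net d)"
  define r where "r = (\<lambda>e x. d e x - proj_net d e x)"
  define X where "X = norm_L2 E l r"
  define Y where "Y = norm_L2 E l (\<lambda>e x. p e x - proj_net p e x)"
  have uH: "u \<in> Hs_net E l 1" and pH: "p \<in> Hs_net E l 1" and uhH: "uh \<in> Hs_net E l 1"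
    using u p uh by (auto intro: Hdiv_net_Hs H10_net_Hs Vh_Hdiv)
  note L2 = Hs_net_1_L2[OF uH] Hs_net_1_L2[OF pH] Hs_net_1_L2[OF uhH] ddx_L2[OF uH] ddx_L2[OF pH] ddx_L2[OF uhH]
  have d2: "d \<in> L2_net E l" using L2 by (simp add: d_def)
  have r2: "r \<in> L2_net E l" unfolding r_def by (intro L2_net_diff d2 proj_net_L2)
  have ph2: "ph \<in> L2_net E l" using ph by (simp add: Qh_def Pk_net_def)
  have I: "I \<in> Vh V E l N" unfolding I_def d_def by (rule interpolant_Vh[OF u])
  have IH: "I \<in> Hs_net E l 1" using I by (auto intro: Hdiv_net_Hs Vh_Hdiv)
  note I2 = Hs_net_1_L2[OF IH]
  note \<Lambda> = interpolation_error[OF uH, folded d_def, folded I_def r_def X_def \<Lambda>_def]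
  have \<Lambda>0: "0 \<le> \<Lambda>" unfolding \<Lambda>_def using l_pos by (intro sum_nonneg) (simp add: less_imp_le)
  have X0: "0 \<le> X" and Y0: "0 \<le> Y" by (simp_all add: X_def Y_def norm_L2_nonneg)
  let ?au = "\<lambda>e x. a e x * (u e x - uh e x)"
  have e2: "(\<lambda>e x. u e x - uh e x) \<in> L2_net E l" by (intro L2_net_diff L2)
  have au2: "?au \<in> L2_net E l" by (rule bounded_coeff_mult_L2[OF a e2 C(1)])
  have au_norm: "norm_L2 E l ?au \<le> C1 * norm_L2 E l (\<lambda>e x. u e x - uh e x)"
    by (rule norm_bounded_coeff_mult_le[OF a e2 C])

  \<comment> \<open>Galerkin identity: the continuous first equation tested with a discrete
    \<open>v\<close> and integrated by parts, minus the discrete one.\<close>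
  have galerkin: "inner_net E l ?au v = inner_net E l (\<lambda>e x. p e x - ph e x) (ddx l v)" if v: "v \<in> Vh V E l N" for v
  proof -
    have vH: "v \<in> Hs_net E l 1" using v by (auto intro: Hdiv_net_Hs Vh_Hdiv)
    note v2 = Hs_net_1_L2[OF vH] ddx_L2[OF vH]
    note au = bounded_coeff_mult_L2[OF a L2(1) C(1)] and auh = bounded_coeff_mult_L2[OF a L2(3) C(1)]
    have "inner_net E l f v = inner_net E l (\<lambda>e x. ddx l p e x + a e x * u e x) v"
    proof (intro inner_net_cong_AE f v2 L2_net_add L2 au)
      show "AE x in ivl (l e). f e x = ddx l p e x + a e x * u e x" if "e \<in> E" for e
        using eq1[OF that] by eventually_elim simp
    qed simp
    also have "\<dots> = inner_net E l (ddx l p) v + inner_net E l (\<lambda>e x. a e x * u e x) v"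
      by (rule inner_net_add_left[OF v2(1) L2(5) au])
    also have "inner_net E l (ddx l p) v = - inner_net E l p (ddx l v)"
      using network_integration_by_parts[OF p Vh_Hdiv[OF v]] by linarith
    finally have "inner_net E l (\<lambda>e x. a e x * u e x) v - inner_net E l (\<lambda>e x. a e x * uh e x) v
        = inner_net E l p (ddx l v) - inner_net E l ph (ddx l v)"
      using deq1[OF v] by linarith
    moreover have "?au = (\<lambda>e x. a e x * u e x - a e x * uh e x)"
      by (simp add: fun_eq_iff right_diff_distrib)
    ultimately show ?thesis
      by (simp add: inner_net_diff_left[OF v2(1) au auh] inner_net_diff_left[OF v2(2) L2(2) ph2])
  qed

  obtain c where c: "\<And>e. e \<in> E \<Longrightarrow> AE x in ivl (l e). ddx l uh e x = step_net c e x"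
    using Vh_ddx_AE_step_net[OF uh] by blast
  \<comment> \<open>\<open>\<delta>\<close> is the difference of \<open>ddx l uh\<close> and the
    projected derivative of \<open>u\<close>, up to null sets. It is a step function, hence
    admissible as a test function against itself.\<close>
  define \<delta> where "\<delta> = step_net (\<lambda>e i. c e i - mean_net d e i)"
  have \<delta>_eq: "\<delta> = (\<lambda>e x. step_net c e x - proj_net d e x)"
    by (simp add: \<delta>_def step_net_diff[symmetric] proj_net_eq)
  have \<delta>2: "\<delta> \<in> L2_net E l" by (simp add: \<delta>_def step_net_L2)
  have "inner_net E l \<delta> \<delta> = inner_net E l (step_net c) \<delta> - inner_net E l (proj_net d) \<delta>"
    by (subst (1) \<delta>_eq) (rule inner_net_diff_left[OF \<delta>2 step_net_L2 proj_net_L2])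
  also have "inner_net E l (step_net c) \<delta> = inner_net E l (ddx l uh) \<delta>"
  proof (intro inner_net_cong_AE step_net_L2 L2 \<delta>2)
    show "AE x in ivl (l e). step_net c e x = ddx l uh e x" if "e \<in> E" for e
      using c[OF that] by eventually_elim simp
  qed simp
  also have "\<dots> = inner_net E l g \<delta>"
    unfolding \<delta>_def by (rule deq2[OF step_net_Qh])
  also have "\<dots> = inner_net E l d \<delta>"
    unfolding d_def
  proof (intro inner_net_cong_AE g L2 \<delta>2)
    show "AE x in ivl (l e). g e x = ddx l u e x" if "e \<in> E" for e
      using eq2[OF that] by eventually_elim simp
  qed simp
  also have "inner_net E l (proj_net d) \<delta> = inner_net E l d \<delta>"
    unfolding \<delta>_def by (rule inner_proj_net_step_net[OF d2])
  finally have \<delta>0: "norm_L2 E l \<delta> = 0" by (simp add: norm_L2_def)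

  let ?v = "\<lambda>e x. uh e x - I e x"
  have v: "?v \<in> Vh V E l N" by (rule Vh_diff[OF uh I])
  have vH: "?v \<in> Hs_net E l 1" using v by (auto intro: Hdiv_net_Hs Vh_Hdiv)
  note v2 = Hs_net_1_L2[OF vH]
  have "AE x in ivl (l e). ddx l ?v e x = \<delta> e x" if e: "e \<in> E" for e
    using ddx_diff[OF uhH IH e] c[OF e] ddx_primitive_net[OF proj_net_L2 e, of "\<lambda>e. trace_ivl (l e) (u e) 0" d]
    by eventually_elim (simp add: I_def \<delta>_eq)
  then have "norm_L2 E l (ddx l ?v) = 0"
    using norm_L2_cong_AE[OF ddx_L2[OF vH] \<delta>2] \<delta>0 by simp
  \<comment> \<open>Since the norm of \<open>ddx l ?v\<close> is zero, Cauchy-Schwarz kills the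
    pressure term whatever the pressure error is.\<close>
  then have "inner_net E l ?au ?v = 0"
    using Cauchy_Schwarz_net[OF L2_net_diff[OF L2(2) ph2] ddx_L2[OF vH]] galerkin[OF v] by simp
  moreover have "inner_net E l (\<lambda>e x. a e x * (u e x - I e x)) ?v = inner_net E l ?au ?v + inner_net E l (\<lambda>e x. a e x * ?v e x) ?v"
  proof -
    \<comment> \<open>The splitting \<open>u - I = (u - uh) + (uh - I)\<close>; its first part is
      orthogonal to \<open>?v\<close> in the product weighted by \<open>a\<close>.\<close>
    have eq: "(\<lambda>e x. a e x * (u e x - I e x)) = (\<lambda>e x. a e x * (u e x - uh e x) + a e x * ?v e x)"
      by (simp add: fun_eq_iff algebra_simps)
    show ?thesis
      unfolding eq by (rule inner_net_add_left[OF v2 au2 bounded_coeff_mult_L2[OF a v2 C(1)]])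
  qed
  ultimately have "C0 * (norm_L2 E l ?v)\<^sup>2 \<le> inner_net E l (\<lambda>e x. a e x * (u e x - I e x)) ?v"
    using bounded_coeff_coercive[OF a v2 C(1)] by simp
  also have "\<dots> \<le> norm_L2 E l (\<lambda>e x. a e x * (u e x - I e x)) * norm_L2 E l ?v"
    using Cauchy_Schwarz_net[OF bounded_coeff_mult_L2[OF a L2_net_diff[OF L2(1) I2] C(1)] v2] by linarith
  also have "\<dots> \<le> C1 * (\<Lambda> * X) * norm_L2 E l ?v"
  proof (rule mult_right_mono)
    have "norm_L2 E l (\<lambda>e x. a e x * (u e x - I e x)) \<le> C1 * norm_L2 E l (\<lambda>e x. u e x - I e x)"
      by (rule norm_bounded_coeff_mult_le[OF a L2_net_diff[OF L2(1) I2] C])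
    also have "\<dots> \<le> C1 * (\<Lambda> * X)" using \<Lambda> C by (intro mult_left_mono) auto
    finally show "norm_L2 E l (\<lambda>e x. a e x * (u e x - I e x)) \<le> C1 * (\<Lambda> * X)" .
  qed (rule norm_L2_nonneg)
  finally have "norm_L2 E l ?v * (C0 * norm_L2 E l ?v) \<le> norm_L2 E l ?v * (C1 * (\<Lambda> * X))"
    by (simp add: power2_eq_square mult_ac)
  \<comment> \<open>Division by the norm of \<open>?v\<close>; if that norm is zero the claim is
    trivial.\<close>
  then have "C0 * norm_L2 E l ?v \<le> C1 * (\<Lambda> * X)"
    using norm_L2_nonneg[of E l ?v] C \<Lambda>0 X0 by (cases "norm_L2 E l ?v = 0") auto
  then have v_le: "norm_L2 E l ?v \<le> C1 / C0 * (\<Lambda> * X)"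
    using C by (simp add: field_simps)
  have u_err: "norm_L2 E l (\<lambda>e x. u e x - uh e x) \<le> (1 + C1 / C0) * \<Lambda> * X"
  proof -
    have nv: "norm_L2 E l (\<lambda>e x. (-1) * ?v e x) = norm_L2 E l ?v"
      by (rule norm_L2_minus)
    have eq: "(\<lambda>e x. u e x - uh e x) = (\<lambda>e x. (u e x - I e x) + (-1) * ?v e x)"
      by (simp add: fun_eq_iff)
    have "norm_L2 E l (\<lambda>e x. u e x - uh e x) \<le> norm_L2 E l (\<lambda>e x. u e x - I e x) + norm_L2 E l ?v"
      unfolding nv[symmetric] by (subst eq) (rule norm_L2_add_le[OF L2_net_diff[OF L2(1) I2] L2_net_cmult[OF v2]])
    then show ?thesis using \<Lambda> v_le by (simp add: algebra_simps)
  qed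

  have ddx_err: "norm_L2 E l (ddx l (\<lambda>e x. u e x - uh e x)) \<le> X"
  proof -
    have "norm_L2 E l (ddx l (\<lambda>e x. u e x - uh e x)) = norm_L2 E l (\<lambda>e x. r e x + (-1) * \<delta> e x)"
    proof (rule norm_L2_cong_AE)
      show "ddx l (\<lambda>e x. u e x - uh e x) \<in> L2_net E l" by (intro ddx_L2 Hs_net_1_diff uH uhH)
      show "(\<lambda>e x. r e x + - 1 * \<delta> e x) \<in> L2_net E l" by (intro L2_net_add L2_net_cmult r2 \<delta>2)
      show "AE x in ivl (l e). ddx l (\<lambda>e x. u e x - uh e x) e x = r e x + - 1 * \<delta> e x" if e: "e \<in> E" for e
        using ddx_diff[OF uH uhH e] c[OF e]
        by eventually_elim (simp add: r_def d_def[symmetric] \<delta>_eq)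
    qed
    also have "\<dots> \<le> norm_L2 E l r + norm_L2 E l (\<lambda>e x. (-1) * \<delta> e x)"
      by (rule norm_L2_add_le[OF r2 L2_net_cmult[OF \<delta>2]])
    also have "norm_L2 E l (\<lambda>e x. (-1) * \<delta> e x) = norm_L2 E l \<delta>"
      by (rule norm_L2_minus)
    finally show ?thesis by (simp add: X_def \<delta>0)
  qed

  obtain c' where c': "\<And>e. e \<in> E \<Longrightarrow> AE x in ivl (l e). ph e x = step_net c' e x"
    using Qh_AE_step_net[OF ph] by blast
  \<comment> \<open>The discrete pressure error, projected \<open>p\<close> minus \<open>ph\<close>.
    The inf-sup function \<open>z\<close> has it as derivative, so the Galerkin identity expresses
    its squared norm by the flux error.\<close>
  define \<rho> where "\<rho> = step_net (\<lambda>e i. mean_net p e i - c' e i)"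
  have \<rho>_eq: "\<rho> = (\<lambda>e x. proj_net p e x - step_net c' e x)"
    by (simp add: \<rho>_def step_net_diff[symmetric] proj_net_eq)
  have \<rho>2: "\<rho> \<in> L2_net E l" by (simp add: \<rho>_def step_net_L2)
  obtain z where z: "z \<in> Vh V E l N" "\<And>e. e \<in> E \<Longrightarrow> AE x in ivl (l e). ddx l z e x = \<rho> e x"
      "norm_L2 E l z \<le> \<kappa> * norm_L2 E l \<rho>"
    using \<kappa>(2)[of "\<lambda>e i. mean_net p e i - c' e i"] unfolding \<rho>_def by blast
  have zH: "z \<in> Hs_net E l 1" using z by (auto intro: Hdiv_net_Hs Vh_Hdiv)
  have "(norm_L2 E l \<rho>)\<^sup>2 = inner_net E l (proj_net p) \<rho> - inner_net E l (step_net c') \<rho>"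
    unfolding norm_L2_square by (subst (1) \<rho>_eq) (rule inner_net_diff_left[OF \<rho>2 proj_net_L2 step_net_L2])
  \<comment> \<open>Tested with a step function, the projection of \<open>p\<close> may be replaced
    by \<open>p\<close> itself, which brings in the full pressure error.\<close>
  also have "inner_net E l (proj_net p) \<rho> = inner_net E l p \<rho>"
    unfolding \<rho>_def by (rule inner_proj_net_step_net[OF L2(2)])
  also have "inner_net E l (step_net c') \<rho> = inner_net E l ph \<rho>"
  proof (intro inner_net_cong_AE step_net_L2 ph2 \<rho>2)
    show "AE x in ivl (l e). step_net c' e x = ph e x" if "e \<in> E" for e
      using c'[OF that] by eventually_elim simp
  qed simp
  also have "inner_net E l p \<rho> - inner_net E l ph \<rho> = inner_net E l (\<lambda>e x. p e x - ph e x) \<rho>"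
    by (rule inner_net_diff_left[OF \<rho>2 L2(2) ph2, symmetric])
  also have "\<dots> = inner_net E l (\<lambda>e x. p e x - ph e x) (ddx l z)"
  proof (intro inner_net_cong_AE L2_net_diff L2 ph2 \<rho>2 ddx_L2 zH)
    show "AE x in ivl (l e). \<rho> e x = ddx l z e x" if "e \<in> E" for e
      using z(2)[OF that] by eventually_elim simp
  qed simp
  also have "\<dots> = inner_net E l ?au z" by (rule galerkin[OF z(1), symmetric])
  also have "\<dots> \<le> norm_L2 E l ?au * norm_L2 E l z"
    using Cauchy_Schwarz_net[OF au2 Hs_net_1_L2[OF zH]] by linarith
  also have "\<dots> \<le> (C1 * ((1 + C1 / C0) * \<Lambda> * X)) * (\<kappa> * norm_L2 E l \<rho>)"
  proof (intro mult_mono z(3) norm_L2_nonneg)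
    show "norm_L2 E l ?au \<le> C1 * ((1 + C1 / C0) * \<Lambda> * X)"
      using au_norm mult_left_mono[OF u_err, of C1] C by linarith
    show "0 \<le> C1 * ((1 + C1 / C0) * \<Lambda> * X)" using C \<Lambda>0 X0 by simp
  qed
  finally have "norm_L2 E l \<rho> * norm_L2 E l \<rho> \<le> norm_L2 E l \<rho> * ((1 + C1 / C0) * \<Lambda> * (C1 * \<kappa>) * X)"
    by (simp add: power2_eq_square mult_ac)
  moreover have "0 \<le> (1 + C1 / C0) * \<Lambda> * (C1 * \<kappa>) * X" using C \<Lambda>0 X0 \<kappa>(1) by simp
  ultimately have \<rho>_le: "norm_L2 E l \<rho> \<le> (1 + C1 / C0) * \<Lambda> * (C1 * \<kappa>) * X"
    using norm_L2_nonneg[of E l \<rho>] by (cases "norm_L2 E l \<rho> = 0") auto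
  have p_err: "norm_L2 E l (\<lambda>e x. p e x - ph e x) \<le> Y + (1 + C1 / C0) * \<Lambda> * (C1 * \<kappa>) * X"
  proof -
    have "norm_L2 E l (\<lambda>e x. p e x - ph e x) = norm_L2 E l (\<lambda>e x. (p e x - proj_net p e x) + \<rho> e x)"
    proof (rule norm_L2_cong_AE)
      show "AE x in ivl (l e). p e x - ph e x = (p e x - proj_net p e x) + \<rho> e x" if e: "e \<in> E" for e
        using c'[OF e] by eventually_elim (simp add: \<rho>_eq)
    qed (intro L2_net_add L2_net_diff L2 ph2 proj_net_L2 \<rho>2)+
    also have "\<dots> \<le> Y + norm_L2 E l \<rho>"
      unfolding Y_def by (rule norm_L2_add_le[OF L2_net_diff[OF L2(2) proj_net_L2] \<rho>2])
    finally show ?thesis using \<rho>_le by linarith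
  qed
  have "norm_Hdiv E l (\<lambda>e x. u e x - uh e x)
      \<le> norm_L2 E l (\<lambda>e x. u e x - uh e x) + norm_L2 E l (ddx l (\<lambda>e x. u e x - uh e x))"
    unfolding norm_Hdiv_def by (rule sqrt_sum_squares_le_sum) (rule norm_L2_nonneg)+
  also have "\<dots> \<le> (1 + C1 / C0) * \<Lambda> * X + X" using u_err ddx_err by linarith
  finally have "norm_Hdiv E l (\<lambda>e x. u e x - uh e x) + norm_L2 E l (\<lambda>e x. p e x - ph e x)
      \<le> ((1 + C1 / C0) * \<Lambda> * X + X) + (Y + (1 + C1 / C0) * \<Lambda> * (C1 * \<kappa>) * X)"
    using p_err by linarith
  \<comment> \<open>The variable \<open>t\<close> shields the quotient in \<open>1 + C1 / C0\<close>
    from algebraic normalisation.\<close>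
  moreover have "(t * \<Lambda> * X + X) + (Y + t * \<Lambda> * (C1 * \<kappa>) * X) = (1 + t * \<Lambda> * (1 + C1 * \<kappa>)) * X + Y" for t
    by (simp add: algebra_simps)
  ultimately have "norm_Hdiv E l (\<lambda>e x. u e x - uh e x) + norm_L2 E l (\<lambda>e x. p e x - ph e x)
      \<le> (1 + (1 + C1 / C0) * \<Lambda> * (1 + C1 * \<kappa>)) * X + Y"
    by metis
  \<comment> \<open>\<open>Y\<close> carries the factor one and is enlarged to the factor of
    \<open>X\<close>, which is at least one.\<close>
  also have "\<dots> \<le> (1 + (1 + C1 / C0) * \<Lambda> * (1 + C1 * \<kappa>)) * (X + Y)"
  proof -
    have "0 \<le> (1 + C1 / C0) * \<Lambda> * (1 + C1 * \<kappa>)" using C \<Lambda>0 \<kappa>(1) by simp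
    then have "Y \<le> (1 + (1 + C1 / C0) * \<Lambda> * (1 + C1 * \<kappa>)) * Y"
      using Y0 by (simp add: mult_le_cancel_right1)
    then show ?thesis by (simp add: distrib_left)
  qed
  finally show ?thesis by (simp add: X_def Y_def r_def d_def)
qed

end

section \<open>Choice of the constant and the convergence estimate\<close>

theorem theorem8p3:
  fixes V :: "'v set" and E :: "('v \<times> 'v) set" and l :: "'v \<times> 'v \<Rightarrow> real"
    and C0 C1 :: real
  assumes "network V E l" and "boundary_vertices V E \<noteq> {}"
    and "C0 > 0" and "C1 > 0"
  shows "\<exists>C>0. \<forall>(a :: 'v netfun) (b :: 'v netfun) (c :: 'v netfun) (N :: 'v \<times> 'v \<Rightarrow> nat)
           (f :: 'v netfun) (g :: 'v netfun) (u :: 'v netfun) (p :: 'v netfun)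
           (uh :: 'v netfun) (ph :: 'v netfun) (m :: real).
         bounded_coeff E l C0 C1 a \<longrightarrow> bounded_coeff E l C0 C1 b \<longrightarrow> bounded_coeff E l C0 C1 c \<longrightarrow>
         is_mesh E N \<longrightarrow>
         f \<in> L2_net E l \<longrightarrow> g \<in> L2_net E l \<longrightarrow>
         stationary_solution V E l a f g u p \<longrightarrow>
         discrete_solution V E l N a f g uh ph \<longrightarrow>
         0 \<le> m \<longrightarrow> m \<le> 1 \<longrightarrow>
         u \<in> Hs_net E l (m + 1) \<longrightarrow> p \<in> Hs_net E l m \<longrightarrow>
         norm_Hdiv E l (\<lambda>e x. u e x - uh e x) + norm_L2 E l (\<lambda>e x. p e x - ph e x)
           \<le> C * mesh_size E l N powr m * (norm_Hs E l (m + 1) u + norm_Hs E l m p)"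
proof -
  \<comment> \<open>\<open>K\<close> is fixed here, before any mesh or coefficient is introduced, so
    it depends on the graph only.\<close>
  obtain K where K: "0 \<le> K" "\<And>d :: 'v \<Rightarrow> real. \<exists>s. (\<forall>v\<in>interior_vertices V E. (\<Sum>e\<in>incident_edges E v. incidence e v * s e) = d v)
    \<and> (\<forall>e\<in>E. \<bar>s e\<bar> \<le> K * (\<Sum>v\<in>V. \<bar>d v\<bar>))"
    using ex_flow[OF assms(1,2)] by blast
  have l_pos: "\<And>e. e \<in> E \<Longrightarrow> 0 < l e" using assms(1) by (simp add: network_def)
  define \<Lambda> where "\<Lambda> = (\<Sum>e\<in>E. l e)"
  \<comment> \<open>The constant delivered by \<open>inf_sup\<close>: edge lengths and graph data,
    with no trace of the mesh.\<close>
  define \<kappa> where "\<kappa> = K * real (card V) * (\<Sum>e\<in>E. sqrt (l e)) * sqrt \<Lambda> + \<Lambda>"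
  define C where "C = 1 + (1 + C1 / C0) * \<Lambda> * (1 + C1 * \<kappa>)"
  have \<Lambda>0: "0 \<le> \<Lambda>" unfolding \<Lambda>_def using l_pos by (intro sum_nonneg) (simp add: less_imp_le)
  have "0 \<le> (\<Sum>e\<in>E. sqrt (l e))" using l_pos by (intro sum_nonneg) (simp add: less_imp_le)
  then have \<kappa>0: "0 \<le> \<kappa>" using K(1) \<Lambda>0 by (simp add: \<kappa>_def)
  have C_pos: "C > 0"
    using assms(3,4) \<Lambda>0 \<kappa>0 unfolding C_def by (intro add_pos_nonneg mult_nonneg_nonneg) auto
  show ?thesis
  proof (intro exI[of _ C] conjI allI impI C_pos)
    fix a b c f g u p uh ph :: "'v netfun" and N :: "'v \<times> 'v \<Rightarrow> nat" and m :: real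
    assume a: "bounded_coeff E l C0 C1 a" and N: "is_mesh E N"
      and fg: "f \<in> L2_net E l" "g \<in> L2_net E l"
      and sol: "stationary_solution V E l a f g u p"
      and disc: "discrete_solution V E l N a f g uh ph"
      and m: "0 \<le> m" "m \<le> 1"
      and reg: "u \<in> Hs_net E l (m + 1)" "p \<in> Hs_net E l m"
    interpret network_mesh V E l N using assms(1) N by unfold_locales
    have uH: "u \<in> Hs_net E l 1" and pH: "p \<in> Hs_net E l 1"
      using sol by (auto simp: stationary_solution_def intro: Hdiv_net_Hs H10_net_Hs)
    have "\<exists>z\<in>Vh V E l N. (\<forall>e\<in>E. AE x in ivl (l e). ddx l z e x = step_net c e x) \<and>
        norm_L2 E l z \<le> \<kappa> * norm_L2 E l (step_net c)" for c
    proof -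
      obtain z where "z \<in> Vh V E l N" "\<And>e. e \<in> E \<Longrightarrow> AE x in ivl (l e). ddx l z e x = step_net c e x"
        "norm_L2 E l z \<le> \<kappa> * norm_L2 E l (step_net c)"
        using inf_sup[OF K, of c] unfolding \<kappa>_def \<Lambda>_def by blast
      then show ?thesis by blast
    qed
    then have "norm_Hdiv E l (\<lambda>e x. u e x - uh e x) + norm_L2 E l (\<lambda>e x. p e x - ph e x)
      \<le> C * (norm_L2 E l (\<lambda>e x. ddx l u e x - proj_net (ddx l u) e x) + norm_L2 E l (\<lambda>e x. p e x - proj_net p e x))"
      unfolding C_def \<Lambda>_def by (rule galerkin_error[OF assms(3,4) a fg sol disc \<kappa>0])
    also have "\<dots> \<le> C * (mesh_size E l N powr m * norm_Hs E l (m + 1) u + mesh_size E l N powr m * norm_Hs E l m p)"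
    proof (intro mult_left_mono add_mono)
      show "norm_L2 E l (\<lambda>e x. ddx l u e x - proj_net (ddx l u) e x) \<le> mesh_size E l N powr m * norm_Hs E l (m + 1) u"
        unfolding norm_Hs_def
        \<comment> \<open>Here \<open>B e\<close> is the squared norm of \<open>u e\<close> of order
          \<open>m + 1\<close>, which dominates that of its derivative of order
          \<open>m\<close>.\<close>
        by (rule proj_net_error[OF ddx_L2[OF uH] m])
          (use weak_deriv_Hs[OF Hs_edge[OF reg(1)] m l_pos] in \<open>simp add: ddx_def\<close>)
      show "norm_L2 E l (\<lambda>e x. p e x - proj_net p e x) \<le> mesh_size E l N powr m * norm_Hs E l m p"
        unfolding norm_Hs_def
        by (rule proj_net_error[OF Hs_net_1_L2[OF pH] m]) (use Hs_edge[OF reg(2)] in simp)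
    qed (use C_pos in simp)
    finally show "norm_Hdiv E l (\<lambda>e x. u e x - uh e x) + norm_L2 E l (\<lambda>e x. p e x - ph e x)
           \<le> C * mesh_size E l N powr m * (norm_Hs E l (m + 1) u + norm_Hs E l m p)"
      by (simp add: algebra_simps)
  qed
qed

end
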